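(* Let $0<\lambda\leq 1$, $\lambda'=1-\lambda$, and let $\epsilon(\lambda)=0$ if $0<\lambda<1$ and $\epsilon(\lambda)=1$ if $\lambda=1$. Let $s$ be a complex number with $s\neq 0,-1,-2,\ldots$ (and $s\ne 1$ if $\lambda=1$). Let the truncation indices $(N_k)_{k\ge 0}$ and $(N_k')_{k\ge 0}$ be increasing sequences of positive integers ($N_k<N_{k+1}$, $N_k'<N_{k+1}'$), and put $\nu_k=N_k+s$, $\nu_k'=N_k'+s$, where it is assumed that $\Re(\nu_k)>0$ and $\Re(\nu_k')>0$ for all $k$ occurring below. Put $N_{-1}=N_{-1}'=1$. Then for all complex $a\neq 0$ with $|\arg a|<\pi$, $$L(\lambda,a,s)=\frac{\epsilon(\lambda)a^{1-s}}{s-1}+a^{-s}\{1+F(\lambda,0)\}+\frac{(2\pi)^s}{\Gamma(s)}\sum_{m=0}^\infty{}' \left\{\frac{i}{2\pi}\,H_m(a;\lambda,\lambda')-\frac{e^{-\frac12\pi is}}{(m+\lambda)^{1-s}}\,R_m(\lambda,a;N_m)+\frac{e^{\frac12\pi is}}{(m+\lambda')^{1-s}}\,R_m'(\lambda',a;N_m')\right\},$$ where $$H_m(a;\lambda,\lambda')=\sum_{r=N_{m-1}}^{N_m-1} \frac{(-i)^r\, \Gamma(r+s)}{(2\pi a)^{r+s}}\,\zeta(r+1,m+\lambda)-\sum_{r=N_{m-1}'}^{N_m'-1} \frac{i^r\, \Gamma(r+s)}{(2\pi a)^{r+s}}\,\zeta(r+1,m+\lambda'),$$ $$R_m(\lambda,a;N_m)=e^{-iX_m-\pi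 is}\, T_{\nu_m}(-iX_m),\qquad R_m'(\lambda',a;N_m')=e^{iX_m'-\pi is}\, T_{\nu_m'}(iX_m'),$$ $$X_m=2\pi a(m+\lambda),\qquad X_m'=2\pi a(m+\lambda').$$ The prime on the summation sign indicates that, when $\lambda=1$ (so $\lambda'=0$), the terms corresponding to $m=0$ in the sums involving $\lambda'$ (that is, the second sum in $H_0$ and the term containing $R_0'$) are to be omitted.
   Context: The Lerch zeta function is defined for $\Re(s)>1$, $0<\lambda\leq 1$ and complex $a\neq 0,-1,-2,\ldots$ by $$L(\lambda,a,s)=\sum_{n=0}^\infty \frac{e^{2\pi n i\lambda}}{(n+a)^s},$$ and for other values of $s$ by analytic continuation. Throughout $|\arg a|<\pi$ and powers of $a$ take their principal values. $\zeta(s,a)=\sum_{n=0}^\infty (n+a)^{-s}$ (for $\Re(s)>1$, $a\ne 0,-1,-2,\ldots$) is the Hurwitz zeta function. The periodic zeta function is $F(\lambda,s)=\sum_{n=1}^\infty e^{2\pi n i\lambda}/n^s$ for $\Re(s)>1$, and is defined elsewhere by analytic continuation in $s$; in particular $F(\lambda,0)=e^{2\pi i\lambda}/(1-e^{2\pi i\lambda})$ for $0<\lambda<1$ and $F(1,0)=-\frac12$. The terminant function is $$T_\nu(z)=e^{\pi i\nu}\,\frac{\Gamma(\nu)}{2\pi i}\,\Gamma(1-\nu,z)\qquad (|\arg z|<\tfrac32\pi,\ \nu\neq 0,-1,-2,\ldots),$$ where $\Gamma(\alpha,z)$ is the upper incomplete gamma function, taking its principal value for $|\arg z|<\pi$ and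 continued analytically in $z$ to the sector $|\arg z|<\frac32\pi$ of the Riemann surface of the logarithm. The arguments are understood as $\arg(-iX_m)=\arg a-\frac12\pi$ and $\arg(iX_m')=\arg a+\frac12\pi$. Empty sums are zero.
   Formalization: Added: Σ_{1≤r<N_M}(-i)^rΓ(r+s)(2πa)^{-r-s}ζ(r+1,M+1+λ) − Σ_{1≤r<N'_M}i^rΓ(r+s)(2πa)^{-r-s}ζ(r+1,M+1+λ') → 0 as M→∞ (fails for fast-growing N_k, small a; then the series fails), and N'_0=1 if λ=1 (else H_1 lacks terms). *)

theory Defs
  imports "HOL-Complex_Analysis.Complex_Analysis"
begin

text \<open>
  The value at \<open>z\<close> of the analytic continuation of \<open>f\<close> from \<open>U\<close> to \<open>D\<close>. It is meaningful when \<open>D\<close> is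
  open and connected, \<open>U \<subseteq> D\<close> is open and nonempty, \<open>z \<in> D\<close>, and a continuation exists; see the
  lemma below for uniqueness.
\<close>

definition analytic_cont :: "complex set \<Rightarrow> complex set \<Rightarrow> (complex \<Rightarrow> complex) \<Rightarrow> complex \<Rightarrow> complex"
  where "analytic_cont D U f z =
    (THE w. \<exists>g. g holomorphic_on D \<and> (\<forall>x\<in>U. g x = f x) \<and> g z = w)"

lemma analytic_cont_eqI:
  assumes "open D" "connected D" "open U" "U \<noteq> {}" "U \<subseteq> D"
    and "g holomorphic_on D" "\<And>x. x \<in> U \<Longrightarrow> g x = f x" "z \<in> D"
  shows "analytic_cont D U f z = g z"
  unfolding analytic_cont_def
proof (rule the_equality)
  show "\<exists>h. h holomorphic_on D \<and> (\<forall>x\<in>U. h x = f x) \<and> h z = g z"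
    using assms by blast
next
  fix w assume "\<exists>h. h holomorphic_on D \<and> (\<forall>x\<in>U. h x = f x) \<and> h z = w"
  then obtain h where h: "h holomorphic_on D" "\<forall>x\<in>U. h x = f x" "h z = w"
    by blast
  have "h z = g z"
    by (rule analytic_continuation_open[OF \<open>open U\<close> \<open>open D\<close> \<open>U \<noteq> {}\<close> \<open>connected D\<close> \<open>U \<subseteq> D\<close>
          h(1) assms(6)]) (use assms h(2) in auto)
  with h(3) show "w = g z" by simp
qed

text \<open>
  For \<open>0 < \<lambda> < 1\<close> the functions below are entire in \<open>s\<close>; for \<open>\<lambda> = 1\<close> they have a simple pole at \<open>1\<close>.
\<close>

definition zeta_domain :: "real \<Rightarrow> complex set"
  where "zeta_domain l = (if l = 1 then - {1} else UNIV)"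

definition lerch :: "real \<Rightarrow> complex \<Rightarrow> complex \<Rightarrow> complex"
  where "lerch l a = analytic_cont (zeta_domain l) {s. Re s > 1}
    (\<lambda>s. \<Sum>n. exp (2 * of_real pi * of_nat n * \<i> * of_real l) / (of_nat n + a) powr s)"

definition periodic_zeta :: "real \<Rightarrow> complex \<Rightarrow> complex"
  where "periodic_zeta l = analytic_cont (zeta_domain l) {s. Re s > 1}
    (\<lambda>s. \<Sum>n. exp (2 * of_real pi * of_nat (Suc n) * \<i> * of_real l) / of_nat (Suc n) powr s)"

text \<open>Only meaningful for \<open>Re s > 1\<close>.\<close>

definition hurwitz_zeta :: "complex \<Rightarrow> complex \<Rightarrow> complex"
  where "hurwitz_zeta s a = (\<Sum>n. (of_nat n + a) powr (- s))"

text \<open>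
  The principal upper incomplete gamma function, for \<open>z\<close> off the closed negative real axis: the path
  of integration from \<open>z\<close> to \<open>\<infinity>\<close> is the horizontal half-line, which does not meet the cut.
\<close>

definition inc_Gamma_principal :: "complex \<Rightarrow> complex \<Rightarrow> complex"
  where "inc_Gamma_principal \<alpha> z =
    integral {0..} (\<lambda>u::real. (z + of_real u) powr (\<alpha> - 1) * exp (- (z + of_real u)))"

text \<open>
  A point \<open>z\<close> of the Riemann surface of the logarithm is represented by \<open>w = ln \<bar>z\<bar> + \<i> arg z\<close>, so that
  \<open>z\<close> lies over \<open>exp w\<close> and \<open>arg z = Im w\<close> is not restricted to \<open>(-\<pi>, \<pi>]\<close>.
\<close>

definition inc_Gamma :: "complex \<Rightarrow> complex \<Rightarrow> complex"
  where "inc_Gamma \<alpha> = analytic_cont {w. \<bar>Im w\<bar> < 3 / 2 * pi} {w. \<bar>Im w\<bar> < pi}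
    (\<lambda>w. inc_Gamma_principal \<alpha> (exp w))"

definition terminant :: "complex \<Rightarrow> complex \<Rightarrow> complex"
  where "terminant \<nu> w =
    exp (of_real pi * \<i> * \<nu>) * Gamma \<nu> / (2 * of_real pi * \<i>) * inc_Gamma (1 - \<nu>) w"

definition prev_index :: "(nat \<Rightarrow> nat) \<Rightarrow> nat \<Rightarrow> nat"
  where "prev_index N m = (case m of 0 \<Rightarrow> 1 | Suc k \<Rightarrow> N k)"

text \<open>
  The common shape of the two sums in \<open>H_m\<close>: \<open>j = -\<i>\<close> for the first and \<open>j = \<i>\<close> for the second, with
  \<open>r\<close> running over \<open>l \<le> r \<le> u - 1\<close>.
\<close>

definition gamma_zeta_sum :: "complex \<Rightarrow> complex \<Rightarrow> complex \<Rightarrow> nat \<Rightarrow> nat \<Rightarrow> real \<Rightarrow> complex"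
  where "gamma_zeta_sum j a s l u x =
    (\<Sum>r = l..<u. j ^ r * Gamma (of_nat r + s) / (2 * of_real pi * a) powr (of_nat r + s)
       * hurwitz_zeta (of_nat r + 1) (of_real x))"

text \<open>In the next two definitions \<open>l' = 1 - l\<close>; for \<open>l = 1\<close> the primed terms with \<open>m = 0\<close> are omitted.\<close>

definition H_term ::
    "real \<Rightarrow> real \<Rightarrow> (nat \<Rightarrow> nat) \<Rightarrow> (nat \<Rightarrow> nat) \<Rightarrow> complex \<Rightarrow> complex \<Rightarrow> nat \<Rightarrow> complex"
  where "H_term l l' N N' a s m =
    gamma_zeta_sum (- \<i>) a s (prev_index N m) (N m) (real m + l)
    - (if l = 1 \<and> m = 0 then 0
       else gamma_zeta_sum \<i> a s (prev_index N' m) (N' m) (real m + l'))"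

definition X_var :: "real \<Rightarrow> complex \<Rightarrow> nat \<Rightarrow> complex"
  where "X_var l a m = 2 * of_real pi * a * of_real (real m + l)"

text \<open>
  \<open>R_term\<close> involves the point \<open>-\<i> X\<close> with argument \<open>arg a - \<pi>/2\<close>, and \<open>R_term'\<close> the point \<open>\<i> X\<close> with
  argument \<open>arg a + \<pi>/2\<close>; these arguments may lie outside \<open>(-\<pi>, \<pi>]\<close>.
\<close>

definition R_term :: "real \<Rightarrow> complex \<Rightarrow> complex \<Rightarrow> nat \<Rightarrow> nat \<Rightarrow> complex"
  where "R_term l a s n m =
    exp (- \<i> * X_var l a m - of_real pi * \<i> * s)
    * terminant (of_nat n + s) (Complex (ln (norm (X_var l a m))) (Arg a - pi / 2))"

definition R_term' :: "real \<Rightarrow> complex \<Rightarrow> complex \<Rightarrow> nat \<Rightarrow> nat \<Rightarrow> complex"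
  where "R_term' l' a s n m =
    exp (\<i> * X_var l' a m - of_real pi * \<i> * s)
    * terminant (of_nat n + s) (Complex (ln (norm (X_var l' a m))) (Arg a + pi / 2))"

definition series_term ::
    "real \<Rightarrow> real \<Rightarrow> (nat \<Rightarrow> nat) \<Rightarrow> (nat \<Rightarrow> nat) \<Rightarrow> complex \<Rightarrow> complex \<Rightarrow> nat \<Rightarrow> complex"
  where "series_term l l' N N' a s m =
    \<i> / (2 * of_real pi) * H_term l l' N N' a s m
    - exp (- (1 / 2 * of_real pi * \<i> * s)) / of_real (real m + l) powr (1 - s)
        * R_term l a s (N m) m
    + (if l = 1 \<and> m = 0 then 0
       else exp (1 / 2 * of_real pi * \<i> * s) / of_real (real m + l') powr (1 - s)
              * R_term' l' a s (N' m) m)"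

text \<open>
  The part of the finite sums that belongs to indices beyond \<open>M\<close>. Write \<open>\<zeta>(r+1, x)\<close> as the sum of
  \<open>(k+x)\<^sup>-\<^sup>r\<^sup>-\<^sup>1\<close> over \<open>k\<close>. Then the sum of \<open>H_m\<close> over \<open>m \<le> M\<close> equals the sum, over \<open>m \<le> M\<close>, of the
  expansions belonging to \<open>(m+l)\<close> and \<open>(m+l')\<close> truncated at \<open>N m\<close> and \<open>N' m\<close>, plus this tail. The
  series of \<open>series_term\<close> therefore has the intended sum exactly when the tail tends to \<open>0\<close>. For
  sequences that grow faster than linearly (or for small \<open>a\<close>) the tail can diverge.
\<close>

definition rearrangement_tail ::
    "real \<Rightarrow> real \<Rightarrow> (nat \<Rightarrow> nat) \<Rightarrow> (nat \<Rightarrow> nat) \<Rightarrow> complex \<Rightarrow> complex \<Rightarrow> nat \<Rightarrow> complex"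
  where "rearrangement_tail l l' N N' a s M =
    gamma_zeta_sum (- \<i>) a s 1 (N M) (real M + 1 + l)
    - gamma_zeta_sum \<i> a s 1 (N' M) (real M + 1 + l')"

end

theory Submission
  imports Defs
begin

text \<open>
  Poisson summation turns the Lerch series into a sum over the frequencies \<open>y\<^sub>k = 2\<pi>(k + \<lambda>)\<close>,
  \<open>k \<in> \<int>\<close>: for \<open>Re s > 1\<close>,
  \<open>L(\<lambda>,a,s) = a\<^sup>-\<^sup>s/2 + \<Sum>\<^sub>k Q(y\<^sub>k,s,a)\<close> with
  \<open>Q(y,s,a) = \<integral>\<^sub>0\<^sup>\<infinity> e\<^sup>i\<^sup>y\<^sup>u (a+u)\<^sup>-\<^sup>s du\<close>, where \<open>k = m\<close> and \<open>k = -m-1\<close> are added up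
  together. The first gives \<open>y = 2\<pi>(m+\<lambda>)\<close>, the second \<open>y = -2\<pi>(m+\<lambda>')\<close>. The path \<open>a + u\<close>, \<open>u \<ge> 0\<close>, never
  meets the cut, so this makes sense for all \<open>a\<close> with \<open>|arg a| < \<pi>\<close>.

  Up to an elementary factor, \<open>Q(y,s,a)\<close> is the incomplete gamma function \<open>\<Gamma>(1-s, -iya)\<close> at the argument
  \<open>arg a \<mp> \<pi>/2\<close> (\<open>wave_tail_eq_power_transform\<close>), and this defines it for all \<open>s\<close>. The recurrence of
  \<open>\<Gamma>(\<alpha>,z)\<close> becomes integration by parts, \<open>iy Q(s) = s Q(s+1) - a\<^sup>-\<^sup>s\<close>. Integrating by parts \<open>N\<close> times splits off
  the first \<open>N\<close> terms of an asymptotic series and leaves a terminant of index \<open>N + s\<close>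
  (\<open>boundary_remainder_expansion\<close>, \<open>terminant_scaled\<close>). Hence an expansion truncated at \<open>N\<close> together with its
  terminant does not depend on \<open>N\<close>: it equals \<open>(s/(iy)) Q(s+1)\<close>, which is \<open>O(y\<^sup>-\<^sup>2)\<close>. The term
  \<open>-a\<^sup>-\<^sup>s/(iy)\<close> of index \<open>0\<close> is summed in closed form, and with \<open>a\<^sup>-\<^sup>s/2\<close> it gives
  \<open>a\<^sup>-\<^sup>s (1 + F(\<lambda>,0))\<close>. The frequency \<open>0\<close> occurs only for \<open>\<lambda> = 1\<close> and gives \<open>a\<^sup>1\<^sup>-\<^sup>s/(s-1)\<close>.

  The summation formula itself comes from a difference equation. Let \<open>E(a)\<close> be the right-hand side (\<open>lerch_expansion\<close>) and
  \<open>\<omega> = e\<^sup>2\<^sup>\<pi>\<^sup>i\<^sup>\<lambda>\<close>. Since \<open>Q(y\<^sub>k,s,a) - \<omega> Q(y\<^sub>k,s,a+1)\<close> is an integral over \<open>[0,1]\<close>, that is, a Fourier coefficient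
  of a smooth function, the value of a Fourier series at a jump (\<open>fourier_partial_sums\<close>) gives
  \<open>E(a) - \<omega> E(a+1) = a\<^sup>-\<^sup>s\<close>. As \<open>E(a+n) \<longlonglongrightarrow> 0\<close>, iteration yields the Lerch series. The bound
  \<open>O(y\<^sup>-\<^sup>2)\<close> holds locally uniformly in \<open>s \<in> \<complex>\<close>, so that \<open>E\<close> is also its analytic continuation; the case
  \<open>a = 1\<close>, \<open>s = 0\<close> is the value of \<open>F(\<lambda>,0)\<close>.

  It remains to sort the finite sums. Writing \<open>\<zeta>(r+1,x)\<close> as \<open>x\<^sup>-\<^sup>r\<^sup>-\<^sup>1 + \<zeta>(r+1,x+1)\<close> and inducting on \<open>M\<close>, the sum of
  \<open>H_term\<close> up to \<open>M\<close> is that of the truncated expansions plus \<open>rearrangement_tail\<close>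
  (\<open>gamma_zeta_sum_rearrange\<close>), and the latter tends to \<open>0\<close> by hypothesis.
\<close>


section \<open>Integrals along horizontal half-lines in the slit plane\<close>

lemma slit_plane_add_real:
  assumes "a \<notin> \<real>\<^sub>\<le>\<^sub>0" "0 \<le> u"
  shows "a + of_real u \<notin> (\<real>\<^sub>\<le>\<^sub>0 :: complex set)"
  using assms by (auto simp: complex_nonpos_Reals_iff)

lemma starlike_slit_plane: "starlike (- \<real>\<^sub>\<le>\<^sub>0 :: complex set)"
proof -
  have "(\<real>\<^sub>\<le>\<^sub>0 :: complex set) = of_real ` {..0}"
    by (auto simp: complex_nonpos_Reals_iff complex_eq_iff image_iff)
  then show ?thesis
    using starlike_slotted_complex_plane_left[of 0] by simp
qed

lemma closed_segment_slit_plane: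
  assumes "a \<notin> \<real>\<^sub>\<le>\<^sub>0"
  shows "closed_segment 1 a \<subseteq> - (\<real>\<^sub>\<le>\<^sub>0 :: complex set)"
proof -
  have "(\<real>\<^sub>\<le>\<^sub>0 :: complex set) = of_real ` {..0}"
    by (auto simp: complex_nonpos_Reals_iff complex_eq_iff image_iff)
  then show ?thesis
    using starlike_slotted_complex_plane_left_aux[of a 0 1] assms by simp
qed

text \<open>
  The dominating function in all estimates of integrals over \<open>[0,\<infinity>)\<close> below. The shift \<open>b\<close> keeps track of
  the decay of the tail from \<open>b\<close> on.
\<close>

lemma has_integral_shifted_powr_to_inf:
  fixes b p :: real
  assumes "b > 0" "p > 1"
  shows "((\<lambda>u. (b + u) powr (- p)) has_integral b powr (1 - p) / (p - 1)) {0..}"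
proof (rule has_integral_to_inf)
  define F where "F = (\<lambda>u. (b + u) powr (1 - p) / (1 - p))"
  have FTC: "((\<lambda>u. (b + u) powr (- p)) has_integral (F y - F 0)) {0..y}" if "0 \<le> y" for y
  proof (rule fundamental_theorem_of_calculus[OF that])
    fix x assume "x \<in> {0..y}"
    then have "(F has_field_derivative (b + x) powr (- p)) (at x)"
      unfolding F_def using assms by (auto intro!: derivative_eq_intros)
    then show "(F has_vector_derivative (b + x) powr (- p)) (at x within {0..y})"
      by (metis has_real_derivative_iff_has_vector_derivative has_vector_derivative_at_within)
  qed
  show "(\<lambda>u. (b + u) powr (- p)) integrable_on {0..y}" for y
  proof (cases "0 \<le> y")
    case True
    then show ?thesis using FTC by blast
  next
    case False
    then show ?thesis by (simp add: integrable_on_empty)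
  qed
  have L: "((\<lambda>y. F y - F 0) \<longlongrightarrow> 0 - F 0) at_top"
  proof (intro tendsto_intros)
    have "((\<lambda>u. (b + u) powr (1 - p)) \<longlongrightarrow> 0) at_top"
      by (rule tendsto_neg_powr)
         (use assms in \<open>auto intro!: filterlim_tendsto_add_at_top[OF tendsto_const] filterlim_ident\<close>)
    then show "(F \<longlongrightarrow> 0) at_top"
      unfolding F_def using tendsto_divide_zero by blast
  qed
  have v: "0 - F 0 = b powr (1 - p) / (p - 1)"
    using assms by (simp add: F_def field_simps)
  have ev: "eventually (\<lambda>y. F y - F 0 = integral {0..y} (\<lambda>u. (b + u) powr (- p))) at_top"
    using eventually_ge_at_top[of 0] by eventually_elim (rule integral_unique[OF FTC, symmetric])
  show "((\<lambda>y. integral {0..y} (\<lambda>u. (b + u) powr (- p))) \<longlongrightarrow> b powr (1 - p) / (p - 1)) at_top"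
    using Lim_transform_eventually[OF L ev] unfolding v .
qed auto

lemma improper_integral_powr_decay:
  fixes \<phi> :: "real \<Rightarrow> complex"
  assumes cont: "continuous_on {0..} \<phi>" and b: "b > 0" and p: "p > 1"
    and bound: "\<And>u. 0 \<le> u \<Longrightarrow> norm (\<phi> u) \<le> C * (b + u) powr (- p)"
  shows "\<phi> integrable_on {0..}"
    and "(\<lambda>n. integral {0..real n} \<phi>) \<longlonglongrightarrow> integral {0..} \<phi>"
    and "norm (integral {0..} \<phi>) \<le> C * (b powr (1 - p) / (p - 1))"
proof -
  define h where "h = (\<lambda>u. C * (b + u) powr (- p))"
  have h: "(h has_integral C * (b powr (1 - p) / (p - 1))) {0..}"
    unfolding h_def by (intro has_integral_mult_right has_integral_shifted_powr_to_inf b p)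
  define f where "f = (\<lambda>(n::nat) u. if u \<in> {0..real n} then \<phi> u else 0)"
  have sub: "{0..real n} \<inter> {0..} = {0..real n}" for n
    by auto
  have int: "\<phi> integrable_on {0..real n}" for n
    by (intro integrable_continuous_interval continuous_on_subset[OF cont]) auto
  have f_int: "f n integrable_on {0..}" for n
    unfolding f_def integrable_restrict_Int sub by (rule int)
  have f_le: "norm (f n u) \<le> h u" if "u \<in> {0..}" for n u
    using bound[of u] that by (auto simp: f_def h_def intro: order_trans[OF norm_ge_zero])
  have f_lim: "(\<lambda>n. f n u) \<longlonglongrightarrow> \<phi> u" if "u \<in> {0..}" for u
  proof (rule tendsto_eventually)
    show "\<forall>\<^sub>F n in sequentially. f n u = \<phi> u"
      using eventually_ge_at_top[of "nat \<lceil>u\<rceil>"] by eventually_elim (use that in \<open>auto simp: f_def\<close>)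
  qed
  have h_int: "h integrable_on {0..}"
    using h by blast
  show *: "\<phi> integrable_on {0..}"
    by (rule dominated_convergence(1)[of f, OF f_int h_int f_le f_lim])
  have "(\<lambda>n. integral {0..} (f n)) \<longlonglongrightarrow> integral {0..} \<phi>"
    by (rule dominated_convergence(2)[of f, OF f_int h_int f_le f_lim])
  moreover have "integral {0..} (f n) = integral {0..real n} \<phi>" for n
    unfolding f_def Henstock_Kurzweil_Integration.integral_restrict_Int sub by (rule refl)
  ultimately show "(\<lambda>n. integral {0..real n} \<phi>) \<longlonglongrightarrow> integral {0..} \<phi>"
    by simp
  have "norm (integral {0..} \<phi>) \<le> integral {0..} h"
    by (rule integral_norm_bound_integral[OF * h_int]) (use bound in \<open>auto simp: h_def\<close>)
  then show "norm (integral {0..} \<phi>) \<le> C * (b powr (1 - p) / (p - 1))"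
    using h by (simp add: integral_unique)
qed

text \<open>
  Both the principal incomplete gamma function and the Fourier integrals of powers are of this form. The half-line to
  the right of a point off the cut stays off the cut.
\<close>

definition tail_integral :: "(complex \<Rightarrow> complex) \<Rightarrow> complex \<Rightarrow> complex"
  where "tail_integral f z = integral {0..} (\<lambda>u::real. f (z + of_real u))"

lemma continuous_on_horizontal:
  assumes "f holomorphic_on - \<real>\<^sub>\<le>\<^sub>0" "z \<notin> \<real>\<^sub>\<le>\<^sub>0" "A \<subseteq> {0..}"
  shows "continuous_on A (\<lambda>u::real. f (z + of_real u))"
proof -
  have "continuous_on (- \<real>\<^sub>\<le>\<^sub>0) f"
    using assms(1) by (rule holomorphic_on_imp_continuous_on)
  then show ?thesis
    by (rule continuous_on_compose2)
       (use assms slit_plane_add_real in \<open>auto intro!: continuous_intros\<close>)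
qed

text \<open>
  The bound is required locally uniformly in the starting point, because the derivative of
  \<open>tail_integral f\<close> is found by comparing tails from neighbouring points.
\<close>

locale decaying_on_slit_plane =
  fixes f :: "complex \<Rightarrow> complex"
  assumes hol: "f holomorphic_on - \<real>\<^sub>\<le>\<^sub>0"
    and decay: "\<And>z. z \<notin> \<real>\<^sub>\<le>\<^sub>0 \<Longrightarrow> \<exists>e>0. \<exists>C. \<exists>p>1. \<forall>w\<in>ball z e. \<forall>u\<ge>0.
                  norm (f (w + of_real u)) \<le> C * (1 + u) powr (- p)"
begin

lemma primitive:
  obtains P where "\<And>z. z \<notin> \<real>\<^sub>\<le>\<^sub>0 \<Longrightarrow> (P has_field_derivative f z) (at z)"
proof -
  have "\<exists>g. \<forall>x\<in>- \<real>\<^sub>\<le>\<^sub>0. (g has_field_derivative f x) (at x)"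
    by (rule holomorphic_starlike_primitive[OF holomorphic_on_imp_continuous_on[OF hol]
          starlike_slit_plane _ finite.emptyI])
       (use hol in \<open>auto intro!: holomorphic_on_imp_differentiable_at[where s = "- \<real>\<^sub>\<le>\<^sub>0"]\<close>)
  then show ?thesis using that by auto
qed

lemma integral_primitive:
  assumes P: "\<And>z. z \<notin> \<real>\<^sub>\<le>\<^sub>0 \<Longrightarrow> (P has_field_derivative f z) (at z)"
    and z: "z \<notin> \<real>\<^sub>\<le>\<^sub>0" and "0 \<le> b"
  shows "integral {0..b} (\<lambda>u. f (z + of_real u)) = P (z + of_real b) - P z"
proof -
  have "((\<lambda>u. f (z + of_real u)) has_integral (P (z + of_real b) - P (z + of_real 0))) {0..b}"
  proof (rule fundamental_theorem_of_calculus[OF \<open>0 \<le> b\<close>])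
    fix x assume "x \<in> {0..b}"
    then have "(P has_field_derivative f (z + of_real x)) (at (z + of_real x))"
      by (intro P slit_plane_add_real z) auto
    moreover have "((+) z has_field_derivative 1) (at (of_real x))"
      by (auto intro!: derivative_eq_intros)
    ultimately have "((\<lambda>w. P (z + w)) has_field_derivative f (z + of_real x)) (at (of_real x))"
      using DERIV_chain2 by fastforce
    then show "((\<lambda>u. P (z + of_real u)) has_vector_derivative f (z + of_real x)) (at x within {0..b})"
      by (rule has_vector_derivative_real_field)
  qed
  then show ?thesis by (simp add: integral_unique)
qed

lemma tail_integral_limit:
  assumes z: "z \<notin> \<real>\<^sub>\<le>\<^sub>0"
  shows "(\<lambda>n. integral {0..real n} (\<lambda>u. f (z + of_real u))) \<longlonglongrightarrow> tail_integral f z"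
proof -
  obtain e C p where *: "e > 0" "p > 1"
      "\<forall>w\<in>ball z e. \<forall>u\<ge>0. norm (f (w + of_real u)) \<le> C * (1 + u) powr (- p)"
    using decay[OF z] by blast
  show ?thesis
    unfolding tail_integral_def
    by (rule improper_integral_powr_decay(2)[OF continuous_on_horizontal[OF hol z] zero_less_one \<open>p > 1\<close>])
       (use * in auto)
qed

text \<open>
  Along each horizontal half-line a primitive has a limit at infinity, and the integral is that limit minus
  the value of the primitive.
\<close>

lemma tail_integral_eq_limit_minus_primitive:
  assumes P: "\<And>z. z \<notin> \<real>\<^sub>\<le>\<^sub>0 \<Longrightarrow> (P has_field_derivative f z) (at z)"
    and z: "z \<notin> \<real>\<^sub>\<le>\<^sub>0"
  shows "(\<lambda>n. P (z + of_nat n)) \<longlonglongrightarrow> tail_integral f z + P z"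
proof -
  have eq: "integral {0..real n} (\<lambda>u. f (z + of_real u)) = P (z + of_nat n) - P z" for n
    using integral_primitive[OF P z, of "real n"] by simp
  have "(\<lambda>n. P (z + of_nat n) - P z) \<longlonglongrightarrow> tail_integral f z"
    using tail_integral_limit[OF z] unfolding eq .
  from tendsto_add[OF this tendsto_const[of "P z"]] show ?thesis by simp
qed

text \<open>
  The limit of a primitive \<open>P\<close> at the right end is locally constant: by the mean value inequality
  \<open>|P(w+n) - P(z+n)|\<close> is at most \<open>|w-z|\<close> times the supremum of \<open>f\<close> near \<open>z+n\<close>, which tends to \<open>0\<close>. So
  \<open>tail_integral f\<close> is locally a constant minus \<open>P\<close>, and no differentiation under the integral sign is needed.
\<close>

lemma DERIV_tail_integral:
  assumes z: "z \<notin> \<real>\<^sub>\<le>\<^sub>0"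
  shows "(tail_integral f has_field_derivative - f z) (at z)"
proof -
  obtain P where P: "\<And>z. z \<notin> \<real>\<^sub>\<le>\<^sub>0 \<Longrightarrow> (P has_field_derivative f z) (at z)"
    using primitive by blast
  obtain e C p where e: "e > 0" and p: "p > 1" and
      bound: "\<And>w u. w \<in> ball z e \<Longrightarrow> 0 \<le> u \<Longrightarrow> norm (f (w + of_real u)) \<le> C * (1 + u) powr (- p)"
    using decay[OF z] by blast
  have "open (- \<real>\<^sub>\<le>\<^sub>0 :: complex set)" by (simp add: open_Compl)
  then obtain d where d: "d > 0" "ball z d \<subseteq> - \<real>\<^sub>\<le>\<^sub>0"
    using z open_contains_ball_eq by blast
  define r where "r = min d e"
  have r: "r > 0" "ball z r \<subseteq> - \<real>\<^sub>\<le>\<^sub>0" "ball z r \<subseteq> ball z e"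
    using d e by (auto simp: r_def)
  have const: "tail_integral f w + P w = tail_integral f z + P z" if w: "w \<in> ball z r" for w
  proof -
    have "norm (P (w + of_nat n) - P (z + of_nat n)) \<le> C * (1 + real n) powr (- p) * norm (w - z)" for n
    proof -
      have "norm ((\<lambda>x. P (x + of_nat n)) w - (\<lambda>x. P (x + of_nat n)) z)
              \<le> C * (1 + real n) powr (- p) * norm (w - z)"
      proof (rule field_differentiable_bound[OF convex_ball])
        fix x assume x: "x \<in> ball z r"
        then have "x + of_real (real n) \<notin> \<real>\<^sub>\<le>\<^sub>0"
          by (intro slit_plane_add_real) (use r in auto)
        then have "(P has_field_derivative f (x + of_nat n)) (at (x + of_nat n))"
          by (intro P) auto
        then show "((\<lambda>x. P (x + of_nat n)) has_field_derivative f (x + of_nat n)) (at x within ball z r)"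
          by (simp add: DERIV_shift has_field_derivative_at_within)
        show "norm (f (x + of_nat n)) \<le> C * (1 + real n) powr (- p)"
          using bound[of x "real n"] x r by auto
      qed (use w r in auto)
      then show ?thesis by simp
    qed
    moreover have "(\<lambda>n. C * (1 + real n) powr (- p) * norm (w - z)) \<longlonglongrightarrow> 0"
    proof (intro tendsto_mult_left_zero tendsto_mult_right_zero tendsto_neg_powr)
      show "filterlim (\<lambda>n. 1 + real n) at_top sequentially"
        by (intro filterlim_tendsto_add_at_top[OF tendsto_const] filterlim_real_sequentially)
    qed (use p in auto)
    ultimately have "(\<lambda>n. P (w + of_nat n) - P (z + of_nat n)) \<longlonglongrightarrow> 0"
      by (rule Lim_null_comparison[OF always_eventually[OF allI]])
    moreover have "(\<lambda>n. P (w + of_nat n) - P (z + of_nat n)) \<longlonglongrightarrow>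
        (tail_integral f w + P w) - (tail_integral f z + P z)"
      by (intro tendsto_diff tail_integral_eq_limit_minus_primitive P z) (use w r in auto)
    ultimately show ?thesis
      using LIMSEQ_unique by fastforce
  qed
  have "((\<lambda>w. (tail_integral f z + P z) - P w) has_field_derivative 0 - f z) (at z)"
    by (intro derivative_intros P z)
  then have "((\<lambda>w. (tail_integral f z + P z) - P w) has_field_derivative - f z) (at z)" by simp
  then show ?thesis
  proof (rule has_field_derivative_transform_within[where d = r])
    fix w assume "dist w z < r"
    then have "w \<in> ball z r" by (simp add: dist_commute)
    from const[OF this] show "(tail_integral f z + P z) - P w = tail_integral f w"
      by (simp add: algebra_simps)
  qed (use r in auto)
qed

lemma integral_eq_tail_integral_diff:
  assumes z: "z \<notin> \<real>\<^sub>\<le>\<^sub>0" and "0 \<le> b"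
  shows "integral {0..b} (\<lambda>u. f (z + of_real u)) = tail_integral f z - tail_integral f (z + of_real b)"
proof -
  have "((\<lambda>w. - tail_integral f w) has_field_derivative f w) (at w)" if "w \<notin> \<real>\<^sub>\<le>\<^sub>0" for w
    using DERIV_minus[OF DERIV_tail_integral[OF that]] by simp
  from integral_primitive[OF this z \<open>0 \<le> b\<close>] show ?thesis by simp
qed

lemma tail_integral_tendsto_0:
  assumes z: "z \<notin> \<real>\<^sub>\<le>\<^sub>0"
  shows "(\<lambda>n. tail_integral f (z + of_nat n)) \<longlonglongrightarrow> 0"
proof -
  have "(\<lambda>n. tail_integral f z - tail_integral f (z + of_nat n)) \<longlonglongrightarrow> tail_integral f z"
    using tail_integral_limit[OF z] unfolding integral_eq_tail_integral_diff[OF z of_nat_0_le_iff]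
    by (simp only: of_real_of_nat_eq)
  from tendsto_diff[OF tendsto_const[of "tail_integral f z"] this] show ?thesis by simp
qed

end

text \<open>
  The point \<open>(a+u)/(1+u)\<close> lies on the segment from \<open>1\<close> to \<open>a\<close>, which is compact and avoids \<open>0\<close>.
\<close>

lemma slit_plane_norm_lower_bound:
  fixes a :: complex
  assumes "a \<notin> \<real>\<^sub>\<le>\<^sub>0"
  obtains c where "0 < c" "c \<le> 1"
    "\<And>w u. w \<in> ball a c \<Longrightarrow> 0 \<le> u \<Longrightarrow> c * (1 + u) \<le> norm (w + of_real u)"
proof -
  have "0 \<notin> closed_segment 1 a"
    using closed_segment_slit_plane[OF assms] by auto
  then obtain d where d: "d > 0" "\<And>x. x \<in> closed_segment 1 a \<Longrightarrow> d \<le> dist 0 x"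
    using separate_point_closed[OF closed_segment] by blast
  define c where "c = min 1 (d / 2)"
  show ?thesis
  proof (rule that[of c])
    show "0 < c" "c \<le> 1" using d by (auto simp: c_def)
    fix w and u :: real assume w: "w \<in> ball a c" and u: "0 \<le> u"
    define x where "x = (1 - 1 / (1 + u)) *\<^sub>R 1 + (1 / (1 + u)) *\<^sub>R a"
    have "x \<in> closed_segment 1 a"
      unfolding x_def closed_segment_def using u by (auto intro!: exI[of _ "1 / (1 + u)"])
    then have "d \<le> norm x" using d(2) by fastforce
    moreover have "(1 + u) *\<^sub>R x = a + of_real u"
      using u unfolding x_def
      by (simp add: scaleR_add_right scaleR_scaleR right_diff_distrib) (simp add: scaleR_conv_of_real)
    ultimately have "d * (1 + u) \<le> norm (a + of_real u)"
      using u by (metis abs_of_nonneg add_nonneg_nonneg mult.commute mult_left_mono norm_scaleR zero_le_one)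
    moreover have "norm (a + of_real u) \<le> norm (w + of_real u) + c"
      using w norm_triangle_ineq4[of "w + of_real u" "w - a"] by (simp add: dist_norm norm_minus_commute add.commute)
    moreover have "c \<le> c * (1 + u)" "c * (1 + u) \<le> d / 2 * (1 + u)"
      using u \<open>0 < c\<close> by (auto simp: c_def intro!: mult_right_mono)
    ultimately show "c * (1 + u) \<le> norm (w + of_real u)" by simp
  qed
qed

text \<open>
  The constant is uniform in \<open>w\<close> near \<open>a\<close> and in bounded \<open>\<nu>\<close>. Uniformity in \<open>w\<close> is used for the derivative in \<open>a\<close>,
  uniformity in \<open>\<nu>\<close> for holomorphy in \<open>\<nu>\<close>.
\<close>

lemma powr_decay_on_slit_plane:
  fixes a :: complex
  assumes a: "a \<notin> \<real>\<^sub>\<le>\<^sub>0" and \<sigma>: "0 \<le> \<sigma>"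
  obtains e C where "0 < e" "0 < C"
    "\<And>w u \<nu>. w \<in> ball a e \<Longrightarrow> 0 \<le> u \<Longrightarrow> \<sigma> \<le> Re \<nu> \<Longrightarrow> norm \<nu> \<le> S \<Longrightarrow>
       norm ((w + of_real u) powr (- \<nu>)) \<le> C * (1 + u) powr (- \<sigma>)"
proof -
  obtain c where c: "0 < c" "c \<le> 1"
    "\<And>w u. w \<in> ball a c \<Longrightarrow> 0 \<le> u \<Longrightarrow> c * (1 + u) \<le> norm (w + of_real u)"
    using slit_plane_norm_lower_bound[OF a] by blast
  show ?thesis
  proof (rule that[of c "c powr (- S) * exp (S * pi)"])
    fix w \<nu> and u :: real
    assume w: "w \<in> ball a c" and u: "0 \<le> u" and \<nu>: "\<sigma> \<le> Re \<nu>" "norm \<nu> \<le> S"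
    have R: "Re \<nu> \<le> S" "\<bar>Im \<nu>\<bar> \<le> S"
      using \<nu>(2) abs_Re_le_cmod[of \<nu>] abs_Im_le_cmod[of \<nu>] by linarith+
    have "Im \<nu> * Arg (w + of_real u) \<le> \<bar>Im \<nu>\<bar> * \<bar>Arg (w + of_real u)\<bar>"
      by (simp flip: abs_mult)
    also have "\<dots> \<le> S * pi"
      using R Arg_bounded[of "w + of_real u"] by (intro mult_mono) auto
    finally have A: "exp (Im \<nu> * Arg (w + of_real u)) \<le> exp (S * pi)" by simp
    have "norm (w + of_real u) powr (- Re \<nu>) \<le> (c * (1 + u)) powr (- Re \<nu>)"
      using c(3)[OF w u] c(1) u \<nu>(1) \<sigma> by (intro powr_mono2') auto
    also have "\<dots> = c powr (- Re \<nu>) * (1 + u) powr (- Re \<nu>)"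
      using c(1) u by (simp add: powr_mult)
    also have "\<dots> \<le> c powr (- S) * (1 + u) powr (- \<sigma>)"
      using c(1,2) u \<nu>(1) R by (intro mult_mono powr_mono powr_mono') auto
    finally have B: "norm (w + of_real u) powr (- Re \<nu>) \<le> c powr (- S) * (1 + u) powr (- \<sigma>)" .
    have "norm ((w + of_real u) powr (- \<nu>))
        = norm (w + of_real u) powr (- Re \<nu>) * exp (Im \<nu> * Arg (w + of_real u))"
      by (simp add: norm_powr_complex)
    also have "\<dots> \<le> (c powr (- S) * (1 + u) powr (- \<sigma>)) * exp (S * pi)"
      using A B by (intro mult_mono) auto
    finally show "norm ((w + of_real u) powr (- \<nu>)) \<le> c powr (- S) * exp (S * pi) * (1 + u) powr (- \<sigma>)"
      by (simp add: mult_ac)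
  qed (use c in auto)
qed

section \<open>The incomplete gamma function in the logarithmic coordinate\<close>

lemma abs_Im_Ln_less_pi:
  assumes "z \<notin> \<real>\<^sub>\<le>\<^sub>0"
  shows "\<bar>Im (Ln z)\<bar> < pi"
proof -
  have "z \<noteq> 0" using assms by auto
  then have "Im (Ln z) \<noteq> pi" "- pi < Im (Ln z)" "Im (Ln z) \<le> pi"
    using assms Im_Ln_eq_pi[of z] mpi_less_Im_Ln[of z] Im_Ln_le_pi[of z]
    by (auto simp: complex_nonpos_Reals_iff)
  then show ?thesis by linarith
qed

lemma exp_notin_nonpos_Reals:
  assumes "\<bar>Im w\<bar> < pi"
  shows "exp w \<notin> \<real>\<^sub>\<le>\<^sub>0"
proof
  assume "exp w \<in> \<real>\<^sub>\<le>\<^sub>0"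
  moreover have "Ln (exp w) = w" using assms by (intro Ln_exp) auto
  moreover have "Re (exp w) \<noteq> 0 \<or> Im (exp w) \<noteq> 0"
    using exp_not_eq_zero[of w] complex_eq_iff[of "exp w" 0] by simp
  ultimately have "Im w = pi"
    using Im_Ln_eq_pi[OF exp_not_eq_zero, of w] by (auto simp: complex_nonpos_Reals_iff)
  then show False using assms by simp
qed

lemma open_strip: "open {w. \<bar>Im w\<bar> < b}"
  by (intro open_Collect_less continuous_intros)

lemma convex_strip: "convex {w. \<bar>Im w\<bar> < b}"
proof -
  have "{w. \<bar>Im w\<bar> < b} = {w. Im w < b} \<inter> {w. Im w > - b}" by auto
  then show ?thesis
    by (simp add: convex_Int convex_halfspace_Im_lt convex_halfspace_Im_gt)
qed

lemma power_times_exp_minus_bound: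
  fixes t :: real
  assumes "0 < t"
  shows "t ^ n * exp (- t) \<le> fact (n + 2) * t powr (- 2)"
proof -
  have sums: "(\<lambda>k. t ^ k / fact k) sums exp t"
    using exp_converges[of t] by (simp add: divide_inverse mult.commute)
  have "t ^ (n + 2) / fact (n + 2) = (\<Sum>k\<in>{n + 2}. t ^ k / fact k)" by simp
  also have "\<dots> \<le> (\<Sum>k. t ^ k / fact k)"
    using sums assms by (intro sum_le_suminf) (auto simp: sums_iff)
  also have "\<dots> = exp t"
    using sums by (simp add: sums_iff)
  finally have "t ^ (n + 2) \<le> exp t * fact (n + 2)"
    unfolding pos_divide_le_eq[OF fact_gt_zero] .
  then have "t ^ (n + 2) * (t powr (- 2) * exp (- t)) \<le> exp t * fact (n + 2) * (t powr (- 2) * exp (- t))"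
    by (intro mult_right_mono) auto
  moreover have "t ^ (n + 2) * t powr (- 2) = t ^ n"
    using assms by (simp add: powr_minus_divide power_add power2_eq_square)
  moreover have "exp t * exp (- t) = 1"
    by (simp flip: exp_add)
  ultimately show ?thesis by (metis (no_types, lifting) mult.assoc mult.commute mult.right_neutral)
qed

text \<open>
  For \<open>Re \<alpha> > 1\<close> the power grows. It is written as a decaying power times \<open>z\<^sup>n\<close>, and the exponential absorbs \<open>z\<^sup>n\<close>.
\<close>

lemma decaying_inc_Gamma_integrand:
  "decaying_on_slit_plane (\<lambda>z. z powr (\<alpha> - 1) * exp (- z))"
proof
  show "(\<lambda>z. z powr (\<alpha> - 1) * exp (- z)) holomorphic_on - \<real>\<^sub>\<le>\<^sub>0"
    by (intro holomorphic_intros) auto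
next
  fix a :: complex assume a: "a \<notin> \<real>\<^sub>\<le>\<^sub>0"
  \<comment> \<open>large enough for the exponent \<open>-\<nu> = \<alpha> - 1 - n\<close> to have nonpositive real part\<close>
  define n where "n = nat \<lceil>\<bar>Re \<alpha>\<bar>\<rceil>"
  define \<nu> where "\<nu> = 1 - \<alpha> + of_nat n"
  have \<nu>: "0 \<le> Re \<nu>" unfolding \<nu>_def n_def by simp linarith
  obtain e C where e: "0 < e" "0 < C" and bound:
    "\<And>w u \<mu>. w \<in> ball a e \<Longrightarrow> 0 \<le> u \<Longrightarrow> 0 \<le> Re \<mu> \<Longrightarrow> norm \<mu> \<le> norm \<nu> \<Longrightarrow>
       norm ((w + of_real u) powr (- \<mu>)) \<le> C * (1 + u) powr (- 0)"
    using powr_decay_on_slit_plane[OF a order_refl, of "norm \<nu>"] by blast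
  define K where "K = norm a + 1"
  have K: "0 < K" "1 \<le> K" by (auto simp: K_def add_nonneg_pos)
  have main: "norm ((w + of_real u) powr (\<alpha> - 1) * exp (- (w + of_real u)))
      \<le> C * K ^ n * exp (K + 1) * fact (n + 2) * (1 + u) powr (- 2)"
    if w: "w \<in> ball a (min e 1)" and u: "0 \<le> u" for w and u :: real
  proof -
    have nw: "norm w \<le> K"
      using w norm_triangle_ineq4[of a "a - w"] by (simp add: K_def dist_norm)
    have "norm (w + of_real u) \<le> norm w + u"
      using norm_triangle_ineq[of w "of_real u"] u by simp
    also have "\<dots> \<le> K + K * u"
      using nw K u mult_right_mono[of 1 K u] by simp
    finally have B: "norm (w + of_real u) ^ n \<le> (K * (1 + u)) ^ n"
      by (intro power_mono) (auto simp: algebra_simps)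
    have A: "norm ((w + of_real u) powr (- \<nu>)) \<le> C"
      using bound[of w u \<nu>] w u \<nu> by simp
    have "(w + of_real u) powr (\<alpha> - 1) = (w + of_real u) powr (- \<nu>) * (w + of_real u) ^ n"
    proof (cases "w + of_real u = 0")
      case False
      have "\<alpha> - 1 = - \<nu> + of_nat n" by (simp add: \<nu>_def)
      then show ?thesis using False by (metis powr_add powr_complexpow)
    qed simp
    then have "norm ((w + of_real u) powr (\<alpha> - 1)) \<le> C * (K * (1 + u)) ^ n"
      using A B e by (simp add: norm_mult norm_power mult_mono)
    moreover have "norm (exp (- (w + of_real u))) \<le> exp (K + 1) * exp (- (1 + u))"
      using nw abs_Re_le_cmod[of w] by (simp flip: exp_add)
    ultimately have "norm ((w + of_real u) powr (\<alpha> - 1) * exp (- (w + of_real u)))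
        \<le> (C * (K * (1 + u)) ^ n) * (exp (K + 1) * exp (- (1 + u)))"
      unfolding norm_mult using K e u by (intro mult_mono) auto
    also have "\<dots> = C * K ^ n * exp (K + 1) * ((1 + u) ^ n * exp (- (1 + u)))"
      by (simp add: power_mult_distrib mult_ac)
    also have "\<dots> \<le> C * K ^ n * exp (K + 1) * (fact (n + 2) * (1 + u) powr (- 2))"
      using power_times_exp_minus_bound[of "1 + u" n] u K e by (intro mult_left_mono) auto
    finally show ?thesis by (simp add: mult_ac)
  qed
  show "\<exists>e>0. \<exists>C. \<exists>p>1. \<forall>w\<in>ball a e. \<forall>u\<ge>0.
      norm ((w + of_real u) powr (\<alpha> - 1) * exp (- (w + of_real u))) \<le> C * (1 + u) powr (- p)"
    using main e by (intro exI[of _ "min e 1"] conjI exI[of _ "C * K ^ n * exp (K + 1) * fact (n + 2)"]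
        exI[of _ "2::real"]) auto
qed

lemma inc_Gamma_principal_eq_tail_integral:
  "inc_Gamma_principal \<alpha> = tail_integral (\<lambda>z. z powr (\<alpha> - 1) * exp (- z))"
  by (simp add: inc_Gamma_principal_def tail_integral_def fun_eq_iff)

text \<open>
  In the logarithmic coordinate \<open>w\<close> the integrand \<open>-z\<^sup>\<alpha>\<^sup>-\<^sup>1 e\<^sup>-\<^sup>z dz\<close> becomes the entire form \<open>-exp (\<alpha>w - e\<^sup>w) dw\<close>.
  Its primitive with the right constant is the continuation of the incomplete gamma function, even to the whole plane.
\<close>

lemma inc_Gamma_primitive:
  obtains G where "\<And>w. (G has_field_derivative - exp (\<alpha> * w - exp w)) (at w)"
    "\<And>w. \<bar>Im w\<bar> < pi \<Longrightarrow> inc_Gamma_principal \<alpha> (exp w) = G w"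
    "\<And>w. \<bar>Im w\<bar> < 3 / 2 * pi \<Longrightarrow> inc_Gamma \<alpha> w = G w"
proof -
  interpret decaying_on_slit_plane "\<lambda>z. z powr (\<alpha> - 1) * exp (- z)"
    by (rule decaying_inc_Gamma_integrand)
  obtain g where g: "\<And>w. (g has_field_derivative - exp (\<alpha> * w - exp w)) (at w)"
  proof -
    have "(\<lambda>w. - exp (\<alpha> * w - exp w)) holomorphic_on UNIV"
      by (intro holomorphic_intros)
    then show ?thesis
    proof (rule holomorphic_convex_primitive'[OF convex_UNIV open_UNIV])
      fix g assume "\<And>x. x \<in> UNIV \<Longrightarrow> (g has_field_derivative - exp (\<alpha> * x - exp x)) (at x)"
      then show ?thesis by (intro that[of g]) simp
    qed
  qed
  define S where "S = {w. \<bar>Im w\<bar> < pi}"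
  have I: "((\<lambda>w. inc_Gamma_principal \<alpha> (exp w)) has_field_derivative - exp (\<alpha> * w - exp w)) (at w)"
    if w: "w \<in> S" for w
  proof -
    have "exp w \<notin> \<real>\<^sub>\<le>\<^sub>0" "Ln (exp w) = w"
      using w exp_notin_nonpos_Reals[of w] by (auto simp: S_def intro!: Ln_exp)
    then have "((\<lambda>w. inc_Gamma_principal \<alpha> (exp w)) has_field_derivative
        - (exp w powr (\<alpha> - 1) * exp (- exp w)) * exp w) (at w)"
      unfolding inc_Gamma_principal_eq_tail_integral
      by (intro DERIV_chain2[OF DERIV_tail_integral] DERIV_exp)
    moreover have "- (exp w powr (\<alpha> - 1) * exp (- exp w)) * exp w = - exp (\<alpha> * w - exp w)"
      using \<open>Ln (exp w) = w\<close> by (simp add: powr_def algebra_simps flip: exp_add)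
    ultimately show ?thesis by simp
  qed
  have "\<exists>c. \<forall>w\<in>S. inc_Gamma_principal \<alpha> (exp w) - g w = c"
  proof (rule has_field_derivative_zero_constant)
    show "convex S" unfolding S_def by (rule convex_strip)
    show "((\<lambda>w. inc_Gamma_principal \<alpha> (exp w) - g w) has_field_derivative 0) (at w within S)"
      if "w \<in> S" for w
      using DERIV_diff[OF I[OF that] g] by (simp add: has_field_derivative_at_within)
  qed
  then obtain c where c: "\<And>w. w \<in> S \<Longrightarrow> inc_Gamma_principal \<alpha> (exp w) - g w = c"
    by blast
  define G where "G = (\<lambda>w. g w + c)"
  have G: "(G has_field_derivative - exp (\<alpha> * w - exp w)) (at w)" for w
    unfolding G_def using DERIV_add[OF g DERIV_const] by simp
  have G_eq: "inc_Gamma_principal \<alpha> (exp w) = G w" if "\<bar>Im w\<bar> < pi" for w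
    using c[of w] that by (simp add: S_def G_def algebra_simps)
  have "inc_Gamma \<alpha> w = G w" if "\<bar>Im w\<bar> < 3 / 2 * pi" for w
    unfolding inc_Gamma_def
  proof (rule analytic_cont_eqI)
    show "connected {w. \<bar>Im w\<bar> < 3 / 2 * pi}" by (rule convex_connected[OF convex_strip])
    show "{w. \<bar>Im w\<bar> < pi} \<noteq> {}" by (auto intro!: exI[of _ 0])
    show "{w. \<bar>Im w\<bar> < pi} \<subseteq> {w. \<bar>Im w\<bar> < 3 / 2 * pi}" using pi_gt_zero by fastforce
    show "G holomorphic_on {w. \<bar>Im w\<bar> < 3 / 2 * pi}"
      using G by (auto simp: holomorphic_on_def field_differentiable_def intro: has_field_derivative_at_within)
    show "open {w. \<bar>Im w\<bar> < 3 / 2 * pi}" "open {w. \<bar>Im w\<bar> < pi}" by (rule open_strip)+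
  qed (use that G_eq in auto)
  with G G_eq show ?thesis using that by blast
qed

lemma DERIV_inc_Gamma:
  assumes w: "\<bar>Im w\<bar> < 3 / 2 * pi"
  shows "(inc_Gamma \<alpha> has_field_derivative - exp (\<alpha> * w - exp w)) (at w)"
proof -
  obtain G where G: "\<And>w. (G has_field_derivative - exp (\<alpha> * w - exp w)) (at w)"
    "\<And>w. \<bar>Im w\<bar> < 3 / 2 * pi \<Longrightarrow> inc_Gamma \<alpha> w = G w"
    using inc_Gamma_primitive by metis
  show ?thesis
    by (rule has_field_derivative_transform_within_open[OF G(1) open_strip[of "3 / 2 * pi"]])
       (use w G(2) in auto)
qed

lemma inc_Gamma_eq_principal:
  assumes "\<bar>Im w\<bar> < pi"
  shows "inc_Gamma \<alpha> w = inc_Gamma_principal \<alpha> (exp w)"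
proof -
  obtain G where "\<And>w. \<bar>Im w\<bar> < pi \<Longrightarrow> inc_Gamma_principal \<alpha> (exp w) = G w"
    "\<And>w. \<bar>Im w\<bar> < 3 / 2 * pi \<Longrightarrow> inc_Gamma \<alpha> w = G w"
    using inc_Gamma_primitive by metis
  then show ?thesis using assms by simp
qed

lemma inc_Gamma_tendsto_0:
  "(\<lambda>n. inc_Gamma \<alpha> (of_real (ln (1 + real n)))) \<longlonglongrightarrow> 0"
proof -
  interpret decaying_on_slit_plane "\<lambda>z. z powr (\<alpha> - 1) * exp (- z)"
    by (rule decaying_inc_Gamma_integrand)
  have "inc_Gamma \<alpha> (of_real (ln (1 + real n))) = inc_Gamma_principal \<alpha> (1 + of_nat n)" for n
  proof -
    have "inc_Gamma \<alpha> (of_real (ln (1 + real n))) = inc_Gamma_principal \<alpha> (exp (of_real (ln (1 + real n))))"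
      by (rule inc_Gamma_eq_principal) simp
    also have "exp (of_real (ln (1 + real n)) :: complex) = of_real (1 + real n)"
      by (subst exp_of_real) simp
    finally show ?thesis by simp
  qed
  then show ?thesis
    using tail_integral_tendsto_0[of 1] by (simp add: inc_Gamma_principal_eq_tail_integral)
qed

text \<open>
  Both sides have the same derivative in \<open>w\<close>, and both tend to \<open>0\<close> as \<open>w \<longlonglongrightarrow> \<infinity>\<close> along the real axis.
\<close>

lemma inc_Gamma_recurrence:
  assumes w: "\<bar>Im w\<bar> < 3 / 2 * pi"
  shows "inc_Gamma (\<alpha> + 1) w = \<alpha> * inc_Gamma \<alpha> w + exp (\<alpha> * w - exp w)"
proof -
  define S where "S = {w. \<bar>Im w\<bar> < 3 / 2 * pi}"
  define D where "D = (\<lambda>w. inc_Gamma (\<alpha> + 1) w - (\<alpha> * inc_Gamma \<alpha> w + exp (\<alpha> * w - exp w)))"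
  have D0: "(D has_field_derivative 0) (at w within S)" if "w \<in> S" for w
  proof -
    have "\<bar>Im w\<bar> < 3 / 2 * pi" using that by (simp add: S_def)
    from DERIV_inc_Gamma[OF this, of "\<alpha> + 1"] DERIV_inc_Gamma[OF this, of \<alpha>]
    have "(D has_field_derivative - exp ((\<alpha> + 1) * w - exp w)
        - (\<alpha> * (- exp (\<alpha> * w - exp w)) + exp (\<alpha> * w - exp w) * (\<alpha> - exp w))) (at w)"
      unfolding D_def by (auto intro!: derivative_eq_intros)
    moreover have "exp ((\<alpha> + 1) * w - exp w) = exp (\<alpha> * w - exp w) * exp w"
      by (simp add: algebra_simps flip: exp_add)
    ultimately show ?thesis
      by (simp add: algebra_simps has_field_derivative_at_within)
  qed
  have "convex S" unfolding S_def by (rule convex_strip)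
  from has_field_derivative_zero_constant[OF this D0]
  obtain c where c: "\<And>w. w \<in> S \<Longrightarrow> D w = c"
    by blast
  define x where "x = (\<lambda>n::nat. ln (1 + real n))"
  have "(\<lambda>n. exp (\<alpha> * of_real (x n) - exp (of_real (x n)))) \<longlonglongrightarrow> 0"
  proof (rule tendsto_norm_zero_cancel)
    have "norm (exp (\<alpha> * of_real (x n) - exp (of_real (x n)))) = (1 + real n) powr Re \<alpha> * exp (- (1 + real n))" for n
    proof -
      have "norm (exp (\<alpha> * of_real (x n) - exp (of_real (x n)))) = exp (Re \<alpha> * x n - exp (x n))"
        by (simp add: norm_exp_eq_Re Re_exp)
      also have "\<dots> = (1 + real n) powr Re \<alpha> * exp (- (1 + real n))"
        by (simp add: x_def powr_def flip: exp_add)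
      finally show ?thesis .
    qed
    moreover have "(\<lambda>n. (1 + real n) powr Re \<alpha> * exp (- (1 + real n))) \<longlonglongrightarrow> 0"
    proof (rule Lim_null_comparison[OF always_eventually[OF allI]])
      define k where "k = nat \<lceil>Re \<alpha>\<rceil>"
      show "norm ((1 + real n) powr Re \<alpha> * exp (- (1 + real n))) \<le> fact (k + 2) * (1 + real n) powr (- 2)" for n
      proof -
        have "(1 + real n) powr Re \<alpha> \<le> (1 + real n) powr real k"
          by (intro powr_mono) (auto simp: k_def real_nat_ceiling_ge)
        then have "(1 + real n) powr Re \<alpha> * exp (- (1 + real n)) \<le> (1 + real n) ^ k * exp (- (1 + real n))"
          by (intro mult_right_mono) (auto simp: powr_realpow)
        also have "\<dots> \<le> fact (k + 2) * (1 + real n) powr (- 2)"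
          by (rule power_times_exp_minus_bound) auto
        finally show ?thesis by simp
      qed
      show "(\<lambda>n. fact (k + 2) * (1 + real n) powr (- 2)) \<longlonglongrightarrow> 0"
        by (intro tendsto_mult_right_zero tendsto_neg_powr
             filterlim_tendsto_add_at_top[OF tendsto_const] filterlim_real_sequentially) auto
    qed
    ultimately show "(\<lambda>n. norm (exp (\<alpha> * of_real (x n) - exp (of_real (x n))))) \<longlonglongrightarrow> 0" by simp
  qed
  then have "(\<lambda>n. D (of_real (x n))) \<longlonglongrightarrow> 0 - (\<alpha> * 0 + 0)"
    unfolding D_def using inc_Gamma_tendsto_0[of "\<alpha> + 1"] inc_Gamma_tendsto_0[of \<alpha>]
    by (intro tendsto_intros) (auto simp: x_def)
  moreover have "D (of_real (x n)) = c" for n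
    by (rule c) (simp add: S_def)
  ultimately have "c = 0" by (simp add: LIMSEQ_const_iff)
  with c[of w] w show ?thesis by (simp add: S_def D_def)
qed

section \<open>Fourier integrals of shifted powers\<close>

abbreviation wave :: "real \<Rightarrow> complex \<Rightarrow> complex \<Rightarrow> complex"
  where "wave y \<nu> z \<equiv> exp (\<i> * of_real y * z) * z powr (- \<nu>)"

text \<open>
  This is \<open>\<integral>\<^sub>0\<^sup>\<infinity> e\<^sup>i\<^sup>y\<^sup>u (a+u)\<^sup>-\<^sup>\<nu> du\<close>. The exponential factor moves the phase of the wave back to the starting
  point, which makes the bounds below uniform in \<open>y\<close>.
\<close>

definition wave_tail :: "real \<Rightarrow> complex \<Rightarrow> complex \<Rightarrow> complex"
  where "wave_tail y \<nu> a = exp (- (\<i> * of_real y * a)) * tail_integral (wave y \<nu>) a"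

lemma norm_exp_wave: "norm (exp (\<i> * of_real y * (w + of_real u))) = exp (- (y * Im w))"
  by (simp add: norm_exp_eq_Re)

lemma decaying_wave:
  assumes \<nu>: "1 < Re \<nu>"
  shows "decaying_on_slit_plane (wave y \<nu>)"
proof
  show "wave y \<nu> holomorphic_on - \<real>\<^sub>\<le>\<^sub>0"
    by (intro holomorphic_intros) auto
next
  fix a :: complex assume a: "a \<notin> \<real>\<^sub>\<le>\<^sub>0"
  have "0 \<le> Re \<nu>" using \<nu> by simp
  then obtain e C where e: "0 < e" "0 < C" and bound:
    "\<And>w u \<mu>. w \<in> ball a e \<Longrightarrow> 0 \<le> u \<Longrightarrow> Re \<nu> \<le> Re \<mu> \<Longrightarrow> norm \<mu> \<le> norm \<nu> \<Longrightarrow>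
       norm ((w + of_real u) powr (- \<mu>)) \<le> C * (1 + u) powr (- Re \<nu>)"
    using powr_decay_on_slit_plane[OF a, of "Re \<nu>" "norm \<nu>"] by blast
  have main: "norm (wave y \<nu> (w + of_real u))
      \<le> exp (\<bar>y\<bar> * (\<bar>Im a\<bar> + 1)) * C * (1 + u) powr (- Re \<nu>)"
    if w: "w \<in> ball a (min e 1)" and u: "0 \<le> u" for w and u :: real
  proof -
    have "\<bar>Im w\<bar> \<le> \<bar>Im a\<bar> + 1"
      using w abs_Im_le_cmod[of "a - w"] by (auto simp: dist_norm)
    then have "\<bar>y\<bar> * \<bar>Im w\<bar> \<le> \<bar>y\<bar> * (\<bar>Im a\<bar> + 1)"
      by (intro mult_left_mono) auto
    then have "- (y * Im w) \<le> \<bar>y\<bar> * (\<bar>Im a\<bar> + 1)"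
      by (metis abs_ge_minus_self abs_mult order_trans)
    then have "norm (exp (\<i> * of_real y * (w + of_real u))) \<le> exp (\<bar>y\<bar> * (\<bar>Im a\<bar> + 1))"
      unfolding norm_exp_wave by simp
    moreover have "norm ((w + of_real u) powr (- \<nu>)) \<le> C * (1 + u) powr (- Re \<nu>)"
      using bound[of w u \<nu>] w u by simp
    ultimately show ?thesis
      unfolding norm_mult by (simp add: mult.assoc mult_mono)
  qed
  show "\<exists>e>0. \<exists>C. \<exists>p>1. \<forall>w\<in>ball a e. \<forall>u\<ge>0.
      norm (wave y \<nu> (w + of_real u)) \<le> C * (1 + u) powr (- p)"
    using main e \<nu> by (intro exI[of _ "min e 1"] conjI exI[of _ "exp (\<bar>y\<bar> * (\<bar>Im a\<bar> + 1)) * C"]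
        exI[of _ "Re \<nu>"]) auto
qed

text \<open>
  The same integral expressed by the incomplete gamma function at the point \<open>-iya\<close> with argument
  \<open>arg a \<mp> \<pi>/2\<close>, now for every \<open>\<nu>\<close>. The frequency must not be \<open>0\<close>.
\<close>

definition power_transform :: "real \<Rightarrow> complex \<Rightarrow> complex \<Rightarrow> complex"
  where "power_transform y \<nu> a =
    exp (- (\<i> * of_real y * a)) * (- (\<i> * of_real y)) powr (\<nu> - 1)
      * inc_Gamma (1 - \<nu>) (Ln a + Ln (- (\<i> * of_real y)))"

lemma Ln_sum_in_strip:
  assumes "a \<notin> \<real>\<^sub>\<le>\<^sub>0" "y \<noteq> 0"
  shows "\<bar>Im (Ln a + Ln (- (\<i> * of_real y)))\<bar> < 3 / 2 * pi"
proof -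
  have "\<bar>Im (Ln (- (\<i> * of_real y)))\<bar> \<le> pi / 2"
    using Re_Ln_pos_le[of "- (\<i> * of_real y)"] assms by simp
  moreover have "\<bar>Im (Ln a)\<bar> < pi"
    by (rule abs_Im_Ln_less_pi[OF assms(1)])
  ultimately show ?thesis
    unfolding plus_complex.sel
    using abs_triangle_ineq[of "Im (Ln a)" "Im (Ln (- (\<i> * of_real y)))"] by linarith
qed

lemma exp_Ln_sum:
  assumes "a \<notin> \<real>\<^sub>\<le>\<^sub>0" "y \<noteq> 0"
  shows "exp (Ln a + Ln (- (\<i> * of_real y))) = - (\<i> * of_real y * a)"
proof -
  have "a \<noteq> 0" using assms by auto
  then show ?thesis using assms by (simp add: exp_add)
qed

text \<open>
  Integration by parts in \<open>\<integral>\<^sub>0\<^sup>\<infinity> e\<^sup>i\<^sup>y\<^sup>u (a+u)\<^sup>-\<^sup>\<nu> du\<close>, continued to all \<open>\<nu>\<close>; it is the recurrence of the incomplete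
  gamma function in disguise.
\<close>

lemma power_transform_recurrence:
  assumes a: "a \<notin> \<real>\<^sub>\<le>\<^sub>0" and y: "y \<noteq> 0"
  shows "\<i> * of_real y * power_transform y \<nu> a = \<nu> * power_transform y (\<nu> + 1) a - a powr (- \<nu>)"
proof -
  define b where "b = - (\<i> * of_real y)"
  define w where "w = Ln a + Ln b"
  have nz: "a \<noteq> 0" "b \<noteq> 0" using a y by (auto simp: b_def)
  have expw: "exp w = b * a"
    using exp_Ln_sum[OF a y] by (simp add: w_def b_def)
  have "inc_Gamma (- \<nu> + 1) w = - \<nu> * inc_Gamma (- \<nu>) w + exp (- \<nu> * w - exp w)"
    by (rule inc_Gamma_recurrence) (use Ln_sum_in_strip[OF a y] in \<open>simp add: w_def b_def\<close>)
  moreover have "exp (- \<nu> * w - exp w) = a powr (- \<nu>) * b powr (- \<nu>) * exp (- (b * a))"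
  proof -
    have eq: "- \<nu> * w - exp w = - \<nu> * Ln a + - \<nu> * Ln b + - (b * a)"
      unfolding expw by (simp add: w_def algebra_simps)
    show ?thesis unfolding eq exp_add using nz by (simp add: powr_def)
  qed
  ultimately have 1: "inc_Gamma (1 - \<nu>) w
      = - \<nu> * inc_Gamma (- \<nu>) w + a powr (- \<nu>) * b powr (- \<nu>) * exp (- (b * a))"
    by simp
  have 2: "b powr (\<nu> - 1) * b = b powr \<nu>" "b powr \<nu> * b powr (- \<nu>) = 1"
    using nz by (simp_all add: powr_diff powr_minus)
  have 3: "exp (b * a) * exp (- (b * a)) = 1" by (simp flip: exp_add)
  have "b * power_transform y \<nu> a = exp (b * a) * (b powr (\<nu> - 1) * b) * inc_Gamma (1 - \<nu>) w"
    by (simp add: power_transform_def b_def w_def)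
  also have "\<dots> = - \<nu> * (exp (b * a) * b powr \<nu> * inc_Gamma (- \<nu>) w)
      + a powr (- \<nu>) * (b powr \<nu> * b powr (- \<nu>)) * (exp (b * a) * exp (- (b * a)))"
    unfolding 1 2(1) by (simp add: algebra_simps)
  also have "\<dots> = - \<nu> * power_transform y (\<nu> + 1) a + a powr (- \<nu>)"
    unfolding 2(2) 3 by (simp add: power_transform_def b_def w_def)
  finally show ?thesis by (simp add: b_def algebra_simps)
qed

text \<open>
  On the half-line where \<open>-iya\<close> is positive, the wave starts with the factor \<open>e\<^sup>i\<^sup>y\<^sup>a\<close>, which is exponentially small.
  This fixes the constant of integration in the next lemma.
\<close>

lemma wave_decay_on_imaginary_axis:
  assumes \<nu>: "1 < Re \<nu>" and y: "y \<noteq> 0"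
  defines "z \<equiv> \<lambda>n::nat. of_real (1 + real n) * inverse (- (\<i> * of_real y))"
  shows "(\<lambda>n. tail_integral (wave y \<nu>) (z n)) \<longlonglongrightarrow> 0"
proof -
  define \<kappa> where "\<kappa> = min 1 (1 / \<bar>y\<bar>) / 2"
  have \<kappa>: "0 < \<kappa>" "\<kappa> \<le> 1 / 2" "\<kappa> \<le> 1 / \<bar>y\<bar> / 2" using y by (auto simp: \<kappa>_def)
  have z: "z n = \<i> * of_real ((1 + real n) / y)" for n
    using y by (simp add: z_def field_simps)
  have z_slit: "z n \<notin> \<real>\<^sub>\<le>\<^sub>0" for n
    using y by (auto simp: z complex_nonpos_Reals_iff)
  define K where "K = \<kappa> powr (- Re \<nu>) * exp (\<bar>Im \<nu>\<bar> * pi)"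
  have bound: "norm (wave y \<nu> (z n + of_real u)) \<le> exp (- (1 + real n)) * K * (1 + u) powr (- Re \<nu>)"
    if u: "0 \<le> u" for n and u :: real
  proof -
    have "\<bar>y\<bar> * (1 / \<bar>y\<bar>) \<le> 1 + real n" using y by simp
    then have "1 / \<bar>y\<bar> \<le> (1 + real n) / \<bar>y\<bar>" using y by (simp add: field_simps)
    also have "\<dots> \<le> norm (z n + of_real u)"
      using abs_Im_le_cmod[of "z n + of_real u"] by (simp add: z)
    finally have "1 / \<bar>y\<bar> \<le> norm (z n + of_real u)" .
    moreover have "u \<le> norm (z n + of_real u)"
      using abs_Re_le_cmod[of "z n + of_real u"] u by (simp add: z)
    moreover have "\<kappa> * u \<le> 1 / 2 * u" using \<kappa> u by (intro mult_right_mono) auto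
    ultimately have L: "\<kappa> * (1 + u) \<le> norm (z n + of_real u)"
      using \<kappa> by (simp add: algebra_simps)
    have "norm (z n + of_real u) powr (- Re \<nu>) \<le> (\<kappa> * (1 + u)) powr (- Re \<nu>)"
      using L \<kappa> u \<nu> by (intro powr_mono2') auto
    also have "\<dots> = \<kappa> powr (- Re \<nu>) * (1 + u) powr (- Re \<nu>)"
      using \<kappa> u by (simp add: powr_mult)
    finally have A: "norm (z n + of_real u) powr (- Re \<nu>) \<le> \<kappa> powr (- Re \<nu>) * (1 + u) powr (- Re \<nu>)" .
    have "Im \<nu> * Arg (z n + of_real u) \<le> \<bar>Im \<nu>\<bar> * \<bar>Arg (z n + of_real u)\<bar>"
      by (simp flip: abs_mult)
    also have "\<dots> \<le> \<bar>Im \<nu>\<bar> * pi"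
      using Arg_bounded[of "z n + of_real u"] by (intro mult_left_mono) auto
    finally have B: "exp (Im \<nu> * Arg (z n + of_real u)) \<le> exp (\<bar>Im \<nu>\<bar> * pi)" by simp
    have C: "norm (exp (\<i> * of_real y * (z n + of_real u))) = exp (- (1 + real n))"
      unfolding norm_exp_wave using y by (simp add: z)
    have "norm (wave y \<nu> (z n + of_real u)) = exp (- (1 + real n)) *
        (norm (z n + of_real u) powr (- Re \<nu>) * exp (Im \<nu> * Arg (z n + of_real u)))"
      unfolding norm_mult C by (simp add: norm_powr_complex)
    also have "\<dots> \<le> exp (- (1 + real n)) *
        (\<kappa> powr (- Re \<nu>) * (1 + u) powr (- Re \<nu>) * exp (\<bar>Im \<nu>\<bar> * pi))"
      using A B by (intro mult_left_mono mult_mono) auto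
    finally show ?thesis by (simp add: K_def mult_ac)
  qed
  have hol: "wave y \<nu> holomorphic_on - \<real>\<^sub>\<le>\<^sub>0"
    by (intro holomorphic_intros) auto
  have "norm (tail_integral (wave y \<nu>) (z n)) \<le> exp (- (1 + real n)) * K * (1 powr (1 - Re \<nu>) / (Re \<nu> - 1))" for n
    unfolding tail_integral_def
    by (rule improper_integral_powr_decay(3)[OF continuous_on_horizontal[OF hol z_slit]])
       (use \<nu> bound in auto)
  moreover have "(\<lambda>n. exp (- (1 + real n)) * K * (1 powr (1 - Re \<nu>) / (Re \<nu> - 1))) \<longlonglongrightarrow> 0"
    by (intro tendsto_mult_left_zero filterlim_compose[OF exp_at_bot]
          filterlim_compose[OF filterlim_uminus_at_bot_at_top]
          filterlim_tendsto_add_at_top[OF tendsto_const] filterlim_real_sequentially)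
  ultimately show ?thesis
    by (rule Lim_null_comparison[OF always_eventually[OF allI]])
qed

text \<open>
  As functions of \<open>a\<close>, both sides times \<open>e\<^sup>i\<^sup>y\<^sup>a\<close> have the derivative \<open>-e\<^sup>i\<^sup>y\<^sup>a a\<^sup>-\<^sup>\<nu>\<close> on the connected slit plane, and
  both tend to \<open>0\<close> along the half-line on which \<open>-iya\<close> is positive.
\<close>

lemma wave_tail_eq_power_transform:
  assumes \<nu>: "1 < Re \<nu>" and y: "y \<noteq> 0" and a: "a \<notin> \<real>\<^sub>\<le>\<^sub>0"
  shows "wave_tail y \<nu> a = power_transform y \<nu> a"
proof -
  interpret decaying_on_slit_plane "wave y \<nu>" by (rule decaying_wave[OF \<nu>])
  define b where "b = - (\<i> * of_real y)"
  define c where "c = Ln b"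
  have b: "b \<noteq> 0" "b \<notin> \<real>\<^sub>\<le>\<^sub>0" using y by (auto simp: b_def complex_nonpos_Reals_iff)
  define D where "D = (\<lambda>z. tail_integral (wave y \<nu>) z - b powr (\<nu> - 1) * inc_Gamma (1 - \<nu>) (Ln z + c))"
  have D0: "(D has_field_derivative 0) (at z)" if z: "z \<in> - \<real>\<^sub>\<le>\<^sub>0" for z
  proof -
    have z': "z \<notin> \<real>\<^sub>\<le>\<^sub>0" and nz: "z \<noteq> 0" using z by auto
    have ex: "exp (Ln z + c) = b * z"
      using exp_Ln_sum[OF z' y] by (simp add: b_def c_def)
    have "(inc_Gamma (1 - \<nu>) has_field_derivative - exp ((1 - \<nu>) * (Ln z + c) - exp (Ln z + c))) (at (Ln z + c))"
      by (rule DERIV_inc_Gamma) (use Ln_sum_in_strip[OF z' y] in \<open>simp add: b_def c_def\<close>)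
    moreover have "((\<lambda>z. Ln z + c) has_field_derivative inverse z) (at z)"
      using z' by (auto intro!: derivative_eq_intros)
    ultimately have "((\<lambda>z. inc_Gamma (1 - \<nu>) (Ln z + c)) has_field_derivative
        - exp ((1 - \<nu>) * (Ln z + c) - exp (Ln z + c)) * inverse z) (at z)"
      by (rule DERIV_chain2)
    then have "(D has_field_derivative - wave y \<nu> z
        - b powr (\<nu> - 1) * (- exp ((1 - \<nu>) * (Ln z + c) - exp (Ln z + c)) * inverse z)) (at z)"
      unfolding D_def by (intro DERIV_diff DERIV_tail_integral[OF z'] DERIV_cmult)
    moreover have "b powr (\<nu> - 1) * (exp ((1 - \<nu>) * (Ln z + c) - exp (Ln z + c)) * inverse z) = wave y \<nu> z"
    proof -
      have "exp ((1 - \<nu>) * (Ln z + c) - exp (Ln z + c))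
          = exp ((1 - \<nu>) * Ln z) * exp ((1 - \<nu>) * c) * exp (- (b * z))"
        unfolding ex by (simp add: algebra_simps flip: exp_add)
      moreover have "b powr (\<nu> - 1) * exp ((1 - \<nu>) * c) = 1"
        using b by (simp add: powr_def c_def algebra_simps flip: exp_add)
      moreover have "exp ((1 - \<nu>) * Ln z) * inverse z = z powr (- \<nu>)"
      proof -
        have "exp ((1 - \<nu>) * Ln z) = z powr (1 + - \<nu>)" using nz by (simp add: powr_def)
        also have "\<dots> = z * z powr (- \<nu>)" using nz by (subst powr_add) simp
        finally show ?thesis using nz by simp
      qed
      ultimately show ?thesis
        by (simp add: b_def mult_ac) (metis (no_types, lifting) mult.assoc mult.commute mult.right_neutral)
    qed
    ultimately show ?thesis by simp
  qed
  have "connected (- \<real>\<^sub>\<le>\<^sub>0 :: complex set)"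
    using starlike_slit_plane starlike_imp_connected by blast
  moreover have "open (- \<real>\<^sub>\<le>\<^sub>0 :: complex set)" by (simp add: open_Compl)
  ultimately have "D constant_on - \<real>\<^sub>\<le>\<^sub>0"
    by (intro has_field_derivative_0_imp_constant_on D0)
  then obtain k where k: "\<And>z. z \<in> - \<real>\<^sub>\<le>\<^sub>0 \<Longrightarrow> D z = k"
    by (auto simp: constant_on_def)
  \<comment> \<open>here \<open>b * z n\<close> is the positive number \<open>1 + n\<close>\<close>
  define z where "z = (\<lambda>n::nat. of_real (1 + real n) * inverse b)"
  have z: "z n \<in> - \<real>\<^sub>\<le>\<^sub>0" for n
    using y by (auto simp: z_def b_def complex_nonpos_Reals_iff)
  have Ln_z: "Ln (z n) + c = of_real (ln (1 + real n))" for n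
  proof -
    have "Ln (z n) = of_real (ln (1 + real n)) + Ln (inverse b)"
      unfolding z_def using b by (subst Ln_times_of_real) (auto simp: Ln_of_real simp del: of_real_add)
    also have "Ln (inverse b) = - c"
      unfolding c_def by (rule Ln_inverse[OF b(2)])
    finally show ?thesis by simp
  qed
  have "(\<lambda>n. D (z n)) \<longlonglongrightarrow> 0 - b powr (\<nu> - 1) * 0"
    unfolding D_def Ln_z
    using wave_decay_on_imaginary_axis[OF \<nu> y]
    by (intro tendsto_intros inc_Gamma_tendsto_0) (simp add: z_def b_def)
  moreover have "D (z n) = k" for n by (rule k[OF z])
  ultimately have "k = 0" by (simp add: LIMSEQ_const_iff)
  with k[of a] a have "tail_integral (wave y \<nu>) a = b powr (\<nu> - 1) * inc_Gamma (1 - \<nu>) (Ln a + c)"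
    by (simp add: D_def)
  then show ?thesis
    by (simp add: wave_tail_def power_transform_def b_def c_def)
qed

text \<open>
  Uniform in the frequency. The decay in \<open>n\<close> controls both the truncation of the integral at \<open>n\<close> and the shift
  \<open>a \<mapsto> a + n\<close>.
\<close>

lemma wave_tail_bound:
  assumes a: "a \<notin> \<real>\<^sub>\<le>\<^sub>0" and \<sigma>: "1 < \<sigma>"
  obtains C where "0 < C"
    "\<And>y \<nu> n. \<sigma> \<le> Re \<nu> \<Longrightarrow> norm \<nu> \<le> S \<Longrightarrow>
       norm (wave_tail y \<nu> (a + of_nat n)) \<le> C * (1 + real n) powr (1 - \<sigma>)"
proof -
  have "0 \<le> \<sigma>" using \<sigma> by simp
  then obtain e C where e: "0 < e" "0 < C" and bound:
    "\<And>w u \<mu>. w \<in> ball a e \<Longrightarrow> 0 \<le> u \<Longrightarrow> \<sigma> \<le> Re \<mu> \<Longrightarrow> norm \<mu> \<le> S \<Longrightarrow>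
       norm ((w + of_real u) powr (- \<mu>)) \<le> C * (1 + u) powr (- \<sigma>)"
    using powr_decay_on_slit_plane[OF a, of \<sigma> S] by blast
  have main: "norm (wave_tail y \<nu> (a + of_nat n)) \<le> C / (\<sigma> - 1) * (1 + real n) powr (1 - \<sigma>)"
    if \<nu>: "\<sigma> \<le> Re \<nu>" "norm \<nu> \<le> S" for y \<nu> n
  proof -
    have hol: "wave y \<nu> holomorphic_on - \<real>\<^sub>\<le>\<^sub>0"
      by (intro holomorphic_intros) auto
    have an: "a + of_nat n \<notin> \<real>\<^sub>\<le>\<^sub>0"
      using slit_plane_add_real[OF a, of "real n"] by simp
    have "norm (wave y \<nu> (a + of_nat n + of_real u)) \<le> (exp (- (y * Im a)) * C) * ((1 + real n) + u) powr (- \<sigma>)"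
      if u: "0 \<le> u" for u
    proof -
      have "norm ((a + of_real (real n + u)) powr (- \<nu>)) \<le> C * (1 + (real n + u)) powr (- \<sigma>)"
        by (rule bound) (use e u \<nu> in auto)
      then show ?thesis
        unfolding norm_mult norm_exp_wave by (simp add: add.assoc mult.assoc)
    qed
    then have le: "norm (tail_integral (wave y \<nu>) (a + of_nat n))
        \<le> (exp (- (y * Im a)) * C) * ((1 + real n) powr (1 - \<sigma>) / (\<sigma> - 1))"
      unfolding tail_integral_def
      by (intro improper_integral_powr_decay(3)[OF continuous_on_horizontal[OF hol an]]) (use \<sigma> in auto)
    have eq: "norm (exp (- (\<i> * of_real y * (a + of_nat n)))) = exp (y * Im a)"
      by (simp add: norm_exp_eq_Re)
    have "norm (wave_tail y \<nu> (a + of_nat n))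
        \<le> exp (y * Im a) * ((exp (- (y * Im a)) * C) * ((1 + real n) powr (1 - \<sigma>) / (\<sigma> - 1)))"
      unfolding wave_tail_def norm_mult eq by (rule mult_left_mono[OF le]) simp
    also have "\<dots> = (exp (y * Im a) * exp (- (y * Im a))) * (C / (\<sigma> - 1) * (1 + real n) powr (1 - \<sigma>))"
      by (simp add: field_simps)
    finally show ?thesis by (simp flip: exp_add)
  qed
  show ?thesis
    by (rule that[of "C / (\<sigma> - 1)"]) (use e \<sigma> main in auto)
qed

lemma wave_tail_split:
  assumes a: "a \<notin> \<real>\<^sub>\<le>\<^sub>0" and \<nu>: "1 < Re \<nu>" and "0 \<le> b"
  shows "exp (- (\<i> * of_real y * a)) * integral {0..b} (\<lambda>u. wave y \<nu> (a + of_real u))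
    = wave_tail y \<nu> a - exp (\<i> * of_real (y * b)) * wave_tail y \<nu> (a + of_real b)"
proof -
  interpret decaying_on_slit_plane "wave y \<nu>" by (rule decaying_wave[OF \<nu>])
  have "exp (\<i> * of_real (y * b)) * exp (- (\<i> * of_real y * (a + of_real b))) = exp (- (\<i> * of_real y * a))"
    by (simp add: algebra_simps flip: exp_add)
  then show ?thesis
    unfolding integral_eq_tail_integral_diff[OF a \<open>0 \<le> b\<close>] wave_tail_def
    by (simp add: right_diff_distrib flip: mult.assoc)
qed

lemma holomorphic_wave_integral:
  assumes a: "a \<notin> \<real>\<^sub>\<le>\<^sub>0"
  shows "(\<lambda>\<nu>. integral {0..b} (\<lambda>u. wave y \<nu> (a + of_real u))) holomorphic_on {\<nu>. 1 < Re \<nu>}"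
proof -
  define k where "k = (\<lambda>\<nu> u. exp (\<i> * of_real y * (a + of_real u)) * exp (- \<nu> * Ln (a + of_real u)))"
  have nz: "a + of_real u \<notin> \<real>\<^sub>\<le>\<^sub>0" if "u \<in> {0..b}" for u
    by (rule slit_plane_add_real[OF a]) (use that in auto)
  have nz': "a + of_real u \<noteq> 0" if "u \<in> {0..b}" for u
    using nz[OF that] by auto
  have "(\<lambda>\<nu>. integral (cbox 0 b) (k \<nu>)) holomorphic_on {\<nu>. 1 < Re \<nu>}"
  proof (rule leibniz_rule_holomorphic)
    show "((\<lambda>\<nu>. k \<nu> u) has_field_derivative k \<nu> u * (- Ln (a + of_real u))) (at \<nu> within {\<nu>. 1 < Re \<nu>})" for \<nu> u
      unfolding k_def by (auto intro!: derivative_eq_intros)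
    show "k \<nu> integrable_on cbox 0 b" for \<nu>
      unfolding k_def cbox_interval using nz
      by (intro integrable_continuous_interval continuous_intros) auto
    show "continuous_on ({\<nu>. 1 < Re \<nu>} \<times> cbox 0 b) (\<lambda>(\<nu>, u). k \<nu> u * (- Ln (a + of_real u)))"
      unfolding k_def case_prod_unfold cbox_interval using nz
      by (intro continuous_intros) auto
    show "convex {\<nu>. 1 < Re \<nu>}"
      by (rule convex_halfspace_Re_gt)
  qed
  moreover have "integral (cbox 0 b) (k \<nu>) = integral {0..b} (\<lambda>u. wave y \<nu> (a + of_real u))" for \<nu>
    unfolding cbox_interval
    by (rule Henstock_Kurzweil_Integration.integral_cong) (use nz' in \<open>auto simp: k_def powr_def\<close>)
  ultimately show ?thesis by simp
qed

lemma uniform_limit_of_bound: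
  fixes f :: "nat \<Rightarrow> 'a \<Rightarrow> 'b::metric_space"
  assumes "\<And>n x. x \<in> S \<Longrightarrow> dist (f n x) (g x) \<le> B n" "B \<longlonglongrightarrow> 0"
  shows "uniform_limit S f g sequentially"
proof (rule uniform_limitI)
  fix e :: real assume "0 < e"
  with assms(2) have "eventually (\<lambda>n. B n < e) sequentially"
    by (rule order_tendstoD)
  then show "\<forall>\<^sub>F n in sequentially. \<forall>x\<in>S. dist (f n x) (g x) < e"
    by eventually_elim (use le_less_trans[OF assms(1)] in blast)
qed

lemma powr_1_plus_nat_tendsto_0:
  assumes "e < 0"
  shows "(\<lambda>n. (1 + real n) powr e) \<longlonglongrightarrow> 0"
  by (intro tendsto_neg_powr assms filterlim_tendsto_add_at_top[OF tendsto_const] filterlim_real_sequentially)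

text \<open>
  Locally uniform limit of the integrals over \<open>[0,n]\<close>.
\<close>

lemma holomorphic_wave_tail:
  assumes a: "a \<notin> \<real>\<^sub>\<le>\<^sub>0"
  shows "(\<lambda>\<nu>. wave_tail y \<nu> a) holomorphic_on {\<nu>. 1 < Re \<nu>}"
proof (rule holomorphic_uniform_sequence)
  define F where "F = (\<lambda>(n::nat) \<nu>. exp (- (\<i> * of_real y * a)) *
    integral {0..real n} (\<lambda>u. wave y \<nu> (a + of_real u)))"
  show "open {\<nu>. 1 < Re \<nu>}" by (rule open_halfspace_Re_gt)
  show "F n holomorphic_on {\<nu>. 1 < Re \<nu>}" for n
    unfolding F_def by (intro holomorphic_intros holomorphic_wave_integral a)
  fix \<nu> assume "\<nu> \<in> {\<nu>. 1 < Re \<nu>}"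
  then have \<nu>: "1 < Re \<nu>" by simp
  \<comment> \<open>any exponent strictly between \<open>1\<close> and \<open>Re \<nu>\<close> leaves room for a disc around \<open>\<nu>\<close>\<close>
  define \<sigma> where "\<sigma> = (1 + Re \<nu>) / 2"
  have \<sigma>: "1 < \<sigma>" "\<sigma> < Re \<nu>" using \<nu> by (auto simp: \<sigma>_def)
  define d where "d = Re \<nu> - \<sigma>"
  have d: "d > 0" using \<sigma> by (simp add: d_def)
  obtain C where C: "0 < C" "\<And>y \<mu> n. \<sigma> \<le> Re \<mu> \<Longrightarrow> norm \<mu> \<le> norm \<nu> + d \<Longrightarrow>
       norm (wave_tail y \<mu> (a + of_nat n)) \<le> C * (1 + real n) powr (1 - \<sigma>)"
    using wave_tail_bound[OF a \<sigma>(1), of "norm \<nu> + d"] by blast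
  have in_ball: "\<sigma> \<le> Re \<mu>" "norm \<mu> \<le> norm \<nu> + d" if "\<mu> \<in> cball \<nu> d" for \<mu>
    using that abs_Re_le_cmod[of "\<nu> - \<mu>"] norm_triangle_ineq4[of \<nu> "\<nu> - \<mu>"]
    by (auto simp: dist_norm d_def)
  have "uniform_limit (cball \<nu> d) F (\<lambda>\<nu>. wave_tail y \<nu> a) sequentially"
  proof (rule uniform_limit_of_bound)
    show "(\<lambda>n. C * (1 + real n) powr (1 - \<sigma>)) \<longlonglongrightarrow> 0"
      by (intro tendsto_mult_right_zero powr_1_plus_nat_tendsto_0) (use \<sigma> in auto)
    fix n \<mu> assume \<mu>: "\<mu> \<in> cball \<nu> d"
    have "F n \<mu> - wave_tail y \<mu> a = - (exp (\<i> * of_real (y * real n)) * wave_tail y \<mu> (a + of_nat n))"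
      unfolding F_def using wave_tail_split[OF a, of \<mu> "real n" y] in_ball[OF \<mu>] \<sigma> by simp
    then have "dist (F n \<mu>) (wave_tail y \<mu> a) = norm (wave_tail y \<mu> (a + of_nat n))"
      by (simp add: dist_norm norm_mult norm_exp_eq_Re)
    also have "\<dots> \<le> C * (1 + real n) powr (1 - \<sigma>)"
      by (rule C(2)[OF in_ball[OF \<mu>]])
    finally show "dist (F n \<mu>) (wave_tail y \<mu> a) \<le> C * (1 + real n) powr (1 - \<sigma>)" .
  qed
  moreover have "cball \<nu> d \<subseteq> {\<nu>. 1 < Re \<nu>}" using in_ball \<sigma> by fastforce
  ultimately show "\<exists>d>0. cball \<nu> d \<subseteq> {\<nu>. 1 < Re \<nu>} \<and>
      uniform_limit (cball \<nu> d) F (\<lambda>\<nu>. wave_tail y \<nu> a) sequentially"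
    using d by blast
qed

text \<open>
  The recurrence extends holomorphy from \<open>Re \<nu> > 1\<close> to the left, one unit strip at a time.
\<close>

lemma holomorphic_power_transform:
  assumes a: "a \<notin> \<real>\<^sub>\<le>\<^sub>0" and y: "y \<noteq> 0"
  shows "(\<lambda>\<nu>. power_transform y \<nu> a) holomorphic_on UNIV"
proof -
  define U where "U = (\<lambda>n::nat. {\<nu>. 1 - real n < Re \<nu>})"
  have "(\<lambda>\<nu>. power_transform y \<nu> a) holomorphic_on U n" for n
  proof (induction n)
    case 0
    have "U 0 = {\<nu>. 1 < Re \<nu>}" by (simp add: U_def)
    then show ?case
      using holomorphic_transform[OF holomorphic_wave_tail[OF a, of y]]
        wave_tail_eq_power_transform[OF _ y a] by simp
  next
    case (Suc n)
    have "((\<lambda>\<nu>. power_transform y \<nu> a) \<circ> (\<lambda>\<nu>. \<nu> + 1)) holomorphic_on U (Suc n)"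
      by (rule holomorphic_on_compose_gen[OF _ Suc]) (auto simp: U_def intro!: holomorphic_intros)
    then have "(\<lambda>\<nu>. (\<nu> * power_transform y (\<nu> + 1) a - a powr (- \<nu>)) / (\<i> * of_real y)) holomorphic_on U (Suc n)"
      unfolding o_def using a y by (intro holomorphic_intros) auto
    then show ?case
      by (rule holomorphic_transform)
         (use power_transform_recurrence[OF a y] y in \<open>auto simp: field_simps\<close>)
  qed
  then have "(\<lambda>\<nu>. power_transform y \<nu> a) holomorphic_on (\<Union>n\<in>UNIV. U n)"
    by (intro holomorphic_on_UN_open) (auto simp: U_def open_halfspace_Re_gt)
  moreover have "(\<Union>n\<in>UNIV. U n) = UNIV"
  proof -
    have "\<nu> \<in> U (nat \<lceil>2 - Re \<nu>\<rceil>)" for \<nu>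
      unfolding U_def using real_nat_ceiling_ge[of "2 - Re \<nu>"] by auto
    then show ?thesis by blast
  qed
  ultimately show ?thesis by simp
qed

lemma norm_powr_le:
  fixes a :: complex
  assumes "norm \<nu> \<le> S"
  shows "norm (a powr (- \<nu>)) \<le> exp (S * norm (Ln a))"
proof (cases "a = 0")
  case False
  have "norm (a powr (- \<nu>)) \<le> exp (norm (- \<nu> * Ln a))"
    using False norm_exp[of "- \<nu> * Ln a"] by (simp add: powr_def)
  also have "\<dots> \<le> exp (S * norm (Ln a))"
    using assms by (simp add: norm_mult mult_right_mono)
  finally show ?thesis .
qed simp

text \<open>
  The recurrence divides by \<open>y\<close> and so carries a uniform bound one unit to the left, as long as \<open>y\<close> stays away
  from \<open>0\<close>.
\<close>

lemma power_transform_bounded: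
  assumes a: "a \<notin> \<real>\<^sub>\<le>\<^sub>0" and \<delta>: "0 < \<delta>"
  obtains B where "0 \<le> B"
    "\<And>y \<nu>. \<delta> \<le> \<bar>y\<bar> \<Longrightarrow> norm \<nu> \<le> S \<Longrightarrow> norm (power_transform y \<nu> a) \<le> B"
proof -
  have "\<exists>B\<ge>0. \<forall>y \<nu>. \<delta> \<le> \<bar>y\<bar> \<longrightarrow> norm \<nu> \<le> S \<longrightarrow> 2 - real n \<le> Re \<nu> \<longrightarrow> norm (power_transform y \<nu> a) \<le> B"
    for n and S :: real
  proof (induction n arbitrary: S)
    case 0
    obtain C where C: "0 < C" "\<And>y \<nu> n. 2 \<le> Re \<nu> \<Longrightarrow> norm \<nu> \<le> S \<Longrightarrow>
       norm (wave_tail y \<nu> (a + of_nat n)) \<le> C * (1 + real n) powr (1 - 2)"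
      using wave_tail_bound[OF a, of 2 S] by auto
    have "norm (power_transform y \<nu> a) \<le> C" if "\<delta> \<le> \<bar>y\<bar>" "norm \<nu> \<le> S" "2 \<le> Re \<nu>" for y \<nu>
      using C(2)[of \<nu> y 0] that \<delta> wave_tail_eq_power_transform[OF _ _ a, of \<nu> y] by auto
    with C(1) show ?case by (intro exI[of _ C]) auto
  next
    case (Suc n)
    obtain B where B: "0 \<le> B" "\<And>y \<nu>. \<delta> \<le> \<bar>y\<bar> \<Longrightarrow> norm \<nu> \<le> S + 1 \<Longrightarrow> 2 - real n \<le> Re \<nu> \<Longrightarrow>
        norm (power_transform y \<nu> a) \<le> B"
      using Suc[of "S + 1"] by blast
    define B' where "B' = (\<bar>S\<bar> * B + exp (S * norm (Ln a))) / \<delta>"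
    have "norm (power_transform y \<nu> a) \<le> B'"
      if y: "\<delta> \<le> \<bar>y\<bar>" and \<nu>: "norm \<nu> \<le> S" "2 - real (Suc n) \<le> Re \<nu>" for y \<nu>
    proof -
      have "norm (power_transform y (\<nu> + 1) a) \<le> B"
        by (rule B(2)) (use y \<nu> norm_triangle_ineq[of \<nu> 1] in auto)
      then have "norm (\<nu> * power_transform y (\<nu> + 1) a) \<le> \<bar>S\<bar> * B"
        unfolding norm_mult using \<nu>(1) B(1) by (intro mult_mono) auto
      then have "norm (\<i> * of_real y * power_transform y \<nu> a) \<le> \<bar>S\<bar> * B + exp (S * norm (Ln a))"
        using power_transform_recurrence[OF a, of y \<nu>] y \<delta> norm_powr_le[OF \<nu>(1), of a]
          norm_triangle_ineq4[of "\<nu> * power_transform y (\<nu> + 1) a" "a powr (- \<nu>)"] by auto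
      moreover have "\<delta> * norm (power_transform y \<nu> a) \<le> \<bar>y\<bar> * norm (power_transform y \<nu> a)"
        using y by (intro mult_right_mono) auto
      ultimately show ?thesis
        using \<delta> by (simp add: B'_def norm_mult field_simps)
    qed
    moreover have "0 \<le> B'" using B \<delta> by (auto simp: B'_def)
    ultimately show ?case by blast
  qed
  from this[of S "nat \<lceil>\<bar>S\<bar> + 2\<rceil>"] obtain B where B: "0 \<le> B"
    "\<And>y \<nu>. \<delta> \<le> \<bar>y\<bar> \<Longrightarrow> norm \<nu> \<le> S \<Longrightarrow> 2 - real (nat \<lceil>\<bar>S\<bar> + 2\<rceil>) \<le> Re \<nu> \<Longrightarrow>
      norm (power_transform y \<nu> a) \<le> B" by blast
  have "2 - real (nat \<lceil>\<bar>S\<bar> + 2\<rceil>) \<le> Re \<nu>" if "norm \<nu> \<le> S" for \<nu>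
    using real_nat_ceiling_ge[of "\<bar>S\<bar> + 2"] abs_Re_le_cmod[of \<nu>] that by linarith
  with B show ?thesis using that by blast
qed

text \<open>
  What is left of \<open>power_transform y s a\<close> after one integration by parts. At \<open>y = 0\<close> it is \<open>0\<close>, as division by \<open>0\<close>
  gives \<open>0\<close>; this matches the convention that for \<open>\<lambda> = 1\<close> the primed term with \<open>m = 0\<close> is omitted.
\<close>

definition boundary_remainder :: "real \<Rightarrow> complex \<Rightarrow> complex \<Rightarrow> complex"
  where "boundary_remainder y s a = s / (\<i> * of_real y) * power_transform y (s + 1) a"

lemma boundary_remainder_0 [simp]: "boundary_remainder 0 s a = 0"
  by (simp add: boundary_remainder_def)

text \<open>
  A second integration by parts gains another factor \<open>1/y\<close>.
\<close>

lemma boundary_remainder_bound_aux: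
  assumes a: "a \<notin> \<real>\<^sub>\<le>\<^sub>0" and y: "y \<noteq> 0"
    and S: "norm s \<le> S" and B: "norm (power_transform y (s + 2) a) \<le> B"
    and A: "norm (a powr (- (s + 1))) \<le> A"
  shows "norm (boundary_remainder y s a) \<le> S * ((S + 1) * B + A) * (1 / y ^ 2)"
proof -
  have S0: "0 \<le> S" using S norm_ge_zero order_trans by blast
  have "norm (\<i> * of_real y * power_transform y (s + 1) a)
      = norm ((s + 1) * power_transform y (s + 2) a - a powr (- (s + 1)))"
    using power_transform_recurrence[OF a y, of "s + 1"] by (simp add: add.assoc)
  also have "\<dots> \<le> norm (s + 1) * norm (power_transform y (s + 2) a) + norm (a powr (- (s + 1)))"
    using norm_triangle_ineq4[of "(s + 1) * power_transform y (s + 2) a" "a powr (- (s + 1))"]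
    by (simp add: norm_mult)
  also have "\<dots> \<le> (S + 1) * B + A"
    using S A B S0 norm_triangle_ineq[of s 1] by (intro add_mono mult_mono) auto
  finally have "\<bar>y\<bar> * norm (power_transform y (s + 1) a) \<le> (S + 1) * B + A"
    by (simp add: norm_mult)
  then have "norm s * (\<bar>y\<bar> * norm (power_transform y (s + 1) a)) \<le> S * ((S + 1) * B + A)"
    using S S0 by (intro mult_mono) auto
  then have "norm s * (\<bar>y\<bar> * norm (power_transform y (s + 1) a)) * (1 / y ^ 2) \<le> S * ((S + 1) * B + A) * (1 / y ^ 2)"
    by (intro mult_right_mono) auto
  moreover have "norm (boundary_remainder y s a) = norm s * (\<bar>y\<bar> * norm (power_transform y (s + 1) a)) * (1 / y ^ 2)"
    using y by (simp add: boundary_remainder_def norm_mult norm_divide power2_eq_square field_simps flip: abs_mult)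
  ultimately show ?thesis by simp
qed

lemma boundary_remainder_bound:
  assumes a: "a \<notin> \<real>\<^sub>\<le>\<^sub>0" and \<delta>: "0 < \<delta>"
  obtains B where
    "\<And>y s. y = 0 \<or> \<delta> \<le> \<bar>y\<bar> \<Longrightarrow> norm s \<le> S \<Longrightarrow> norm (boundary_remainder y s a) \<le> B * (1 / y ^ 2)"
proof -
  obtain B where B: "0 \<le> B"
    "\<And>y \<nu>. \<delta> \<le> \<bar>y\<bar> \<Longrightarrow> norm \<nu> \<le> S + 2 \<Longrightarrow> norm (power_transform y \<nu> a) \<le> B"
    using power_transform_bounded[OF a \<delta>, of "S + 2"] by blast
  define A where "A = exp ((S + 1) * norm (Ln a))"
  have "norm (boundary_remainder y s a) \<le> S * ((S + 1) * B + A) * (1 / y ^ 2)"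
    if "y = 0 \<or> \<delta> \<le> \<bar>y\<bar>" "norm s \<le> S" for y s
  proof (cases "y = 0")
    case False
    then show ?thesis
      using that norm_triangle_ineq[of s 2] norm_triangle_ineq[of s 1]
      by (intro boundary_remainder_bound_aux a B norm_powr_le[of "s + 1" "S + 1" a, folded A_def]) auto
  qed simp
  then show ?thesis using that by blast
qed

lemma holomorphic_boundary_remainder:
  assumes a: "a \<notin> \<real>\<^sub>\<le>\<^sub>0"
  shows "(\<lambda>s. boundary_remainder y s a) holomorphic_on UNIV"
proof (cases "y = 0")
  case False
  have "((\<lambda>\<nu>. power_transform y \<nu> a) \<circ> (\<lambda>s. s + 1)) holomorphic_on UNIV"
    by (rule holomorphic_on_compose_gen[OF _ holomorphic_power_transform[OF a False]])
       (auto intro!: holomorphic_intros)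
  then show ?thesis
    unfolding boundary_remainder_def o_def using False by (intro holomorphic_intros) auto
qed simp

lemma powr_shift_tendsto_0:
  fixes a :: complex
  assumes a: "a \<notin> \<real>\<^sub>\<le>\<^sub>0" and \<mu>: "0 < Re \<mu>"
  shows "(\<lambda>n. (a + of_nat n) powr (- \<mu>)) \<longlonglongrightarrow> 0"
proof -
  have "0 \<le> Re \<mu>" using \<mu> by simp
  then obtain e C where e: "0 < e" "0 < C" and bound:
    "\<And>w u \<nu>. w \<in> ball a e \<Longrightarrow> 0 \<le> u \<Longrightarrow> Re \<mu> \<le> Re \<nu> \<Longrightarrow> norm \<nu> \<le> norm \<mu> \<Longrightarrow>
       norm ((w + of_real u) powr (- \<nu>)) \<le> C * (1 + u) powr (- Re \<mu>)"
    using powr_decay_on_slit_plane[OF a, of "Re \<mu>" "norm \<mu>"] by blast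
  have "norm ((a + of_nat n) powr (- \<mu>)) \<le> C * (1 + real n) powr (- Re \<mu>)" for n
    using bound[of a "real n" \<mu>] e by simp
  moreover have "(\<lambda>n. C * (1 + real n) powr (- Re \<mu>)) \<longlonglongrightarrow> 0"
    by (intro tendsto_mult_right_zero powr_1_plus_nat_tendsto_0) (use \<mu> in simp)
  ultimately show ?thesis
    by (rule Lim_null_comparison[OF always_eventually[OF allI]])
qed

text \<open>
  At \<open>y = 0\<close> the two last terms vanish, and the integral of the power is elementary.
\<close>

lemma wave_tail_eq_boundary:
  assumes a: "a \<notin> \<real>\<^sub>\<le>\<^sub>0" and s: "1 < Re s"
  shows "wave_tail y s a = (if y = 0 then a powr (1 - s) / (s - 1) else 0)
    - a powr (- s) * (1 / (\<i> * of_real y)) + boundary_remainder y s a"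
proof (cases "y = 0")
  case False
  then show ?thesis
    using power_transform_recurrence[OF a False, of s] wave_tail_eq_power_transform[OF s False a]
    by (simp add: boundary_remainder_def field_simps)
next
  case True
  interpret decaying_on_slit_plane "wave 0 s" by (rule decaying_wave[OF s])
  have s1: "s - 1 \<noteq> 0" using s by auto
  have "(\<lambda>n. (a + of_nat n) powr (1 - s) / (1 - s)) \<longlonglongrightarrow> tail_integral (wave 0 s) a + a powr (1 - s) / (1 - s)"
  proof (rule tail_integral_eq_limit_minus_primitive[OF _ a])
    fix z :: complex assume "z \<notin> \<real>\<^sub>\<le>\<^sub>0"
    then show "((\<lambda>z. z powr (1 - s) / (1 - s)) has_field_derivative wave 0 s z) (at z)"
      using s1 by (auto intro!: derivative_eq_intros)
  qed
  moreover have "(\<lambda>n. (a + of_nat n) powr (1 - s) / (1 - s)) \<longlonglongrightarrow> 0"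
    using powr_shift_tendsto_0[OF a, of "s - 1"] s by (intro tendsto_divide_zero) simp
  ultimately have "tail_integral (wave 0 s) a + a powr (1 - s) / (1 - s) = 0"
    using LIMSEQ_unique by blast
  then have "tail_integral (wave 0 s) a = a powr (1 - s) / (s - 1)"
    using s1 by (simp add: field_simps add_eq_0_iff)
  with True show ?thesis by (simp add: wave_tail_def)
qed

section \<open>Fourier series at the end points of an interval\<close>

definition fourier_coeff :: "(complex \<Rightarrow> complex) \<Rightarrow> int \<Rightarrow> complex"
  where "fourier_coeff h k = integral {0..1} (\<lambda>u::real. exp (2 * of_real pi * \<i> * of_int k * of_real u) * h (of_real u))"

lemma continuous_on_unit_interval:
  assumes "h holomorphic_on S" "of_real ` {0..1::real} \<subseteq> S"
  shows "continuous_on {0..1::real} (\<lambda>u. h (of_real u))"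
  by (rule continuous_on_compose2[OF holomorphic_on_imp_continuous_on[OF assms(1)]])
     (use assms(2) in \<open>auto intro!: continuous_intros\<close>)

lemma fourier_coeff_diff:
  assumes "f holomorphic_on S" "g holomorphic_on S" "of_real ` {0..1::real} \<subseteq> S"
  shows "fourier_coeff (\<lambda>z. f z - g z) k = fourier_coeff f k - fourier_coeff g k"
proof -
  have "(\<lambda>u::real. exp (2 * of_real pi * \<i> * of_int k * of_real u) * h (of_real u)) integrable_on {0..1}"
    if "h holomorphic_on S" for h
    by (intro integrable_continuous_interval continuous_intros
        continuous_on_unit_interval[OF that assms(3)])
  from Henstock_Kurzweil_Integration.integral_diff[OF this[OF assms(1)] this[OF assms(2)]]
  show ?thesis by (simp add: fourier_coeff_def right_diff_distrib)
qed

lemma exp_2pi_int [simp]: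
  "exp (2 * of_real pi * \<i> * of_int k) = (1 :: complex)"
  using exp_integer_2pi[of "of_int k"] by (simp add: mult_ac)

lemma fourier_coeff_by_parts:
  assumes S: "open S" "of_real ` {0..1::real} \<subseteq> S" and h: "h holomorphic_on S"
  shows "2 * of_real pi * \<i> * of_int k * fourier_coeff h k = h 1 - h 0 - fourier_coeff (deriv h) k"
proof -
  define c where "c = 2 * of_real pi * \<i> * of_int k"
  have dh: "deriv h holomorphic_on S" by (rule holomorphic_deriv[OF h S(1)])
  have int: "(\<lambda>u::real. exp (c * of_real u) * g (of_real u)) integrable_on {0..1}"
    if "g holomorphic_on S" for g
    by (intro integrable_continuous_interval continuous_intros continuous_on_unit_interval[OF that S(2)])
  have "((\<lambda>u::real. c * (exp (c * of_real u) * h (of_real u)) + exp (c * of_real u) * deriv h (of_real u))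
      has_integral (exp (c * of_real 1) * h (of_real 1) - exp (c * of_real 0) * h (of_real 0))) {0..1}"
  proof (rule fundamental_theorem_of_calculus)
    fix x :: real assume "x \<in> {0..1}"
    then have "of_real x \<in> S" using S(2) by auto
    then have "(h has_field_derivative deriv h (of_real x)) (at (of_real x))"
      by (rule holomorphic_derivI[OF h S(1)])
    then have "((\<lambda>z. exp (c * z) * h z) has_field_derivative
        c * (exp (c * of_real x) * h (of_real x)) + exp (c * of_real x) * deriv h (of_real x)) (at (of_real x))"
      by (auto intro!: derivative_eq_intros)
    then show "((\<lambda>u::real. exp (c * of_real u) * h (of_real u)) has_vector_derivative
        c * (exp (c * of_real x) * h (of_real x)) + exp (c * of_real x) * deriv h (of_real x)) (at x within {0..1})"
      by (rule has_vector_derivative_real_field)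
  qed simp
  then have "integral {0..1} (\<lambda>u::real. c * (exp (c * of_real u) * h (of_real u)) + exp (c * of_real u) * deriv h (of_real u))
      = exp c * h 1 - h 0"
    by (simp add: integral_unique)
  moreover have "integral {0..1} (\<lambda>u::real. c * (exp (c * of_real u) * h (of_real u)) + exp (c * of_real u) * deriv h (of_real u))
      = c * integral {0..1} (\<lambda>u::real. exp (c * of_real u) * h (of_real u))
        + integral {0..1} (\<lambda>u::real. exp (c * of_real u) * deriv h (of_real u))"
    by (subst Henstock_Kurzweil_Integration.integral_add[OF integrable_on_mult_right[OF int[OF h]] int[OF dh]])
       (simp add: Henstock_Kurzweil_Integration.integral_mult_right)
  moreover have "exp c = 1" by (simp add: c_def)
  ultimately show ?thesis
    unfolding fourier_coeff_def c_def[symmetric] by (simp add: algebra_simps)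
qed

lemma fourier_coeff_bound:
  assumes S: "open S" "of_real ` {0..1::real} \<subseteq> S" and h: "h holomorphic_on S"
  obtains C where "\<And>k. norm (of_int k * fourier_coeff h k) \<le> C"
proof -
  have dh: "deriv h holomorphic_on S" by (rule holomorphic_deriv[OF h S(1)])
  have "compact ((\<lambda>u::real. deriv h (of_real u)) ` {0..1})"
    by (intro compact_continuous_image continuous_on_unit_interval[OF dh S(2)]) auto
  then have "bounded ((\<lambda>u::real. deriv h (of_real u)) ` {0..1})"
    by (rule compact_imp_bounded)
  then obtain D where "\<forall>x\<in>(\<lambda>u::real. deriv h (of_real u)) ` {0..1}. norm x \<le> D"
    unfolding bounded_iff by blast
  then have D: "norm (deriv h (of_real u)) \<le> D" if "0 \<le> u" "u \<le> 1" for u :: real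
    using that by simp
  have "norm (of_int k * fourier_coeff h k) \<le> norm (h 1) + norm (h 0) + D" for k
  proof -
    have "norm (fourier_coeff (deriv h) k) \<le> D * (1 - 0)"
      unfolding fourier_coeff_def by (rule integral_bound)
         (use D in \<open>auto intro!: continuous_intros continuous_on_unit_interval[OF dh S(2)]
            simp: norm_mult norm_exp_eq_Re\<close>)
    then have "norm (2 * of_real pi * \<i> * of_int k * fourier_coeff h k) \<le> norm (h 1) + norm (h 0) + D"
      unfolding fourier_coeff_by_parts[OF S h]
      using norm_triangle_ineq4[of "h 1" "h 0"] norm_triangle_ineq4[of "h 1 - h 0" "fourier_coeff (deriv h) k"]
      by simp
    moreover have "norm (of_int k * fourier_coeff h k) * 1 \<le> norm (of_int k * fourier_coeff h k) * (2 * pi)"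
      using pi_gt3 by (intro mult_left_mono) auto
    ultimately show ?thesis by (simp add: norm_mult mult_ac)
  qed
  then show ?thesis using that by blast
qed

text \<open>
  For a function that is holomorphic near the interval, one integration by parts suffices.
\<close>

lemma fourier_coeff_tendsto_0:
  assumes S: "open S" "of_real ` {0..1::real} \<subseteq> S" and h: "h holomorphic_on S"
  shows "(\<lambda>n. fourier_coeff h (int n)) \<longlonglongrightarrow> 0" "(\<lambda>n. fourier_coeff h (- int n)) \<longlonglongrightarrow> 0"
proof -
  obtain C where C: "\<And>k. norm (of_int k * fourier_coeff h k) \<le> C"
    using fourier_coeff_bound[OF S h] by blast
  have "norm (fourier_coeff h k) \<le> C * (1 / real n)" if "\<bar>k\<bar> = int n" "0 < n" for k n
  proof -
    have "\<bar>real_of_int k\<bar> = real n" using that by (metis of_int_abs of_int_of_nat_eq)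
    then have "real n * norm (fourier_coeff h k) \<le> C" using C[of k] by (simp add: norm_mult)
    then show ?thesis using that by (simp add: field_simps)
  qed
  then have ev: "\<forall>\<^sub>F n in sequentially. norm (fourier_coeff h (int n)) \<le> C * (1 / real n)"
    "\<forall>\<^sub>F n in sequentially. norm (fourier_coeff h (- int n)) \<le> C * (1 / real n)"
    by (force intro!: eventually_mono[OF eventually_gt_at_top[of 0]])+
  have lim: "(\<lambda>n. C * (1 / real n)) \<longlonglongrightarrow> 0"
    by (intro tendsto_mult_right_zero lim_1_over_n)
  show "(\<lambda>n. fourier_coeff h (int n)) \<longlonglongrightarrow> 0" "(\<lambda>n. fourier_coeff h (- int n)) \<longlonglongrightarrow> 0"
    by (rule Lim_null_comparison[OF ev(1) lim], rule Lim_null_comparison[OF ev(2) lim])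
qed

lemma holomorphic_factor_zero:
  assumes "f holomorphic_on S" "open S" "f a = 0"
  obtains g where "g holomorphic_on S" "\<And>z. f z = (z - a) * g z" "g a = deriv f a"
proof (rule that)
  define g where "g = (\<lambda>z. if z = a then deriv f a else (f z - f a) / (z - a))"
  show "g holomorphic_on S" unfolding g_def by (rule pole_lemma_open[OF assms(1,2)])
  show "f z = (z - a) * g z" for z using assms(3) by (simp add: g_def)
  show "g a = deriv f a" by (simp add: g_def)
qed

text \<open>
  If \<open>h\<close> vanishes at \<open>0\<close> and \<open>1\<close>, then \<open>h(u) = (e\<^sup>2\<^sup>\<pi>\<^sup>i\<^sup>u - 1) q(u)\<close> with \<open>q\<close> holomorphic near
  \<open>[0,1]\<close>, since the zeros of the factor there are simple. The coefficients of \<open>h\<close> are then differences of consecutive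
  coefficients of \<open>q\<close>, and the partial sums telescope to two coefficients of \<open>q\<close>.
\<close>

lemma fourier_partial_sums_vanishing_ends:
  assumes S: "open S" "of_real ` {0..1::real} \<subseteq> S" and h: "h holomorphic_on S" and ends: "h 0 = 0" "h 1 = 0"
  shows "(\<lambda>m. fourier_coeff h (int m) + fourier_coeff h (- int m - 1)) sums 0"
proof -
  obtain h1 where h1: "h1 holomorphic_on S" "\<And>z. h z = (z - 0) * h1 z"
    using holomorphic_factor_zero[OF h S(1) ends(1)] by metis
  have "h1 1 = 0" using h1(2)[of 1] ends by simp
  then obtain h2 where h2: "h2 holomorphic_on S" "\<And>z. h1 z = (z - 1) * h2 z"
    using holomorphic_factor_zero[OF h1(1) S(1)] by metis
  define E where "E = (\<lambda>z::complex. exp (2 * of_real pi * \<i> * z) - 1)"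
  have E: "E holomorphic_on UNIV" unfolding E_def by (intro holomorphic_intros)
  have dE: "(E has_field_derivative 2 * of_real pi * \<i>) (at z)" if "exp (2 * of_real pi * \<i> * z) = 1" for z
    unfolding E_def by (rule derivative_eq_intros refl | simp add: that)+
  have E01: "E 0 = 0" "E 1 = 0" by (simp_all add: E_def)
  obtain e1 where e1: "e1 holomorphic_on UNIV" "\<And>z. E z = (z - 0) * e1 z" "e1 0 = deriv E 0"
    using holomorphic_factor_zero[OF E open_UNIV E01(1)] by metis
  have "e1 1 = 0" using e1(2)[of 1] E01 by simp
  then obtain e2 where e2: "e2 holomorphic_on UNIV" "\<And>z. e1 z = (z - 1) * e2 z" "e2 1 = deriv e1 1"
    using holomorphic_factor_zero[OF e1(1) open_UNIV] by metis
  have nz: "e2 (of_real u) \<noteq> 0" if u: "0 \<le> u" "u \<le> 1" for u :: real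
  proof -
    consider "u = 0" | "u = 1" | "0 < u" "u < 1" using u by linarith
    then show ?thesis
    proof cases
      case 1
      have "e1 0 = 2 * of_real pi * \<i>"
        unfolding e1(3) by (rule DERIV_imp_deriv[OF dE]) simp
      then show ?thesis using e2(2)[of 0] 1 by auto
    next
      case 2
      have "(e1 has_field_derivative deriv e1 1) (at 1)"
        by (rule holomorphic_derivI[OF e1(1)]) auto
      then have "((\<lambda>z. z * e1 z) has_field_derivative deriv e1 1) (at 1)"
        using \<open>e1 1 = 0\<close> by (auto intro!: derivative_eq_intros)
      moreover have "(\<lambda>z. z * e1 z) = E" using e1(2) by auto
      ultimately have "deriv e1 1 = 2 * of_real pi * \<i>"
        using dE[of 1] DERIV_unique by auto
      then show ?thesis using e2(3) 2 by simp
    next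
      case 3
      have "exp (2 * of_real pi * \<i> * of_real u) \<noteq> (1::complex)"
      proof
        assume "exp (2 * of_real pi * \<i> * of_real u) = (1::complex)"
        then obtain n :: int where n: "2 * pi * u = of_int (2 * n) * pi"
          unfolding exp_eq_1 by auto
        then have "u = of_int n" by simp
        then show False using 3 by auto
      qed
      then have "E (of_real u) \<noteq> 0" by (simp add: E_def)
      then show ?thesis using e1(2)[of "of_real u"] e2(2)[of "of_real u"] by auto
    qed
  qed
  \<comment> \<open>\<open>e2\<close> vanishes at the other integers, which may belong to \<open>S\<close>\<close>
  define T where "T = S \<inter> e2 -` (- {0})"
  have T: "open T" unfolding T_def
    using e2(1) S(1) holomorphic_on_imp_continuous_on holomorphic_on_subset
    by (intro continuous_open_preimage) (auto intro: open_Compl)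
  have T01: "of_real ` {0..1::real} \<subseteq> T"
    using S(2) nz by (auto simp: T_def)
  define q where "q = (\<lambda>z. h2 z / e2 z)"
  have q: "q holomorphic_on T"
    unfolding q_def
    by (intro holomorphic_intros holomorphic_on_subset[OF h2(1)] holomorphic_on_subset[OF e2(1)])
       (auto simp: T_def)
  have hq: "h (of_real u) = E (of_real u) * q (of_real u)" if "0 \<le> u" "u \<le> 1" for u :: real
    using nz[OF that] by (simp add: h1(2) h2(2) e1(2) e2(2) q_def)
  have coeff: "fourier_coeff h k = fourier_coeff q (k + 1) - fourier_coeff q k" for k
  proof -
    have int: "(\<lambda>u::real. exp (2 * of_real pi * \<i> * of_int k * of_real u) * q (of_real u)) integrable_on {0..1}" for k
      by (intro integrable_continuous_interval continuous_intros continuous_on_unit_interval[OF q T01])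
    have "fourier_coeff h k = integral {0..1} (\<lambda>u::real.
        exp (2 * of_real pi * \<i> * of_int (k + 1) * of_real u) * q (of_real u)
        - exp (2 * of_real pi * \<i> * of_int k * of_real u) * q (of_real u))"
      unfolding fourier_coeff_def
    proof (rule Henstock_Kurzweil_Integration.integral_cong)
      fix u :: real assume "u \<in> {0..1}"
      then have u: "0 \<le> u" "u \<le> 1" by auto
      have "exp (2 * of_real pi * \<i> * of_int (k + 1) * of_real u)
          = exp (2 * of_real pi * \<i> * of_int k * of_real u) * exp (2 * of_real pi * \<i> * of_real u)"
        by (simp add: algebra_simps flip: exp_add)
      then show "exp (2 * of_real pi * \<i> * of_int k * of_real u) * h (of_real u) =
          exp (2 * of_real pi * \<i> * of_int (k + 1) * of_real u) * q (of_real u)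
          - exp (2 * of_real pi * \<i> * of_int k * of_real u) * q (of_real u)"
        unfolding hq[OF u] by (simp add: E_def algebra_simps)
    qed
    also have "\<dots> = fourier_coeff q (k + 1) - fourier_coeff q k"
      unfolding fourier_coeff_def by (rule Henstock_Kurzweil_Integration.integral_diff[OF int int])
    finally show ?thesis .
  qed
  have "fourier_coeff h (int m) = fourier_coeff q (int (Suc m)) - fourier_coeff q (int m)"
    "fourier_coeff h (- int m - 1) = fourier_coeff q (- int m) - fourier_coeff q (- int (Suc m))" for m
    using coeff[of "int m"] coeff[of "- int m - 1"] by (simp_all add: add.commute minus_diff_commute)
  then have "(\<Sum>m<M. fourier_coeff h (int m) + fourier_coeff h (- int m - 1))
      = fourier_coeff q (int M) - fourier_coeff q (- int M)" for M
    by (induction M) (simp_all del: of_nat_Suc)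
  moreover have "(\<lambda>M. fourier_coeff q (int M) - fourier_coeff q (- int M)) \<longlonglongrightarrow> 0 - 0"
    by (intro tendsto_diff fourier_coeff_tendsto_0[OF T T01 q])
  ultimately show ?thesis by (simp add: sums_def)
qed

lemma fourier_coeff_affine:
  "fourier_coeff (\<lambda>z. \<alpha> + \<beta> * z) k = (if k = 0 then \<alpha> + \<beta> / 2 else \<beta> / (2 * of_real pi * \<i> * of_int k))"
proof (cases "k = 0")
  case True
  have "((\<lambda>u::real. \<alpha> + \<beta> * of_real u) has_integral (\<alpha> * of_real 1 + \<beta> * of_real 1 ^ 2 / 2 - (\<alpha> * of_real 0 + \<beta> * of_real 0 ^ 2 / 2))) {0..1}"
  proof (rule fundamental_theorem_of_calculus)
    fix x :: real
    have "((\<lambda>z. \<alpha> * z + \<beta> * z ^ 2 / 2) has_field_derivative \<alpha> + \<beta> * of_real x) (at (of_real x))"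
      by (auto intro!: derivative_eq_intros)
    then show "((\<lambda>u. \<alpha> * of_real u + \<beta> * of_real u ^ 2 / 2) has_vector_derivative \<alpha> + \<beta> * of_real x) (at x within {0..1})"
      by (rule has_vector_derivative_real_field)
  qed simp
  then show ?thesis using True by (simp add: fourier_coeff_def integral_unique)
next
  case False
  have hol: "(\<lambda>z. c + d * z) holomorphic_on UNIV" for c d :: complex
    by (intro holomorphic_intros)
  have dconst: "deriv (\<lambda>z. c + d * z) = (\<lambda>z. d + 0 * z)" for c d :: complex
    by (rule ext, rule DERIV_imp_deriv) (auto intro!: derivative_eq_intros)
  have "2 * of_real pi * \<i> * of_int k * fourier_coeff (\<lambda>z. \<beta> + 0 * z) k = 0"
    using fourier_coeff_by_parts[OF open_UNIV subset_UNIV hol[of \<beta> 0], of k]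
    unfolding dconst by (simp add: fourier_coeff_def)
  then have "fourier_coeff (\<lambda>z. \<beta> + 0 * z) k = 0" using False by simp
  then have "2 * of_real pi * \<i> * of_int k * fourier_coeff (\<lambda>z. \<alpha> + \<beta> * z) k = \<beta>"
    using fourier_coeff_by_parts[OF open_UNIV subset_UNIV hol[of \<alpha> \<beta>], of k]
    unfolding dconst by simp
  then show ?thesis using False by (simp add: field_simps)
qed

lemma fourier_partial_sums_affine:
  "(\<lambda>m. fourier_coeff (\<lambda>z. \<alpha> + \<beta> * z) (int m) + fourier_coeff (\<lambda>z. \<alpha> + \<beta> * z) (- int m - 1))
     sums (\<alpha> + \<beta> / 2)"
proof -
  define c where "c = \<beta> / (2 * of_real pi * \<i>)"
  have ne: "- int m - 1 \<noteq> 0" for m by presburger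
  have "(\<Sum>m<Suc M. fourier_coeff (\<lambda>z. \<alpha> + \<beta> * z) (int m) + fourier_coeff (\<lambda>z. \<alpha> + \<beta> * z) (- int m - 1))
      = \<alpha> + \<beta> / 2 - c * of_real (1 / real (Suc M))" for M
  proof (induction M)
    case 0
    then show ?case
      unfolding fourier_coeff_affine using ne[of 0] by (simp add: c_def)
  next
    case (Suc M)
    have "fourier_coeff (\<lambda>z. \<alpha> + \<beta> * z) (int (Suc M)) = c * of_real (1 / real (Suc M))"
      unfolding fourier_coeff_affine by (simp add: c_def)
    moreover have "fourier_coeff (\<lambda>z. \<alpha> + \<beta> * z) (- int (Suc M) - 1) = - (c * of_real (1 / real (Suc (Suc M))))"
    proof -
      have "of_int (- int (Suc M) - 1) = - (of_nat (Suc (Suc M)) :: complex)" by simp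
      then show ?thesis
        unfolding fourier_coeff_affine if_not_P[OF ne] c_def by (simp only:) (simp del: of_nat_Suc)
    qed
    ultimately show ?case using Suc by (subst sum.lessThan_Suc) (simp only:, simp)
  qed
  moreover have "(\<lambda>M. \<alpha> + \<beta> / 2 - c * of_real (1 / real (Suc M))) \<longlonglongrightarrow> \<alpha> + \<beta> / 2 - c * of_real 0"
    by (intro tendsto_intros LIMSEQ_Suc[OF lim_1_over_n])
  ultimately have "(\<lambda>M. \<Sum>m<Suc M. fourier_coeff (\<lambda>z. \<alpha> + \<beta> * z) (int m) + fourier_coeff (\<lambda>z. \<alpha> + \<beta> * z) (- int m - 1))
      \<longlonglongrightarrow> \<alpha> + \<beta> / 2" by simp
  then show ?thesis unfolding sums_def by (rule LIMSEQ_imp_Suc)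
qed

text \<open>
  The value of a Fourier series at a jump is the mean of the one-sided limits. Subtracting the affine function with the
  same end values reduces it to the two previous lemmas.
\<close>

lemma fourier_partial_sums:
  assumes S: "open S" "of_real ` {0..1::real} \<subseteq> S" and h: "h holomorphic_on S"
  shows "(\<lambda>m. fourier_coeff h (int m) + fourier_coeff h (- int m - 1)) sums ((h 0 + h 1) / 2)"
proof -
  define \<beta> where "\<beta> = h 1 - h 0"
  have aff: "(\<lambda>z. h 0 + \<beta> * z) holomorphic_on S" by (intro holomorphic_intros)
  have "(\<lambda>m. fourier_coeff (\<lambda>z. h z - (h 0 + \<beta> * z)) (int m)
      + fourier_coeff (\<lambda>z. h z - (h 0 + \<beta> * z)) (- int m - 1)) sums 0"
    by (rule fourier_partial_sums_vanishing_ends[OF S holomorphic_on_diff[OF h aff]]) (simp_all add: \<beta>_def)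
  from sums_add[OF this fourier_partial_sums_affine[of "h 0" \<beta>]]
  have "(\<lambda>m. fourier_coeff h (int m) + fourier_coeff h (- int m - 1)) sums (h 0 + \<beta> / 2)"
    unfolding fourier_coeff_diff[OF h aff S(2)] by (simp add: algebra_simps)
  moreover have "h 0 + \<beta> / 2 = (h 0 + h 1) / 2" by (simp add: \<beta>_def field_simps)
  ultimately show ?thesis by simp
qed

section \<open>The Lerch zeta function as a sum over frequencies\<close>

definition freq :: "real \<Rightarrow> int \<Rightarrow> real"
  where "freq l k = 2 * pi * (of_int k + l)"

lemma freq_nonneg_index: "freq l (int m) = 2 * pi * (real m + l)"
  by (simp add: freq_def)

lemma freq_neg_index: "freq l (- int m - 1) = - (2 * pi * (real m + (1 - l)))"
  by (simp add: freq_def algebra_simps)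

lemma exp_freq: "exp (\<i> * of_real (freq l k)) = exp (2 * of_real pi * \<i> * of_real l)"
proof -
  have eq: "\<i> * of_real (freq l k) = 2 * of_real pi * \<i> * of_int k + 2 * of_real pi * \<i> * of_real l"
    by (simp add: freq_def algebra_simps)
  show ?thesis unfolding eq exp_add by simp
qed

text \<open>
  The frequencies are equally spaced, so only finitely many of them are close to \<open>0\<close>.
\<close>

lemma freq_separated:
  assumes "0 < l" "l \<le> 1"
  obtains \<delta> where "0 < \<delta>" "\<And>k. freq l k = 0 \<or> \<delta> \<le> \<bar>freq l k\<bar>"
proof -
  define d where "d = (if l = 1 then 1 else min l (1 - l))"
  have d: "0 < d" using assms by (auto simp: d_def)
  have "of_int k + l = 0 \<or> d \<le> \<bar>of_int k + l\<bar>" for k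
  proof (cases "0 \<le> k")
    case True
    then have "0 \<le> real_of_int k" by simp
    then show ?thesis using assms by (auto simp: d_def)
  next
    case False
    then have "k \<le> - 1" by simp
    then have k: "real_of_int k \<le> - 1" by (metis of_int_le_iff of_int_minus of_int_1)
    show ?thesis
    proof (cases "l = 1")
      case True
      have "k = - 1 \<or> k \<le> - 2" using \<open>k \<le> - 1\<close> by presburger
      then have "real_of_int k = - 1 \<or> real_of_int k \<le> - 2" by linarith
      then show ?thesis using True by (auto simp: d_def)
    qed (use assms k in \<open>auto simp: d_def\<close>)
  qed
  then have "freq l k = 0 \<or> 2 * pi * d \<le> \<bar>freq l k\<bar>" for k
    by (auto simp: freq_def abs_mult intro!: mult_left_mono)
  then show ?thesis using that[of "2 * pi * d"] d by simp
qed

lemma summable_inverse_square_shift: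
  assumes "0 \<le> c"
  shows "summable (\<lambda>m. 1 / (2 * pi * (real m + c)) ^ 2)"
proof (rule summable_comparison_test')
  show "summable (\<lambda>m. inverse (real m ^ 2))"
    using inverse_power_summable[of 2, where 'a = real] by simp
  fix m :: nat assume m: "m \<ge> 1"
  have "1 * real m \<le> (2 * pi) * (real m + c)"
    using assms pi_gt3 by (intro mult_mono) auto
  then have "inverse ((2 * pi * (real m + c)) ^ 2) \<le> inverse (real m ^ 2)"
    using m by (intro le_imp_inverse_le power_mono) auto
  then show "norm (1 / (2 * pi * (real m + c)) ^ 2) \<le> inverse (real m ^ 2)"
    by (simp add: divide_inverse)
qed

lemma summable_freq_weights:
  assumes "0 < l" "l \<le> 1"
  shows "summable (\<lambda>m. 1 / freq l (int m) ^ 2 + 1 / freq l (- int m - 1) ^ 2)"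
  unfolding freq_nonneg_index freq_neg_index power2_minus
  by (intro summable_add summable_inverse_square_shift) (use assms in auto)

text \<open>
  The value of \<open>1 + F(\<lambda>,0)\<close>; see \<open>periodic_zeta_0\<close>.
\<close>

definition lerch_constant :: "real \<Rightarrow> complex"
  where "lerch_constant l = (if l = 1 then 1 / 2 else 1 / (1 - exp (2 * of_real pi * \<i> * of_real l)))"

lemma exp_2pi_neq_1:
  assumes "0 < l" "l < 1"
  shows "exp (2 * of_real pi * \<i> * of_real l) \<noteq> (1 :: complex)"
proof
  assume "exp (2 * of_real pi * \<i> * of_real l) = (1::complex)"
  then obtain n :: int where n: "2 * pi * l = of_int (2 * n) * pi"
    unfolding exp_eq_1 by auto
  then have "l = of_int n" by simp
  then show False using assms by auto
qed

text \<open>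
  The partial fraction series of the cotangent in disguise. For \<open>\<lambda> < 1\<close> it is the Fourier series of
  \<open>e\<^sup>2\<^sup>\<pi>\<^sup>i\<^sup>\<lambda>\<^sup>u\<close> at the end points; for \<open>\<lambda> = 1\<close> the frequencies cancel in pairs and the sum telescopes.
\<close>

lemma reciprocal_freq_sums:
  assumes l: "0 < l" "l \<le> 1"
  shows "(\<lambda>m. 1 / (\<i> * of_real (freq l (int m))) + 1 / (\<i> * of_real (freq l (- int m - 1))))
    sums (1 / 2 - lerch_constant l)"
proof (cases "l = 1")
  case True
  define f where "f = (\<lambda>m. 1 / (2 * of_real pi * \<i>) * of_real (1 / real m))"
  have "f \<longlonglongrightarrow> 1 / (2 * of_real pi * \<i>) * of_real 0"
    unfolding f_def by (intro tendsto_intros lim_1_over_n)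
  from telescope_sums[OF this]
  have "(\<lambda>m. f (Suc m) - f m) sums 0" by (simp add: f_def)
  moreover have "f (Suc m) - f m = 1 / (\<i> * of_real (freq l (int m))) + 1 / (\<i> * of_real (freq l (- int m - 1)))" for m
    unfolding freq_nonneg_index freq_neg_index True by (simp add: f_def add.commute mult_ac)
  ultimately show ?thesis using True by (simp add: lerch_constant_def)
next
  case False
  define \<omega> :: complex where "\<omega> = exp (2 * of_real pi * \<i> * of_real l)"
  have \<omega>: "\<omega> \<noteq> 1" unfolding \<omega>_def using l False by (intro exp_2pi_neq_1) auto
  define h where "h = (\<lambda>z. exp (2 * of_real pi * \<i> * of_real l * z))"
  have nz: "freq l k \<noteq> 0" for k
  proof
    assume "freq l k = 0"
    then have "l = of_int (- k)" by (simp add: freq_def)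
    moreover have "l < 1" using l False by simp
    ultimately have "0 < real_of_int (- k)" "real_of_int (- k) < 1" using l by simp_all
    then have "0 < - k" "- k < 1" by (simp_all only: of_int_0_less_iff of_int_less_1_iff)
    then show False by linarith
  qed
  have "fourier_coeff h k = (\<omega> - 1) * (1 / (\<i> * of_real (freq l k)))" for k
  proof -
    define c where "c = \<i> * of_real (freq l k)"
    have c: "c \<noteq> 0" using nz by (simp add: c_def)
    have "((\<lambda>u::real. exp (c * of_real u)) has_integral (exp (c * of_real 1) / c - exp (c * of_real 0) / c)) {0..1}"
    proof (rule fundamental_theorem_of_calculus)
      fix x :: real
      have "((\<lambda>z. exp (c * z) / c) has_field_derivative exp (c * of_real x)) (at (of_real x))"
        using c by (auto intro!: derivative_eq_intros)
      then show "((\<lambda>u. exp (c * of_real u) / c) has_vector_derivative exp (c * of_real x)) (at x within {0..1})"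
        by (rule has_vector_derivative_real_field)
    qed simp
    moreover have "exp (2 * of_real pi * \<i> * of_int k * of_real u) * h (of_real u) = exp (c * of_real u)" for u :: real
      by (simp add: h_def c_def freq_def algebra_simps flip: exp_add)
    moreover have "exp c = \<omega>" unfolding c_def \<omega>_def by (rule exp_freq)
    ultimately show ?thesis
      by (simp add: fourier_coeff_def integral_unique c_def[symmetric] diff_divide_distrib)
  qed
  moreover have "(\<lambda>m. fourier_coeff h (int m) + fourier_coeff h (- int m - 1)) sums ((h 0 + h 1) / 2)"
    by (rule fourier_partial_sums[OF open_UNIV]) (auto simp: h_def intro!: holomorphic_intros)
  ultimately have "(\<lambda>m. (\<omega> - 1) * (1 / (\<i> * of_real (freq l (int m))) + 1 / (\<i> * of_real (freq l (- int m - 1)))))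
      sums ((1 + \<omega>) / 2)"
    by (simp only: distrib_left) (simp add: h_def \<omega>_def)
  from sums_divide[OF this, of "\<omega> - 1"]
  have "(\<lambda>m. 1 / (\<i> * of_real (freq l (int m))) + 1 / (\<i> * of_real (freq l (- int m - 1))))
      sums ((1 + \<omega>) / 2 / (\<omega> - 1))"
    using \<omega> by simp
  moreover have "(1 + \<omega>) / 2 / (\<omega> - 1) = 1 / 2 - 1 / (1 - \<omega>)"
    using \<omega> by (auto simp: divide_simps) (auto simp: algebra_simps)
  then have "(1 + \<omega>) / 2 / (\<omega> - 1) = 1 / 2 - lerch_constant l"
    using False by (simp add: lerch_constant_def \<omega>_def)
  ultimately show ?thesis by simp
qed

definition remainder_pair :: "real \<Rightarrow> complex \<Rightarrow> complex \<Rightarrow> nat \<Rightarrow> complex"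
  where "remainder_pair l s a m =
    boundary_remainder (freq l (int m)) s a + boundary_remainder (freq l (- int m - 1)) s a"

definition lerch_expansion :: "real \<Rightarrow> complex \<Rightarrow> complex \<Rightarrow> complex"
  where "lerch_expansion l a s =
    (if l = 1 then 1 else 0) * a powr (1 - s) / (s - 1) + a powr (- s) * lerch_constant l
      + (\<Sum>m. remainder_pair l s a m)"

lemma remainder_pair_bound:
  assumes l: "0 < l" "l \<le> 1" and a: "a \<notin> \<real>\<^sub>\<le>\<^sub>0"
  obtains B where "\<And>s m. norm s \<le> S \<Longrightarrow>
    norm (remainder_pair l s a m) \<le> B * (1 / freq l (int m) ^ 2 + 1 / freq l (- int m - 1) ^ 2)"
proof -
  obtain \<delta> where \<delta>: "0 < \<delta>" "\<And>k. freq l k = 0 \<or> \<delta> \<le> \<bar>freq l k\<bar>"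
    using freq_separated[OF l] by blast
  obtain B where B: "\<And>y s. y = 0 \<or> \<delta> \<le> \<bar>y\<bar> \<Longrightarrow> norm s \<le> S \<Longrightarrow>
      norm (boundary_remainder y s a) \<le> B * (1 / y ^ 2)"
    using boundary_remainder_bound[OF a \<delta>(1), of S] by blast
  have "norm (remainder_pair l s a m) \<le> B * (1 / freq l (int m) ^ 2 + 1 / freq l (- int m - 1) ^ 2)"
    if "norm s \<le> S" for s m
    unfolding remainder_pair_def distrib_left
    by (rule norm_triangle_mono[OF B B]) (use \<delta>(2) that in auto)
  then show ?thesis using that by blast
qed

lemma summable_remainder_pair:
  assumes l: "0 < l" "l \<le> 1" and a: "a \<notin> \<real>\<^sub>\<le>\<^sub>0"
  shows "summable (remainder_pair l s a)"
proof -
  obtain B where "\<And>s' m. norm s' \<le> norm s \<Longrightarrow> norm (remainder_pair l s' a m)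
      \<le> B * (1 / freq l (int m) ^ 2 + 1 / freq l (- int m - 1) ^ 2)"
    using remainder_pair_bound[OF l a, of "norm s"] by blast
  then have B: "norm (remainder_pair l s a m)
      \<le> B * (1 / freq l (int m) ^ 2 + 1 / freq l (- int m - 1) ^ 2)" for m
    by simp
  show ?thesis
    by (rule summable_comparison_test'[OF summable_mult[OF summable_freq_weights[OF l]]])
       (use B in auto)
qed

lemma holomorphic_suminf_remainder_pair:
  assumes l: "0 < l" "l \<le> 1" and a: "a \<notin> \<real>\<^sub>\<le>\<^sub>0"
  shows "(\<lambda>s. \<Sum>m. remainder_pair l s a m) holomorphic_on UNIV"
proof (rule holomorphic_uniform_sequence[OF open_UNIV])
  show "(\<lambda>s. \<Sum>m<M. remainder_pair l s a m) holomorphic_on UNIV" for M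
    unfolding remainder_pair_def by (intro holomorphic_intros holomorphic_boundary_remainder a)
  fix s :: complex
  obtain B where B: "\<And>s' m. norm s' \<le> norm s + 1 \<Longrightarrow> norm (remainder_pair l s' a m)
      \<le> B * (1 / freq l (int m) ^ 2 + 1 / freq l (- int m - 1) ^ 2)"
    using remainder_pair_bound[OF l a, of "norm s + 1"] by blast
  have ball: "norm s' \<le> norm s + 1" if "s' \<in> cball s 1" for s'
    using that norm_triangle_ineq4[of s "s - s'"] by (simp add: dist_norm)
  have "uniform_limit (cball s 1) (\<lambda>M s. \<Sum>m<M. remainder_pair l s a m)
      (\<lambda>s. \<Sum>m. remainder_pair l s a m) sequentially"
    by (rule Weierstrass_m_test[OF B[OF ball] summable_mult[OF summable_freq_weights[OF l]]])
  then show "\<exists>d>0. cball s d \<subseteq> UNIV \<and> uniform_limit (cball s d)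
      (\<lambda>M s. \<Sum>m<M. remainder_pair l s a m) (\<lambda>s. \<Sum>m. remainder_pair l s a m) sequentially"
    by (intro exI[of _ 1]) auto
qed

lemma wave_tail_sums:
  assumes l: "0 < l" "l \<le> 1" and a: "a \<notin> \<real>\<^sub>\<le>\<^sub>0" and s: "1 < Re s"
  shows "(\<lambda>m. wave_tail (freq l (int m)) s a + wave_tail (freq l (- int m - 1)) s a)
    sums (lerch_expansion l a s - a powr (- s) / 2)"
proof -
  define p where "p = (if l = 1 then 1 else 0) * a powr (1 - s) / (s - 1)"
  have pos: "freq l (int m) \<noteq> 0" for m
    unfolding freq_nonneg_index using l by auto
  have neg: "freq l (- int m - 1) = 0 \<longleftrightarrow> m = 0 \<and> l = 1" for m
    unfolding freq_neg_index using l by auto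
  have "wave_tail (freq l (int m)) s a + wave_tail (freq l (- int m - 1)) s a
      = (if m = 0 then p else 0)
        - a powr (- s) * (1 / (\<i> * of_real (freq l (int m))) + 1 / (\<i> * of_real (freq l (- int m - 1))))
        + remainder_pair l s a m" for m
    unfolding wave_tail_eq_boundary[OF a s] remainder_pair_def neg if_not_P[OF pos] distrib_left p_def
    by (simp only: if_distrib) auto
  moreover have "(\<lambda>m. (if m = 0 then p else 0)
        - a powr (- s) * (1 / (\<i> * of_real (freq l (int m))) + 1 / (\<i> * of_real (freq l (- int m - 1))))
        + remainder_pair l s a m)
      sums (p - a powr (- s) * (1 / 2 - lerch_constant l) + (\<Sum>m. remainder_pair l s a m))"
    by (intro sums_add sums_diff sums_mult reciprocal_freq_sums l
        summable_sums summable_remainder_pair a sums_single[of 0 "\<lambda>_. p"])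
  moreover have "p - a powr (- s) * (1 / 2 - lerch_constant l) + (\<Sum>m. remainder_pair l s a m)
      = lerch_expansion l a s - a powr (- s) / 2"
    by (simp add: lerch_expansion_def p_def algebra_simps)
  ultimately show ?thesis by simp
qed

text \<open>
  The difference \<open>wave_tail y s a - \<omega> wave_tail y s (a+1)\<close> is the integral over \<open>[0,1]\<close> alone, because
  \<open>e\<^sup>i\<^sup>y = \<omega>\<close> for every frequency. It is a Fourier coefficient of \<open>e\<^sup>2\<^sup>\<pi>\<^sup>i\<^sup>\<lambda>\<^sup>u (a+u)\<^sup>-\<^sup>s\<close>.
\<close>

lemma lerch_expansion_shift:
  assumes l: "0 < l" "l \<le> 1" and a: "a \<notin> \<real>\<^sub>\<le>\<^sub>0" and s: "1 < Re s"
  shows "lerch_expansion l a s - exp (2 * of_real pi * \<i> * of_real l) * lerch_expansion l (a + 1) s = a powr (- s)"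
proof -
  define \<omega> :: complex where "\<omega> = exp (2 * of_real pi * \<i> * of_real l)"
  have a1: "a + 1 \<notin> \<real>\<^sub>\<le>\<^sub>0" using slit_plane_add_real[OF a, of 1] by simp
  define S where "S = (\<lambda>z. a + z) -` (- \<real>\<^sub>\<le>\<^sub>0)"
  have S: "open S" unfolding S_def
    by (intro continuous_open_vimage continuous_intros) (simp add: open_Compl)
  have S01: "of_real ` {0..1::real} \<subseteq> S"
    using slit_plane_add_real[OF a] by (auto simp: S_def)
  define h where "h = (\<lambda>z. exp (2 * of_real pi * \<i> * of_real l * z) * (a + z) powr (- s))"
  have h: "h holomorphic_on S"
    unfolding h_def S_def by (intro holomorphic_intros) auto
  have coeff: "fourier_coeff h k = wave_tail (freq l k) s a - \<omega> * wave_tail (freq l k) s (a + 1)" for k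
  proof -
    have eq: "exp (2 * of_real pi * \<i> * of_int k * of_real u) * h (of_real u)
      = exp (- (\<i> * of_real (freq l k) * a)) * wave (freq l k) s (a + of_real u)" for u :: real
    proof -
      have "exp (2 * of_real pi * \<i> * of_int k * of_real u) * exp (2 * of_real pi * \<i> * of_real l * of_real u)
        = exp (- (\<i> * of_real (freq l k) * a)) * exp (\<i> * of_real (freq l k) * (a + of_real u))"
        by (simp add: freq_def algebra_simps flip: exp_add)
      then show ?thesis by (simp add: h_def mult.assoc[symmetric])
    qed
    show ?thesis
      using wave_tail_split[OF a s, of 1 "freq l k"]
      unfolding fourier_coeff_def eq \<omega>_def exp_freq[of l k, symmetric] by simp
  qed
  have pair: "fourier_coeff h (int m) + fourier_coeff h (- int m - 1)
      = (wave_tail (freq l (int m)) s a + wave_tail (freq l (- int m - 1)) s a)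
        - \<omega> * (wave_tail (freq l (int m)) s (a + 1) + wave_tail (freq l (- int m - 1)) s (a + 1))" for m
    unfolding coeff by (simp only: distrib_left) simp
  have "(\<lambda>m. fourier_coeff h (int m) + fourier_coeff h (- int m - 1)) sums ((h 0 + h 1) / 2)"
    by (rule fourier_partial_sums[OF S S01 h])
  moreover have "(\<lambda>m. fourier_coeff h (int m) + fourier_coeff h (- int m - 1))
    sums ((lerch_expansion l a s - a powr (- s) / 2) - \<omega> * (lerch_expansion l (a + 1) s - (a + 1) powr (- s) / 2))"
    unfolding pair by (intro sums_diff sums_mult wave_tail_sums l a a1 s)
  ultimately have "(h 0 + h 1) / 2
      = (lerch_expansion l a s - a powr (- s) / 2) - \<omega> * (lerch_expansion l (a + 1) s - (a + 1) powr (- s) / 2)"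
    by (rule sums_unique2)
  moreover have "h 0 = a powr (- s)" "h 1 = \<omega> * (a + 1) powr (- s)"
    by (simp_all add: h_def \<omega>_def)
  ultimately have eq: "(a powr (- s) + \<omega> * (a + 1) powr (- s)) / 2
      = (lerch_expansion l a s - a powr (- s) / 2) - \<omega> * (lerch_expansion l (a + 1) s - (a + 1) powr (- s) / 2)"
    by (simp only:)
  \<comment> \<open>the halves of the mean value and of \<open>wave_tail_sums\<close> combine\<close>
  have solve: "x - \<omega> * y = p" if "(p + \<omega> * q) / 2 = (x - p / 2) - \<omega> * (y - q / 2)" for p q x y
  proof -
    have "p + \<omega> * q = ((p + \<omega> * q) / 2) * 2" by simp
    also have "\<dots> = 2 * x - p - \<omega> * (2 * y - q)"
      unfolding that by (simp add: algebra_simps)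
    finally have eq2: "2 * (x - \<omega> * y) = 2 * p" by (simp add: algebra_simps)
    have nz: "(2::complex) \<noteq> 0" by simp
    show ?thesis by (rule iffD1[OF mult_left_cancel[OF nz] eq2])
  qed
  have "lerch_expansion l a s - \<omega> * lerch_expansion l (a + 1) s = a powr (- s)"
    by (rule solve[OF eq])
  then show ?thesis unfolding \<omega>_def .
qed

lemma lerch_expansion_shift_tendsto_0:
  assumes l: "0 < l" "l \<le> 1" and a: "a \<notin> \<real>\<^sub>\<le>\<^sub>0" and s: "1 < Re s"
  shows "(\<lambda>n. lerch_expansion l (a + of_nat n) s) \<longlonglongrightarrow> 0"
proof -
  have an: "a + of_nat n \<notin> \<real>\<^sub>\<le>\<^sub>0" for n
    using slit_plane_add_real[OF a, of "real n"] by simp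
  define \<sigma> where "\<sigma> = Re s + 2"
  have \<sigma>: "1 < \<sigma>" using s by (simp add: \<sigma>_def)
  obtain C where "0 < C" and C: "\<And>y \<nu> n. \<sigma> \<le> Re \<nu> \<Longrightarrow> norm \<nu> \<le> norm (s + 2) \<Longrightarrow>
       norm (wave_tail y \<nu> (a + of_nat n)) \<le> C * (1 + real n) powr (1 - \<sigma>)"
    using wave_tail_bound[OF a \<sigma>, of "norm (s + 2)"] by blast
  define W where "W = (\<lambda>m. 1 / freq l (int m) ^ 2 + 1 / freq l (- int m - 1) ^ 2)"
  have W: "summable W" unfolding W_def by (rule summable_freq_weights[OF l])
  define K where "K = (\<lambda>n. norm s * ((norm s + 1) * (C * (1 + real n) powr (1 - \<sigma>))
      + norm ((a + of_nat n) powr (- (s + 1)))))"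
  have K: "norm (boundary_remainder y s (a + of_nat n)) \<le> K n * (1 / y ^ 2)" for y n
  proof (cases "y = 0")
    case False
    have "norm (power_transform y (s + 2) (a + of_nat n)) \<le> C * (1 + real n) powr (1 - \<sigma>)"
      using C[of "s + 2" y n] wave_tail_eq_power_transform[OF _ False an, of "s + 2" n] s
      by (simp add: \<sigma>_def)
    then show ?thesis
      unfolding K_def by (intro boundary_remainder_bound_aux an False) auto
  qed simp
  have pair: "norm (remainder_pair l s (a + of_nat n) m) \<le> K n * W m" for m n
    unfolding remainder_pair_def W_def distrib_left by (rule norm_triangle_mono[OF K K])
  have "norm (\<Sum>m. remainder_pair l s (a + of_nat n) m) \<le> K n * suminf W" for n
  proof -
    have "norm (\<Sum>m. remainder_pair l s (a + of_nat n) m) \<le> (\<Sum>m. K n * W m)"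
      by (rule norm_suminf_le) (auto intro: pair summable_mult W)
    also have "\<dots> = K n * suminf W" by (rule suminf_mult[OF W])
    finally show ?thesis .
  qed
  moreover have "(\<lambda>n. K n * suminf W) \<longlonglongrightarrow> norm s * ((norm s + 1) * (C * 0) + 0) * suminf W"
    unfolding K_def using \<sigma> s
    by (intro tendsto_intros powr_1_plus_nat_tendsto_0 tendsto_norm_zero powr_shift_tendsto_0 a) auto
  then have "(\<lambda>n. K n * suminf W) \<longlonglongrightarrow> 0" by simp
  ultimately have R: "(\<lambda>n. \<Sum>m. remainder_pair l s (a + of_nat n) m) \<longlonglongrightarrow> 0"
    by (rule Lim_null_comparison[OF always_eventually[OF allI]])
  have P: "(\<lambda>n. (a + of_nat n) powr (1 - s)) \<longlonglongrightarrow> 0" "(\<lambda>n. (a + of_nat n) powr (- s)) \<longlonglongrightarrow> 0"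
    using powr_shift_tendsto_0[OF a, of "s - 1"] powr_shift_tendsto_0[OF a, of s] s by simp_all
  have "(\<lambda>n. lerch_expansion l (a + of_nat n) s) \<longlonglongrightarrow> (if l = 1 then 1 else 0) * 0 / (s - 1) + 0 * lerch_constant l + 0"
    unfolding lerch_expansion_def using s by (intro tendsto_intros P R) auto
  then show ?thesis by simp
qed

text \<open>
  By the difference equation the series telescopes.
\<close>

lemma lerch_series_sums:
  assumes l: "0 < l" "l \<le> 1" and a: "a \<notin> \<real>\<^sub>\<le>\<^sub>0" and s: "1 < Re s"
  shows "(\<lambda>n. exp (2 * of_real pi * of_nat n * \<i> * of_real l) / (of_nat n + a) powr s) sums lerch_expansion l a s"
proof -
  define \<omega> :: complex where "\<omega> = exp (2 * of_real pi * \<i> * of_real l)"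
  have \<omega>_power: "exp (2 * of_real pi * of_nat n * \<i> * of_real l) = \<omega> ^ n" for n
    by (simp add: \<omega>_def mult_ac flip: exp_of_nat_mult)
  have an: "a + of_nat n \<notin> \<real>\<^sub>\<le>\<^sub>0" for n
    using slit_plane_add_real[OF a, of "real n"] by simp
  have term_eq: "exp (2 * of_real pi * of_nat n * \<i> * of_real l) / (of_nat n + a) powr s
      = \<omega> ^ n * lerch_expansion l (a + of_nat n) s - \<omega> ^ Suc n * lerch_expansion l (a + of_nat (Suc n)) s" for n
  proof -
    have "\<omega> ^ n * (lerch_expansion l (a + of_nat n) s - \<omega> * lerch_expansion l (a + of_nat n + 1) s)
        = \<omega> ^ n * (a + of_nat n) powr (- s)"
      using lerch_expansion_shift[OF l an s, of n] by (simp add: \<omega>_def)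
    then show ?thesis
      unfolding \<omega>_power by (simp add: powr_minus_divide algebra_simps)
  qed
  have "(\<lambda>n. \<omega> ^ n * lerch_expansion l (a + of_nat n) s) \<longlonglongrightarrow> 0"
  proof (rule tendsto_norm_zero_cancel)
    have "norm \<omega> = 1" by (simp add: \<omega>_def norm_exp_eq_Re)
    then show "(\<lambda>n. norm (\<omega> ^ n * lerch_expansion l (a + of_nat n) s)) \<longlonglongrightarrow> 0"
      using lerch_expansion_shift_tendsto_0[OF l a s] by (simp add: norm_mult norm_power tendsto_norm_zero)
  qed
  from telescope_sums'[OF this] show ?thesis
    unfolding term_eq by simp
qed

lemma holomorphic_lerch_expansion:
  assumes l: "0 < l" "l \<le> 1" and a: "a \<notin> \<real>\<^sub>\<le>\<^sub>0"
  shows "lerch_expansion l a holomorphic_on zeta_domain l"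
proof -
  have "(\<lambda>s. (if l = 1 then 1 else 0) * a powr (1 - s) / (s - 1)) holomorphic_on zeta_domain l"
  proof (cases "l = 1")
    case True
    then show ?thesis using a by (auto intro!: holomorphic_intros simp: zeta_domain_def)
  qed simp
  moreover have "(\<lambda>s. \<Sum>m. remainder_pair l s a m) holomorphic_on zeta_domain l"
    using holomorphic_suminf_remainder_pair[OF l a] by (rule holomorphic_on_subset) simp
  moreover have "(\<lambda>s. a powr (- s) * lerch_constant l) holomorphic_on zeta_domain l"
    using a by (intro holomorphic_intros) auto
  ultimately show ?thesis
    unfolding lerch_expansion_def by (intro holomorphic_on_add)
qed

lemma zeta_domain_geometry:
  "open (zeta_domain l)" "connected (zeta_domain l)" "open {s. 1 < Re s}" "{s. 1 < Re s} \<noteq> {}"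
  "{s. 1 < Re s} \<subseteq> zeta_domain l"
proof -
  show "open (zeta_domain l)" by (simp add: zeta_domain_def open_Compl)
  show "connected (zeta_domain l)"
    by (simp add: zeta_domain_def connected_punctured_universe convex_connected)
  show "open {s. 1 < Re s}" by (rule open_halfspace_Re_gt)
  have "2 \<in> {s. 1 < Re s}" by simp
  then show "{s. 1 < Re s} \<noteq> {}" by blast
  show "{s. 1 < Re s} \<subseteq> zeta_domain l" by (auto simp: zeta_domain_def)
qed

lemma lerch_eq_expansion:
  assumes l: "0 < l" "l \<le> 1" and a: "a \<notin> \<real>\<^sub>\<le>\<^sub>0" and s: "s \<in> zeta_domain l"
  shows "lerch l a s = lerch_expansion l a s"
  unfolding lerch_def
  by (rule analytic_cont_eqI[OF zeta_domain_geometry holomorphic_lerch_expansion[OF l a] _ s])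
     (use sums_unique[OF lerch_series_sums[OF l a]] in auto)

text \<open>
  \<open>F(\<lambda>,s) = e\<^sup>2\<^sup>\<pi>\<^sup>i\<^sup>\<lambda> L(\<lambda>,1,s)\<close>, and at \<open>s = 0\<close> all remainders vanish because of their factor \<open>s\<close>.
\<close>

lemma periodic_zeta_0:
  assumes l: "0 < l" "l \<le> 1"
  shows "1 + periodic_zeta l 0 = lerch_constant l"
proof -
  define \<omega> :: complex where "\<omega> = exp (2 * of_real pi * \<i> * of_real l)"
  have one: "(1::complex) \<notin> \<real>\<^sub>\<le>\<^sub>0" by simp
  have F0: "periodic_zeta l 0 = \<omega> * lerch_expansion l 1 0"
    unfolding periodic_zeta_def
  proof (rule analytic_cont_eqI[OF zeta_domain_geometry])
    show "(\<lambda>s. \<omega> * lerch_expansion l 1 s) holomorphic_on zeta_domain l"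
      by (intro holomorphic_intros holomorphic_lerch_expansion l one)
    show "0 \<in> zeta_domain l" by (simp add: zeta_domain_def)
    fix s :: complex assume "s \<in> {s. 1 < Re s}"
    then have "(\<lambda>n. \<omega> * (exp (2 * of_real pi * of_nat n * \<i> * of_real l) / (of_nat n + 1) powr s))
        sums (\<omega> * lerch_expansion l 1 s)"
      by (intro sums_mult lerch_series_sums l one) auto
    moreover have "\<omega> * (exp (2 * of_real pi * of_nat n * \<i> * of_real l) / (of_nat n + 1) powr s)
        = exp (2 * of_real pi * of_nat (Suc n) * \<i> * of_real l) / of_nat (Suc n) powr s" for n
      by (simp add: \<omega>_def algebra_simps flip: exp_add)
    ultimately show "\<omega> * lerch_expansion l 1 s
        = (\<Sum>n. exp (2 * of_real pi * of_nat (Suc n) * \<i> * of_real l) / of_nat (Suc n) powr s)"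
      by (simp add: sums_iff)
  qed
  have L0: "lerch_expansion l 1 0 = - (if l = 1 then 1 else 0) + lerch_constant l"
    by (simp add: lerch_expansion_def remainder_pair_def boundary_remainder_def)
  have const: "lerch_constant l = (if l = 1 then 1 / 2 else 1 / (1 - \<omega>))"
    by (simp add: lerch_constant_def \<omega>_def)
  show ?thesis
  proof (cases "l = 1")
    case True
    then have "\<omega> = 1" using exp_2pi_int[of 1] by (simp add: \<omega>_def)
    then show ?thesis using True F0 L0 const by simp
  next
    case False
    then have "\<omega> \<noteq> 1" unfolding \<omega>_def using l by (intro exp_2pi_neq_1) auto
    then have "1 + \<omega> * (1 / (1 - \<omega>)) = 1 / (1 - \<omega>)" by (simp add: divide_simps)
    then show ?thesis using False F0 L0 const by simp
  qed
qed

section \<open>Terminants, truncated expansions and their rearrangement\<close>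

text \<open>
  Iterated integration by parts. The left-hand side is the case \<open>N = 1\<close>; each further step splits off one more term.
\<close>

lemma boundary_remainder_expansion:
  assumes a: "a \<notin> \<real>\<^sub>\<le>\<^sub>0" and y: "y \<noteq> 0" and N: "1 \<le> N"
  shows "boundary_remainder y s a =
    - (\<Sum>r = 1..<N. pochhammer s r * a powr (- (of_nat r + s)) / (\<i> * of_real y) ^ (r + 1))
    + pochhammer s N / (\<i> * of_real y) ^ N * power_transform y (of_nat N + s) a"
  using N
proof (induction N rule: dec_induct)
  case base
  then show ?case by (simp add: boundary_remainder_def add.commute)
next
  case (step N)
  define b where "b = \<i> * of_real y"
  have b: "b \<noteq> 0" using y by (simp add: b_def)
  define q where "q = power_transform y (of_nat N + s) a"
  define q' where "q' = power_transform y (of_nat (Suc N) + s) a"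
  define p where "p = a powr (- (of_nat N + s))"
  have "b * q = (of_nat N + s) * q' - p"
    using power_transform_recurrence[OF a y, of "of_nat N + s"]
    by (simp add: b_def q_def q'_def p_def add_ac)
  then have q: "q = ((of_nat N + s) * q' - p) / b" using b by (simp add: field_simps)
  have A: "pochhammer s N / b ^ N * q
      = pochhammer s (Suc N) / b ^ Suc N * q' - pochhammer s N * p / b ^ (N + 1)"
    unfolding q pochhammer_Suc using b by (simp add: field_simps)
  have B: "(\<Sum>r = 1..<Suc N. pochhammer s r * a powr (- (of_nat r + s)) / b ^ (r + 1))
      = (\<Sum>r = 1..<N. pochhammer s r * a powr (- (of_nat r + s)) / b ^ (r + 1)) + pochhammer s N * p / b ^ (N + 1)"
    unfolding p_def using step.hyps by (intro sum.atLeastLessThan_Suc)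
  show ?case
    unfolding step.IH b_def[symmetric] q_def[symmetric] q'_def[symmetric] A B
    by (simp only: minus_add_distrib) simp
qed

text \<open>
  The sign \<open>\<tau>\<close> treats the frequencies \<open>2\<pi>(m+\<lambda>)\<close> (\<open>\<tau> = 1\<close>) and \<open>-2\<pi>(m+\<lambda>')\<close> (\<open>\<tau> = -1\<close>) together, here and below.
\<close>

lemma Ln_imaginary:
  fixes \<tau> x :: real
  assumes \<tau>: "\<tau> = 1 \<or> \<tau> = - 1" and x: "0 < x"
  shows "Ln (- (\<i> * of_real (\<tau> * x))) = of_real (ln x) - of_real \<tau> * (of_real pi / 2) * \<i>"
proof -
  have "Ln (- (\<i> * of_real (\<tau> * x))) = Ln (of_real x * (- (\<i> * of_real \<tau>)))"
    by (simp add: mult_ac)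
  also have "\<dots> = of_real (ln x) + Ln (- (\<i> * of_real \<tau>))"
    using x \<tau> by (subst Ln_times_of_real) (auto simp: Ln_of_real)
  also have "Ln (- (\<i> * of_real \<tau>)) = - (of_real \<tau> * (of_real pi / 2) * \<i>)"
    using \<tau> by auto
  finally show ?thesis by simp
qed

lemma powr_of_real_mult:
  fixes z w :: complex
  assumes "0 < c" "z \<noteq> 0"
  shows "(of_real c * z) powr w = of_real c powr w * z powr w"
  using assms by (simp add: powr_def Ln_times_of_real Ln_of_real distrib_left exp_add)

text \<open>
  The part of \<open>gamma_zeta_sum\<close> that comes from a single term of the zeta series.
\<close>

definition asymptotic_sum :: "complex \<Rightarrow> complex \<Rightarrow> complex \<Rightarrow> nat \<Rightarrow> real \<Rightarrow> complex"
  where "asymptotic_sum j a s N x =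
    (\<Sum>r = 1..<N. j ^ r * Gamma (of_nat r + s) / (2 * of_real pi * a) powr (of_nat r + s) * (1 / of_real x ^ (r + 1)))"

text \<open>
  The factor \<open>(\<mp>i)\<^sup>r\<close> is produced by the powers of \<open>1/(iy)\<close>, and \<open>\<Gamma>(r+s)/\<Gamma>(s)\<close> by the factors
  \<open>s, s+1, \<dots>\<close> of the recurrence.
\<close>

lemma asymptotic_sum_scaled:
  assumes \<tau>: "\<tau> = 1 \<or> \<tau> = - 1" and x: "0 < x" and s: "s \<notin> \<int>\<^sub>\<le>\<^sub>0" and a: "a \<noteq> 0"
  shows "of_real (2 * pi) powr s / Gamma s * (of_real \<tau> * (\<i> / (2 * of_real pi)) * asymptotic_sum (- (of_real \<tau> * \<i>)) a s N x)
    = - (\<Sum>r = 1..<N. pochhammer s r * a powr (- (of_nat r + s)) / (\<i> * of_real (\<tau> * (2 * pi * x))) ^ (r + 1))"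
proof -
  have "of_real (2 * pi) powr s / Gamma s * (of_real \<tau> * (\<i> / (2 * of_real pi)) *
      ((- (of_real \<tau> * \<i>)) ^ r * Gamma (of_nat r + s) / (2 * of_real pi * a) powr (of_nat r + s) * (1 / of_real x ^ (r + 1))))
    = - (pochhammer s r * a powr (- (of_nat r + s)) / (\<i> * of_real (\<tau> * (2 * pi * x))) ^ (r + 1))" for r
  proof -
    define t :: complex where "t = of_real (2 * pi)"
    have t: "t \<noteq> 0" by (simp add: t_def)
    have G: "Gamma (of_nat r + s) = pochhammer s r * Gamma s" "Gamma s \<noteq> 0"
      using pochhammer_Gamma[OF s, of r] s by (simp_all add: Gamma_eq_zero_iff add.commute)
    have "(2 * of_real pi * a) powr (of_nat r + s) = t powr (of_nat r + s) * a powr (of_nat r + s)"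
      using powr_of_real_mult[of "2 * pi" a "of_nat r + s"] a by (simp add: t_def)
    also have "t powr (of_nat r + s) = t ^ r * t powr s"
      using t by (simp add: powr_add)
    finally have P: "(2 * of_real pi * a) powr (of_nat r + s) = t ^ r * t powr s * a powr (of_nat r + s)" .
    have am: "a powr (- (of_nat r + s)) = 1 / a powr (of_nat r + s)"
      by (rule powr_minus_divide)
    define u where "u = - (of_real \<tau> * \<i>)"
    have u: "u * (of_real \<tau> * \<i>) = 1" using \<tau> by (auto simp: u_def)
    have "(\<i> * of_real (\<tau> * (2 * pi * x))) ^ (r + 1) = (of_real \<tau> * \<i>) ^ (r + 1) * t ^ (r + 1) * of_real x ^ (r + 1)"
      by (simp only: power_mult_distrib[symmetric]) (simp add: t_def mult_ac)
    then have Y: "1 / (\<i> * of_real (\<tau> * (2 * pi * x))) ^ (r + 1) = u ^ (r + 1) / (t ^ (r + 1) * of_real x ^ (r + 1))"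
    proof -
      have "u ^ (r + 1) * (of_real \<tau> * \<i>) ^ (r + 1) = 1"
        unfolding power_mult_distrib[symmetric] u by simp
      then have "1 / (of_real \<tau> * \<i>) ^ (r + 1) = u ^ (r + 1)"
        by (metis divide_eq_eq mult_zero_right zero_neq_one)
      then show ?thesis
        using \<open>(\<i> * of_real (\<tau> * (2 * pi * x))) ^ (r + 1) = _\<close>
        by (simp only: divide_divide_eq_left[symmetric] mult.assoc)
    qed
    have "t powr s / Gamma s * (of_real \<tau> * (\<i> / t) *
        (u ^ r * (pochhammer s r * Gamma s) / (t ^ r * t powr s * a powr (of_nat r + s)) * (1 / of_real x ^ (r + 1))))
      = (of_real \<tau> * \<i>) * u ^ r * pochhammer s r * (1 / a powr (of_nat r + s)) / (t ^ (r + 1) * of_real x ^ (r + 1))"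
      using G(2) t x a by (simp add: field_simps)
    also have "(of_real \<tau> * \<i>) * u ^ r = - (u ^ (r + 1))" by (simp add: u_def)
    also have "- (u ^ (r + 1)) * pochhammer s r * (1 / a powr (of_nat r + s)) / (t ^ (r + 1) * of_real x ^ (r + 1))
      = - (pochhammer s r * (1 / a powr (of_nat r + s)) * (u ^ (r + 1) / (t ^ (r + 1) * of_real x ^ (r + 1))))"
      by simp
    also have "\<dots> = - (pochhammer s r * a powr (- (of_nat r + s)) / (\<i> * of_real (\<tau> * (2 * pi * x))) ^ (r + 1))"
      unfolding Y[symmetric] am by simp
    finally show ?thesis unfolding P G(1) u_def by (simp only: t_def of_real_mult of_real_numeral)
  qed
  then show ?thesis
    unfolding asymptotic_sum_def sum_distrib_left sum_negf[symmetric] by simp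
qed

text \<open>
  All elementary factors are collected: \<open>(-iy)\<^sup>s\<^sup>-\<^sup>1\<close> provides \<open>(2\<pi>)\<^sup>s\<^sup>-\<^sup>1\<close>, \<open>x\<^sup>s\<^sup>-\<^sup>1\<close>, the unit \<open>\<tau>i\<close> and
  \<open>e\<^sup>-\<^sup>\<tau>\<^sup>\<pi>\<^sup>i\<^sup>s\<^sup>/\<^sup>2\<close>, while the factor \<open>e\<^sup>\<pi>\<^sup>i\<^sup>\<nu>\<close> of the terminant and the \<open>e\<^sup>-\<^sup>\<pi>\<^sup>i\<^sup>s\<close> in front of it leave \<open>(-1)\<^sup>N\<close>.
\<close>

lemma terminant_scaled:
  fixes \<tau> x :: real
  assumes \<tau>: "\<tau> = 1 \<or> \<tau> = - 1" and x: "0 < x" and a: "a \<noteq> 0" and s: "s \<notin> \<int>\<^sub>\<le>\<^sub>0"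
  defines "y \<equiv> \<tau> * (2 * pi * x)"
  shows "of_real (2 * pi) powr s / Gamma s * (- of_real \<tau> * (exp (- of_real \<tau> * (1 / 2 * of_real pi * \<i> * s)) / of_real x powr (1 - s)
      * (exp (- (\<i> * of_real y * a) - of_real pi * \<i> * s)
         * terminant (of_nat N + s) (Ln a + Ln (- (\<i> * of_real y))))))
    = pochhammer s N / (\<i> * of_real y) ^ N * power_transform y (of_nat N + s) a"
proof -
  define b where "b = - (\<i> * of_real y)"
  define t :: complex where "t = of_real (2 * pi)"
  define J where "J = inc_Gamma (1 - (of_nat N + s)) (Ln a + Ln b)"
  have t: "t \<noteq> 0" by (simp add: t_def)
  have \<tau>0: "\<tau> \<noteq> 0" using \<tau> by auto
  have b0: "b \<noteq> 0" using x \<tau>0 by (simp add: b_def y_def)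
  have Ln_b: "Ln b = of_real (ln (2 * pi * x)) - of_real \<tau> * (of_real pi / 2) * \<i>"
    unfolding b_def y_def by (rule Ln_imaginary[OF \<tau>]) (use x in auto)
  have G: "Gamma (of_nat N + s) = pochhammer s N * Gamma s" "Gamma s \<noteq> 0"
    using pochhammer_Gamma[OF s, of N] s by (simp_all add: Gamma_eq_zero_iff add.commute)
  have q: "power_transform y (of_nat N + s) a = exp (- (\<i> * of_real y * a)) * b powr (of_nat N + s - 1) * J"
    by (simp add: power_transform_def b_def J_def)
  have bp: "b powr (of_nat N + s - 1) = b ^ N * b powr (s - 1)"
  proof -
    have "b powr (of_nat N + s - 1) = b powr (of_nat N + (s - 1))" by (simp add: algebra_simps)
    then show ?thesis using b0 by (simp only: powr_add) simp
  qed
  have bs: "b powr (s - 1) = t powr (s - 1) * of_real x powr (s - 1) * (of_real \<tau> * \<i>) * exp (- of_real \<tau> * (1 / 2 * of_real pi * \<i> * s))"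
  proof -
    have "b powr (s - 1) = exp ((s - 1) * of_real (ln (2 * pi * x))) * exp (- ((s - 1) * (of_real \<tau> * (of_real pi / 2) * \<i>)))"
      using b0 by (simp add: powr_def Ln_b algebra_simps flip: exp_add)
    also have "exp ((s - 1) * of_real (ln (2 * pi * x))) = (t * of_real x) powr (s - 1)"
      using x by (simp add: t_def powr_def Ln_of_real flip: of_real_mult)
    also have "(t * of_real x) powr (s - 1) = t powr (s - 1) * of_real x powr (s - 1)"
      unfolding t_def using x by (intro powr_of_real_mult) auto
    also have "exp (- ((s - 1) * (of_real \<tau> * (of_real pi / 2) * \<i>)))
        = exp (of_real \<tau> * (of_real pi / 2) * \<i>) * exp (- of_real \<tau> * (1 / 2 * of_real pi * \<i> * s))"
    proof -
      have "- ((s - 1) * (of_real \<tau> * (of_real pi / 2) * \<i>))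
          = of_real \<tau> * (of_real pi / 2) * \<i> + - of_real \<tau> * (1 / 2 * of_real pi * \<i> * s)"
        by (simp add: field_simps)
      then show ?thesis by (simp only: exp_add)
    qed
    also have "exp (of_real \<tau> * (of_real pi / 2) * \<i>) = of_real \<tau> * \<i>"
    proof -
      have "exp (\<i> * of_real pi / 2) = \<i>"
        using cis_conv_exp[of "pi / 2"] by simp
      then show ?thesis using \<tau> by (auto simp: mult.commute exp_minus)
    qed
    finally show ?thesis by (simp add: mult_ac)
  qed
  have sign: "exp (of_real pi * \<i> * (of_nat N + s)) * exp (- (of_real pi * \<i> * s)) = (- 1) ^ N"
  proof -
    have "exp (of_real pi * \<i> * (of_nat N + s)) * exp (- (of_real pi * \<i> * s)) = exp (of_nat N * (of_real pi * \<i>))"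
      by (simp add: algebra_simps flip: exp_add)
    also have "\<dots> = (exp (of_real pi * \<i>)) ^ N" by (rule exp_of_nat_mult)
    finally show ?thesis by simp
  qed
  have bN: "(\<i> * of_real y) ^ N * (- 1) ^ N = b ^ N"
    unfolding power_mult_distrib[symmetric] by (simp add: b_def)
  have m1: "(- 1) ^ N * (- 1) ^ N = (1::complex)" by (simp flip: power_mult_distrib)
  have iy: "(\<i> * of_real y) ^ N \<noteq> 0" using b0 by (simp add: b_def)
  define e where "e = exp (- of_real \<tau> * (1 / 2 * of_real pi * \<i> * s))"
  define w where "w = exp (- (\<i> * of_real y * a))"
  have lhs: "t powr s / Gamma s * (- of_real \<tau> * (e / of_real x powr (1 - s)
      * (exp (- (\<i> * of_real y * a) - of_real pi * \<i> * s)
         * (exp (of_real pi * \<i> * (of_nat N + s)) * Gamma (of_nat N + s) / (2 * of_real pi * \<i>) * J))))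
    = - (of_real \<tau> * e * t powr s * of_real x powr (s - 1) * w * (- 1) ^ N * pochhammer s N * J / (t * \<i>))"
  proof -
    have x1: "1 / of_real x powr (1 - s) = (of_real x :: complex) powr (s - 1)"
      using powr_minus_divide[of "of_real x :: complex" "1 - s"] by simp
    have "exp (- (\<i> * of_real y * a) - of_real pi * \<i> * s) = w * exp (- (of_real pi * \<i> * s))"
      by (simp add: w_def flip: exp_add)
    then have "exp (- (\<i> * of_real y * a) - of_real pi * \<i> * s)
         * (exp (of_real pi * \<i> * (of_nat N + s)) * Gamma (of_nat N + s) / (2 * of_real pi * \<i>) * J)
       = w * (exp (of_real pi * \<i> * (of_nat N + s)) * exp (- (of_real pi * \<i> * s))) * (pochhammer s N * Gamma s) * J / (t * \<i>)"
      unfolding G(1) by (simp add: t_def)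
    also have "\<dots> = w * (- 1) ^ N * pochhammer s N * Gamma s * J / (t * \<i>)"
      unfolding sign by simp
    finally have "t powr s / Gamma s * (- of_real \<tau> * (e * (1 / of_real x powr (1 - s))
      * (exp (- (\<i> * of_real y * a) - of_real pi * \<i> * s)
         * (exp (of_real pi * \<i> * (of_nat N + s)) * Gamma (of_nat N + s) / (2 * of_real pi * \<i>) * J))))
      = t powr s / Gamma s * (- of_real \<tau> * (e * of_real x powr (s - 1) * (w * (- 1) ^ N * pochhammer s N * Gamma s * J / (t * \<i>))))"
      unfolding x1 by (simp only:)
    also have "\<dots> = - (of_real \<tau> * e * t powr s * of_real x powr (s - 1) * w * (- 1) ^ N * pochhammer s N * J / (t * \<i>))"
      using G(2) t by (simp add: field_simps)
    finally show ?thesis by simp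
  qed
  have "pochhammer s N / (\<i> * of_real y) ^ N * power_transform y (of_nat N + s) a
     = pochhammer s N * (b ^ N / (\<i> * of_real y) ^ N) * w * (t powr (s - 1) * of_real x powr (s - 1) * (of_real \<tau> * \<i>) * e) * J"
    unfolding q bp bs by (simp add: w_def e_def)
  also have "b ^ N / (\<i> * of_real y) ^ N = (- 1) ^ N"
    unfolding bN[symmetric] using iy by simp
  also have "t powr (s - 1) = t powr s / t"
    using t by (simp add: powr_diff)
  also have "pochhammer s N * (- 1) ^ N * w * (t powr s / t * of_real x powr (s - 1) * (of_real \<tau> * \<i>) * e) * J
     = - (of_real \<tau> * e * t powr s * of_real x powr (s - 1) * w * (- 1) ^ N * pochhammer s N * J / (t * \<i>))"
    using t by (simp add: field_simps)
  finally show ?thesis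
    using lhs unfolding terminant_def t_def[symmetric] e_def[symmetric] b_def[symmetric] J_def[symmetric] by (simp only:)
qed

text \<open>
  The principal logarithms of \<open>a\<close> and \<open>-iy\<close> are added without reduction of the argument, so that their sum lies on the
  sheet that \<open>R_term\<close> and \<open>R_term'\<close> prescribe.
\<close>

lemma log_arg_point:
  assumes \<tau>: "\<tau> = 1 \<or> \<tau> = - 1" and x: "0 < x" and a: "a \<noteq> 0"
  shows "Complex (ln (norm (2 * of_real pi * a * of_real x))) (Arg a - \<tau> * (pi / 2))
    = Ln a + Ln (- (\<i> * of_real (\<tau> * (2 * pi * x))))"
proof -
  have L: "Ln (- (\<i> * of_real (\<tau> * (2 * pi * x)))) = of_real (ln (2 * pi * x)) - of_real \<tau> * (of_real pi / 2) * \<i>"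
    by (rule Ln_imaginary[OF \<tau>]) (use x in auto)
  have n: "norm (2 * of_real pi * a * of_real x) = norm a * (2 * pi * x)"
    using x by (simp add: norm_mult)
  have "ln (norm a * (2 * pi * x)) = ln (norm a) + ln (2 * pi * x)"
    using a x by (simp add: ln_mult_pos)
  then show ?thesis
    unfolding L n using a by (simp add: complex_eq_iff Arg_eq_Im_Ln)
qed

lemma hurwitz_zeta_rec:
  assumes "1 \<le> r" "0 < x"
  shows "hurwitz_zeta (of_nat r + 1) (of_real x) = 1 / of_real x ^ (r + 1) + hurwitz_zeta (of_nat r + 1) (of_real (x + 1))"
proof -
  define f where "f = (\<lambda>n. (of_nat n + of_real x :: complex) powr (- (of_nat r + 1)))"
  have f: "f n = 1 / (of_nat n + of_real x) ^ (r + 1)" for n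
  proof -
    have "of_real (real n + x) \<noteq> (0::complex)" unfolding of_real_eq_0_iff using assms by simp
    then have nz: "of_nat n + of_real x \<noteq> (0::complex)" by simp
    have "f n = 1 / (of_nat n + of_real x) powr (of_nat (r + 1))"
      unfolding f_def by (subst powr_minus_divide) (simp add: add.commute)
    then show ?thesis unfolding powr_complexpow[OF nz] .
  qed
  have "summable f"
  proof (rule summable_comparison_test')
    show "summable (\<lambda>m. inverse (real m ^ 2))"
      using inverse_power_summable[of 2, where 'a = real] by simp
    fix n :: nat assume n: "n \<ge> 1"
    have nm: "norm (of_nat n + of_real x :: complex) = real n + x"
      using assms norm_of_real[of "real n + x", where 'a = complex] by simp
    have "norm (f n) = inverse ((real n + x) ^ (r + 1))"
      unfolding f norm_divide norm_power nm by (simp add: divide_inverse)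
    also have "\<dots> \<le> inverse ((real n + x) ^ 2)"
      using n assms by (intro le_imp_inverse_le power_increasing) auto
    also have "\<dots> \<le> inverse (real n ^ 2)"
      using n assms by (intro le_imp_inverse_le power_mono) auto
    finally show "norm (f n) \<le> inverse (real n ^ 2)" .
  qed
  then have "suminf f = f 0 + (\<Sum>n. f (Suc n))"
    by (simp add: suminf_split_head)
  moreover have "(\<Sum>n. f (Suc n)) = hurwitz_zeta (of_nat r + 1) (of_real (x + 1))"
    by (simp add: hurwitz_zeta_def f_def add_ac)
  moreover have "suminf f = hurwitz_zeta (of_nat r + 1) (of_real x)"
    by (simp add: hurwitz_zeta_def f_def)
  ultimately show ?thesis by (simp add: f)
qed

lemma gamma_zeta_sum_split_head:
  assumes "0 < x"
  shows "gamma_zeta_sum j a s 1 N x = asymptotic_sum j a s N x + gamma_zeta_sum j a s 1 N (x + 1)"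
  unfolding gamma_zeta_sum_def asymptotic_sum_def sum.distrib[symmetric]
proof (rule sum.cong)
  fix r assume "r \<in> {1..<N}"
  then have "1 \<le> r" by simp
  from hurwitz_zeta_rec[OF this assms]
  show "j ^ r * Gamma (of_nat r + s) / (2 * of_real pi * a) powr (of_nat r + s) * hurwitz_zeta (of_nat r + 1) (of_real x)
    = j ^ r * Gamma (of_nat r + s) / (2 * of_real pi * a) powr (of_nat r + s) * (1 / of_real x ^ (r + 1))
      + j ^ r * Gamma (of_nat r + s) / (2 * of_real pi * a) powr (of_nat r + s) * hurwitz_zeta (of_nat r + 1) (of_real (x + 1))"
    by (simp only: distrib_left)
qed simp

text \<open>
  At each step the tail with truncation index \<open>N M\<close> and the next block \<open>N M \<le> r < N (Suc M)\<close> start at the same point, so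
  they merge into one sum; its first zeta term is then split off. For \<open>x = 0\<close> the first block must be empty.
\<close>

lemma gamma_zeta_sum_rearrange:
  assumes N: "strict_mono N" "\<And>k. 0 < N k" and x: "0 \<le> x" "x = 0 \<Longrightarrow> N 0 = 1"
  shows "(\<Sum>m\<le>M. gamma_zeta_sum j a s (prev_index N m) (N m) (real m + x))
    = (\<Sum>m\<le>M. asymptotic_sum j a s (N m) (real m + x)) + gamma_zeta_sum j a s 1 (N M) (real M + 1 + x)"
proof (induction M)
  case 0
  show ?case
  proof (cases "x = 0")
    case True
    then show ?thesis using x(2) by (simp add: prev_index_def gamma_zeta_sum_def asymptotic_sum_def)
  next
    case False
    then show ?thesis
      using gamma_zeta_sum_split_head[of x j a s "N 0"] x(1) by (simp add: prev_index_def add.commute)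
  qed
next
  case (Suc M)
  have le: "1 \<le> N M" "N M \<le> N (Suc M)"
    using N(2)[of M] strict_monoD[OF N(1), of M "Suc M"] by simp_all
  have "gamma_zeta_sum j a s 1 (N M) (real M + 1 + x) + gamma_zeta_sum j a s (N M) (N (Suc M)) (real M + 1 + x)
      = gamma_zeta_sum j a s 1 (N (Suc M)) (real M + 1 + x)"
    unfolding gamma_zeta_sum_def by (rule sum.atLeastLessThan_concat[OF le])
  also have "\<dots> = asymptotic_sum j a s (N (Suc M)) (real M + 1 + x) + gamma_zeta_sum j a s 1 (N (Suc M)) (real M + 1 + x + 1)"
    using x by (intro gamma_zeta_sum_split_head) simp
  finally have step: "gamma_zeta_sum j a s 1 (N M) (real M + 1 + x) + gamma_zeta_sum j a s (N M) (N (Suc M)) (real M + 1 + x)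
      = asymptotic_sum j a s (N (Suc M)) (real M + 1 + x) + gamma_zeta_sum j a s 1 (N (Suc M)) (real M + 1 + x + 1)" .
  have re: "real (Suc M) + x = real M + 1 + x" "real (Suc M) + 1 + x = real M + 1 + x + 1"
    "prev_index N (Suc M) = N M" by (simp_all add: prev_index_def)
  show ?case
    unfolding sum.atMost_Suc Suc.IH re using step by (simp only: add.assoc)
qed

lemma scaled_upper_term:
  assumes x: "0 < real m + l" and s: "s \<notin> \<int>\<^sub>\<le>\<^sub>0" and a: "a \<notin> \<real>\<^sub>\<le>\<^sub>0" and n: "1 \<le> n"
  shows "of_real (2 * pi) powr s / Gamma s * (\<i> / (2 * of_real pi) * asymptotic_sum (- \<i>) a s n (real m + l)
      - exp (- (1 / 2 * of_real pi * \<i> * s)) / of_real (real m + l) powr (1 - s) * R_term l a s n m)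
    = boundary_remainder (2 * pi * (real m + l)) s a"
proof -
  define x where "x = real m + l"
  have x0: "0 < x" and a0: "a \<noteq> 0" using x a by (auto simp: x_def)
  have X: "X_var l a m = 2 * of_real pi * a * of_real x" by (simp add: X_var_def x_def)
  have R: "R_term l a s n m = exp (- (\<i> * of_real (2 * pi * x) * a) - of_real pi * \<i> * s)
      * terminant (of_nat n + s) (Ln a + Ln (- (\<i> * of_real (2 * pi * x))))"
    using log_arg_point[of 1 x a] x0 a0 unfolding R_term_def X by (simp add: mult_ac)
  have y: "2 * pi * x \<noteq> 0" using x0 by simp
  have "of_real (2 * pi) powr s / Gamma s * (\<i> / (2 * of_real pi) * asymptotic_sum (- \<i>) a s n x)
    = - (\<Sum>r = 1..<n. pochhammer s r * a powr (- (of_nat r + s)) / (\<i> * of_real (2 * pi * x)) ^ (r + 1))"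
    using asymptotic_sum_scaled[of 1 x s a n] x0 a0 s by simp
  moreover have "of_real (2 * pi) powr s / Gamma s * - (exp (- (1 / 2 * of_real pi * \<i> * s)) / of_real x powr (1 - s) * R_term l a s n m)
    = pochhammer s n / (\<i> * of_real (2 * pi * x)) ^ n * power_transform (2 * pi * x) (of_nat n + s) a"
    using terminant_scaled[of 1 x a s n] x0 a0 s unfolding R by simp
  ultimately show ?thesis
    unfolding x_def[symmetric] diff_conv_add_uminus[of "_ * asymptotic_sum _ _ _ _ _"] distrib_left
      boundary_remainder_expansion[OF a y n, of s] by (simp only:)
qed

lemma scaled_lower_term:
  assumes x: "0 < real m + l" and s: "s \<notin> \<int>\<^sub>\<le>\<^sub>0" and a: "a \<notin> \<real>\<^sub>\<le>\<^sub>0" and n: "1 \<le> n"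
  shows "of_real (2 * pi) powr s / Gamma s * (- (\<i> / (2 * of_real pi) * asymptotic_sum \<i> a s n (real m + l))
      + exp (1 / 2 * of_real pi * \<i> * s) / of_real (real m + l) powr (1 - s) * R_term' l a s n m)
    = boundary_remainder (- (2 * pi * (real m + l))) s a"
proof -
  define x where "x = real m + l"
  have x0: "0 < x" and a0: "a \<noteq> 0" using x a by (auto simp: x_def)
  have X: "X_var l a m = 2 * of_real pi * a * of_real x" by (simp add: X_var_def x_def)
  have R: "R_term' l a s n m = exp (- (\<i> * of_real (- (2 * pi * x)) * a) - of_real pi * \<i> * s)
      * terminant (of_nat n + s) (Ln a + Ln (- (\<i> * of_real (- (2 * pi * x)))))"
    using log_arg_point[of "- 1" x a] x0 a0 unfolding R_term'_def X by (simp add: mult_ac)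
  have y: "- (2 * pi * x) \<noteq> 0" using x0 by simp
  have "of_real (2 * pi) powr s / Gamma s * (- (\<i> / (2 * of_real pi) * asymptotic_sum \<i> a s n x))
    = - (\<Sum>r = 1..<n. pochhammer s r * a powr (- (of_nat r + s)) / (\<i> * of_real (- (2 * pi * x))) ^ (r + 1))"
    using asymptotic_sum_scaled[of "- 1" x s a n] x0 a0 s by simp
  moreover have "of_real (2 * pi) powr s / Gamma s * (exp (1 / 2 * of_real pi * \<i> * s) / of_real x powr (1 - s) * R_term' l a s n m)
    = pochhammer s n / (\<i> * of_real (- (2 * pi * x))) ^ n * power_transform (- (2 * pi * x)) (of_nat n + s) a"
    using terminant_scaled[of "- 1" x a s n] x0 a0 s unfolding R by simp
  ultimately show ?thesis
    unfolding x_def[symmetric] distrib_left boundary_remainder_expansion[OF a y n, of s] by (simp only:)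
qed

section \<open>The expansion with terminants\<close>

theorem theorem2:
  fixes l l' :: real and s a :: complex and N N' :: "nat \<Rightarrow> nat"
  assumes "0 < l" "l \<le> 1" "l' = 1 - l"
    and "s \<notin> \<int>\<^sub>\<le>\<^sub>0" "l = 1 \<Longrightarrow> s \<noteq> 1"
    and "strict_mono N" "strict_mono N'" "\<And>k. N k > 0" "\<And>k. N' k > 0"
    and "\<And>k. Re (of_nat (N k) + s) > 0"
    and "\<And>k. \<not> (l = 1 \<and> k = 0) \<Longrightarrow> Re (of_nat (N' k) + s) > 0"
    and "l = 1 \<Longrightarrow> N' 0 = 1"
    and "a \<noteq> 0" "\<bar>Arg a\<bar> < pi"
    and "rearrangement_tail l l' N N' a s \<longlonglongrightarrow> 0"
  shows "summable (series_term l l' N N' a s) \<and>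
    lerch l a s =
      (if l = 1 then 1 else 0) * a powr (1 - s) / (s - 1)
      + a powr (- s) * (1 + periodic_zeta l 0)
      + of_real (2 * pi) powr s / Gamma s * (\<Sum>m. series_term l l' N N' a s m)"
proof -
  have l: "0 < l" "l \<le> 1" using assms by auto
  have a: "a \<notin> \<real>\<^sub>\<le>\<^sub>0"
  proof
    assume "a \<in> \<real>\<^sub>\<le>\<^sub>0"
    then have "Re a < 0 \<and> Im a = 0"
      using \<open>a \<noteq> 0\<close> by (auto simp: complex_nonpos_Reals_iff complex_eq_iff)
    then have "Arg a = pi" using Arg_eq_pi by blast
    with \<open>\<bar>Arg a\<bar> < pi\<close> show False by simp
  qed
  define c where "c = of_real (2 * pi) powr s / Gamma s"
  have c: "c \<noteq> 0" using \<open>s \<notin> \<int>\<^sub>\<le>\<^sub>0\<close> by (simp add: c_def Gamma_eq_zero_iff)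
  \<comment> \<open>\<open>A m\<close> and \<open>A' m\<close>: truncated expansion and terminant of one frequency, the combination that does not depend on the truncation index\<close>
  define A where "A = (\<lambda>m. \<i> / (2 * of_real pi) * asymptotic_sum (- \<i>) a s (N m) (real m + l)
    - exp (- (1 / 2 * of_real pi * \<i> * s)) / of_real (real m + l) powr (1 - s) * R_term l a s (N m) m)"
  define A' where "A' = (\<lambda>m. - (\<i> / (2 * of_real pi) * asymptotic_sum \<i> a s (N' m) (real m + l'))
    + (if l = 1 \<and> m = 0 then 0 else
        exp (1 / 2 * of_real pi * \<i> * s) / of_real (real m + l') powr (1 - s) * R_term' l' a s (N' m) m))"
  have A: "c * A m = boundary_remainder (freq l (int m)) s a" for m
    unfolding c_def A_def freq_nonneg_index
    by (rule scaled_upper_term) (use l a assms in \<open>auto simp: Suc_le_eq add_nonneg_pos\<close>)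
  have A': "c * A' m = boundary_remainder (freq l (- int m - 1)) s a" for m
  proof (cases "l = 1 \<and> m = 0")
    case True
    then have "freq l (- int m - 1) = 0" unfolding freq_neg_index by simp
    then show ?thesis using True assms(12) by (simp add: A'_def asymptotic_sum_def)
  next
    case False
    then have pos: "0 < real m + l'"
      using l \<open>l' = 1 - l\<close> by (cases "l = 1") auto
    show ?thesis
      unfolding c_def A'_def freq_neg_index if_not_P[OF False] \<open>l' = 1 - l\<close>[symmetric]
      by (rule scaled_lower_term[OF pos]) (use a assms in \<open>auto simp: Suc_le_eq\<close>)
  qed
  \<comment> \<open>for \<open>l = 1\<close> and \<open>m = 0\<close> the second sum is empty, since \<open>N' 0 = 1\<close>\<close>
  have H: "H_term l l' N N' a s m = gamma_zeta_sum (- \<i>) a s (prev_index N m) (N m) (real m + l)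
      - gamma_zeta_sum \<i> a s (prev_index N' m) (N' m) (real m + l')" for m
    unfolding H_term_def using assms(12) by (auto simp: prev_index_def gamma_zeta_sum_def)
  have partial: "(\<Sum>m\<le>M. series_term l l' N N' a s m)
      = (\<Sum>m\<le>M. A m + A' m) + \<i> / (2 * of_real pi) * rearrangement_tail l l' N N' a s M" for M
  proof -
    define k where "k = \<i> / (2 * of_real pi)"
    have up: "(\<Sum>m\<le>M. gamma_zeta_sum (- \<i>) a s (prev_index N m) (N m) (real m + l))
      = (\<Sum>m\<le>M. asymptotic_sum (- \<i>) a s (N m) (real m + l)) + gamma_zeta_sum (- \<i>) a s 1 (N M) (real M + 1 + l)"
      by (rule gamma_zeta_sum_rearrange) (use assms in auto)
    have low: "(\<Sum>m\<le>M. gamma_zeta_sum \<i> a s (prev_index N' m) (N' m) (real m + l'))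
      = (\<Sum>m\<le>M. asymptotic_sum \<i> a s (N' m) (real m + l')) + gamma_zeta_sum \<i> a s 1 (N' M) (real M + 1 + l')"
      by (rule gamma_zeta_sum_rearrange) (use assms in auto)
    have "series_term l l' N N' a s m = (A m + A' m)
        + k * ((gamma_zeta_sum (- \<i>) a s (prev_index N m) (N m) (real m + l) - asymptotic_sum (- \<i>) a s (N m) (real m + l))
             - (gamma_zeta_sum \<i> a s (prev_index N' m) (N' m) (real m + l') - asymptotic_sum \<i> a s (N' m) (real m + l')))" for m
      unfolding series_term_def H A_def A'_def k_def[symmetric] by (simp add: algebra_simps)
    then have "(\<Sum>m\<le>M. series_term l l' N N' a s m) = (\<Sum>m\<le>M. A m + A' m)
        + k * (((\<Sum>m\<le>M. gamma_zeta_sum (- \<i>) a s (prev_index N m) (N m) (real m + l)) - (\<Sum>m\<le>M. asymptotic_sum (- \<i>) a s (N m) (real m + l)))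
             - ((\<Sum>m\<le>M. gamma_zeta_sum \<i> a s (prev_index N' m) (N' m) (real m + l')) - (\<Sum>m\<le>M. asymptotic_sum \<i> a s (N' m) (real m + l'))))"
      by (simp only: sum.distrib sum_subtractf sum_distrib_left[symmetric])
    then show ?thesis
      unfolding up low rearrangement_tail_def k_def by simp
  qed
  have "c * (A m + A' m) = remainder_pair l s a m" for m
    unfolding distrib_left A A' remainder_pair_def by (rule refl)
  moreover have "remainder_pair l s a sums (\<Sum>m. remainder_pair l s a m)"
    by (rule summable_sums[OF summable_remainder_pair[OF l a]])
  ultimately have "(\<lambda>M. \<Sum>m\<le>M. c * (A m + A' m)) \<longlonglongrightarrow> (\<Sum>m. remainder_pair l s a m)"
    unfolding sums_def_le by simp
  moreover have "(\<lambda>M. c * (\<i> / (2 * of_real pi) * rearrangement_tail l l' N N' a s M)) \<longlonglongrightarrow> c * (\<i> / (2 * of_real pi) * 0)"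
    by (intro tendsto_intros assms(15))
  ultimately have "(\<lambda>M. (\<Sum>m\<le>M. c * (A m + A' m)) + c * (\<i> / (2 * of_real pi) * rearrangement_tail l l' N N' a s M))
      \<longlonglongrightarrow> (\<Sum>m. remainder_pair l s a m) + c * (\<i> / (2 * of_real pi) * 0)"
    by (rule tendsto_add)
  moreover have "(\<Sum>m\<le>M. c * (A m + A' m)) + c * (\<i> / (2 * of_real pi) * rearrangement_tail l l' N N' a s M)
      = (\<Sum>m\<le>M. c * series_term l l' N N' a s m)" for M
    unfolding sum_distrib_left[symmetric] partial by (rule distrib_left[symmetric])
  ultimately have "(\<lambda>m. c * series_term l l' N N' a s m) sums (\<Sum>m. remainder_pair l s a m)"
    unfolding sums_def_le by simp
  from sums_divide[OF this, of c]
  have "series_term l l' N N' a s sums ((\<Sum>m. remainder_pair l s a m) / c)"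
    using c by simp
  then have sum: "summable (series_term l l' N N' a s)"
    and val: "c * (\<Sum>m. series_term l l' N N' a s m) = (\<Sum>m. remainder_pair l s a m)"
    using c by (auto simp: sums_iff)
  have "s \<in> zeta_domain l" using assms(5) by (auto simp: zeta_domain_def)
  from lerch_eq_expansion[OF l a this]
  have "lerch l a s = (if l = 1 then 1 else 0) * a powr (1 - s) / (s - 1) + a powr (- s) * (1 + periodic_zeta l 0)
      + c * (\<Sum>m. series_term l l' N N' a s m)"
    unfolding lerch_expansion_def val periodic_zeta_0[OF l] .
  with sum show ?thesis unfolding c_def by blast
qed

end
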